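(* Let $\mathcal{T},\Sigma\subset\mathbb{N}$ be such that $\mathcal{T}\times\Sigma\subset\mathbb{N}\times\mathbb{N}$ is fixed and finite. For each $n\ge 1$, let $f$ be a rule chosen uniformly at random from all $n^{n^2}$ functions $\mathbb{Z}_n^2\to\mathbb{Z}_n$, and let $\mathcal{R}_{\mathcal{T},\Sigma}$ be the (random) set of weakly robust periodic solutions of $f$ whose temporal period $\tau$ and spatial period $\sigma$ satisfy $(\tau,\sigma)\in\mathcal{T}\times\Sigma$. If there exists $(\tau,\sigma)\in\mathcal{T}\times\Sigma$ such that $\sigma\mid\tau$, then, as $n\to\infty$, $$\mathbb{P}(\mathcal{R}_{\mathcal{T},\Sigma}\neq\emptyset)=\frac{c(\mathcal{T},\Sigma)}{n}+o\left(\frac1n\right),$$ where $c(\mathcal{T},\Sigma)$ is a constant depending only on $\mathcal{T}$ and $\Sigma$.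
   Context: $\mathbb{N}=\{1,2,\dots\}$ and $\mathbb{Z}_n=\{0,\dots,n-1\}$. A rule is a function $f:\mathbb{Z}_n^2\to\mathbb{Z}_n$; it acts on configurations $\xi_t\in\mathbb{Z}_n^{\mathbb{Z}}$ by $\xi_{t+1}(x)=f(\xi_t(x-1),\xi_t(x))$ for all $x\in\mathbb{Z}$, $t\ge 0$. Periodic solution (PS): a configuration $\xi_0$ with $\xi_0(x+\sigma)=\xi_0(x)$ for all $x$ and $\xi_\tau=\xi_0$, where the positive integers $\sigma$ and $\tau$ are both minimal, gives a PS of $f$ with spatial period $\sigma$ and temporal period $\tau$. Spatial and temporal shifts of a PS are not distinguished. Weak robustness: let $\xi_0$ be a PS configuration under $f$. An initial configuration $\eta_0\in\mathbb{Z}_n^{\mathbb{Z}}$ is proper for $\xi_0$ if there is $y\in\mathbb{Z}$ with $\eta_0(x)=\xi_0(x)$ for all $x\le y$. Let $\xi_t,\eta_t$ be obtained by running $f$ from $\xi_0,\eta_0$; put $s_t(\eta_0)=\sup\{y\in\mathbb{Z}:\eta_t(x)=\xi_t(x)\text{ for all }x\le y\}$ and $v(\eta_0)=\liminf_{t\to\infty}s_t(\eta_0)/t$. The expansion velocity is $v=\inf\{v(\eta_0):\eta_0\text{ is proper for }\xi_0\}$. The PS is weakly robust (a WRPS) if $v>0$. *)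

theory Defs
  imports "HOL-Probability.Probability" "HOL-Library.Landau_Symbols"
begin

type_synonym config = "int \<Rightarrow> nat"
type_synonym ca_rule = "nat \<times> nat \<Rightarrow> nat"

text \<open>
  The state space \<open>\<int>\<^sub>n\<close> is \<open>{..<n}\<close>. Rules are extensional functions, so that
  \<open>rules n\<close> has exactly \<open>n ^ (n\<^sup>2)\<close> elements for \<open>n \<ge> 1\<close>.
\<close>

definition configs :: "nat \<Rightarrow> config set" where
  "configs n = {\<xi>. \<forall>x. \<xi> x < n}"

definition rules :: "nat \<Rightarrow> ca_rule set" where
  "rules n = ({..<n} \<times> {..<n}) \<rightarrow>\<^sub>E {..<n}"

definition step :: "ca_rule \<Rightarrow> config \<Rightarrow> config" where
  "step f \<xi> = (\<lambda>x. f (\<xi> (x - 1), \<xi> x))"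

definition run :: "ca_rule \<Rightarrow> config \<Rightarrow> nat \<Rightarrow> config" where
  "run f \<xi> t = (step f ^^ t) \<xi>"

definition spatial_period :: "config \<Rightarrow> nat \<Rightarrow> bool" where
  "spatial_period \<xi> \<sigma> \<longleftrightarrow>
     \<sigma> > 0 \<and> (\<forall>x. \<xi> (x + int \<sigma>) = \<xi> x) \<and>
     (\<forall>s. 0 < s \<and> s < \<sigma> \<longrightarrow> \<not> (\<forall>x. \<xi> (x + int s) = \<xi> x))"

definition temporal_period :: "ca_rule \<Rightarrow> config \<Rightarrow> nat \<Rightarrow> bool" where
  "temporal_period f \<xi> \<tau> \<longleftrightarrow>
     \<tau> > 0 \<and> run f \<xi> \<tau> = \<xi> \<and> (\<forall>t. 0 < t \<and> t < \<tau> \<longrightarrow> run f \<xi> t \<noteq> \<xi>)"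

definition is_PS :: "nat \<Rightarrow> ca_rule \<Rightarrow> nat \<Rightarrow> nat \<Rightarrow> config \<Rightarrow> bool" where
  "is_PS n f \<tau> \<sigma> \<xi> \<longleftrightarrow> \<xi> \<in> configs n \<and> spatial_period \<xi> \<sigma> \<and> temporal_period f \<xi> \<tau>"

definition proper :: "nat \<Rightarrow> config \<Rightarrow> config \<Rightarrow> bool" where
  "proper n \<xi> \<eta> \<longleftrightarrow> \<eta> \<in> configs n \<and> (\<exists>y. \<forall>x\<le>y. \<eta> x = \<xi> x)"

text \<open>
  The front is extended-real valued: it is \<open>\<infinity>\<close> when the two evolutions agree everywhere
  at time \<open>t\<close>.
\<close>

definition front :: "ca_rule \<Rightarrow> config \<Rightarrow> config \<Rightarrow> nat \<Rightarrow> ereal" where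
  "front f \<xi> \<eta> t =
     (SUP y\<in>{y::int. \<forall>x\<le>y. run f \<eta> t x = run f \<xi> t x}. ereal (real_of_int y))"

definition velocity :: "ca_rule \<Rightarrow> config \<Rightarrow> config \<Rightarrow> ereal" where
  "velocity f \<xi> \<eta> = liminf (\<lambda>t. front f \<xi> \<eta> t / ereal (real t))"

definition expansion_velocity :: "nat \<Rightarrow> ca_rule \<Rightarrow> config \<Rightarrow> ereal" where
  "expansion_velocity n f \<xi> = (INF \<eta>\<in>{\<eta>. proper n \<xi> \<eta>}. velocity f \<xi> \<eta>)"

definition weakly_robust :: "nat \<Rightarrow> ca_rule \<Rightarrow> config \<Rightarrow> bool" where
  "weakly_robust n f \<xi> \<longleftrightarrow> expansion_velocity n f \<xi> > 0"

text \<open>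
  Spatial and temporal shifts of a periodic solution are not distinguished, so the
  solution generated by \<open>\<xi>\<close> is the set of all space-time shifts of \<open>\<xi>\<close>.
\<close>

definition shift_class :: "ca_rule \<Rightarrow> config \<Rightarrow> config set" where
  "shift_class f \<xi> = {\<lambda>x. run f \<xi> t (x + y) | (t::nat) (y::int). True}"

definition WRPS :: "nat \<Rightarrow> ca_rule \<Rightarrow> nat set \<Rightarrow> nat set \<Rightarrow> config set set" where
  "WRPS n f T S =
     {shift_class f \<xi> | \<xi> \<tau> \<sigma>. (\<tau>, \<sigma>) \<in> T \<times> S \<and> is_PS n f \<tau> \<sigma> \<xi> \<and> weakly_robust n f \<xi>}"

definition random_rule :: "nat \<Rightarrow> ca_rule pmf" where
  "random_rule n = pmf_of_set (rules n)"

end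

theory Submission
  imports Defs
begin

text \<open>
  The column of \<open>\<xi>\<close> at \<open>x\<close> drives the evolution at \<open>x + 1\<close>, and \<open>\<xi>\<close> is weakly robust iff every driven
  orbit is attracted to the column at \<open>x + 1\<close>. For a column of \<open>\<tau>\<close> distinct states this is a collapse
  of a composition of \<open>\<tau>\<close> independent random maps, and a weighted Cayley formula shows that it has
  probability \<open>1 - (1 - 1 / n) ^ \<tau>\<close>, which is asymptotic to \<open>\<tau> / n\<close>.

  A space-time tile with \<open>k\<close> distinct states prescribes at least \<open>k\<close> entries of the rule. If it
  prescribes exactly \<open>k\<close>, equal states have equal surroundings, so any two columns either are
  rotations of each other or have no state in common. If the columns are rotations of each other by
  a shift \<open>h\<close>, one collapse makes all columns attracting, and each pair \<open>(\<tau>, h)\<close> contributes \<open>1 / n\<close> to the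
  expected number of periodic solutions; by the second moment, no two of them coexist up to \<open>o(1 / n)\<close>.
  Two disjoint columns have to collapse independently, at cost \<open>O(1 / n\<^sup>2)\<close>. Tiles that prescribe more
  than \<open>k\<close> entries have expected number \<open>O(1 / n)\<close>, and a collapse of their first column has probability
  \<open>o(1)\<close>, because a second moment argument yields other cycles of the driven dynamics.
\<close>

section \<open>Uniformly random rules\<close>

text \<open>Counting entries bounds the expected number of tiles with a surplus query only by a
  multiple of \<open>1 / n\<close>, the order of the main term, so part of the collapse has to be
  paid for as well. Instead of the full collapse only the absence of driven cycles outside the
  states \<open>V\<close> of the tile is used: the tile reads entries with second argument in
  \<open>V\<close>, the fresh cycles read the others, so the two events are independent. Cycles of
  length \<open>l * p\<close> have expected number about \<open>1 / l\<close>, and the divergence of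
  the harmonic series makes their total absence unlikely.

  Another obstacle is that a single column may have a smaller period than the whole solution.
  Attraction passes every period of a column on to its successor, and spatial periodicity closes the
  circle, so the first column has minimal period \<tau>. In a tile without surplus queries this
  makes the first two columns injective, as the exact collapse probability requires.\<close>

definition avg :: "nat \<Rightarrow> (ca_rule \<Rightarrow> real) \<Rightarrow> real" where
  "avg n h = (\<Sum>f\<in>rules n. h f) / real (card (rules n))"

abbreviation pr :: "nat \<Rightarrow> (ca_rule \<Rightarrow> bool) \<Rightarrow> real" where
  "pr n P \<equiv> avg n (\<lambda>f. of_bool (P f))"

lemma finite_rules [simp]: "finite (rules n)"
  unfolding rules_def by (intro finite_PiE) auto

lemma rules_ne [simp]: "rules n \<noteq> {}"
  unfolding rules_def by (auto simp: PiE_eq_empty_iff)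

lemma card_rules_pos [simp]: "0 < card (rules n)"
  by (simp add: card_gt_0_iff)

lemma rules_less: "f \<in> rules n \<Longrightarrow> a < n \<Longrightarrow> b < n \<Longrightarrow> f (a, b) < n"
  unfolding rules_def by (auto simp: PiE_iff)

lemma override_on_rules: "f \<in> rules n \<Longrightarrow> g \<in> rules n \<Longrightarrow> override_on f g I \<in> rules n"
  unfolding rules_def by (auto simp: PiE_iff override_on_def extensional_def)

lemma avg_const [simp]: "avg n (\<lambda>f. c) = c"
  by (simp add: avg_def)

lemma avg_mono: "(\<And>f. f \<in> rules n \<Longrightarrow> h f \<le> k f) \<Longrightarrow> avg n h \<le> avg n k"
  unfolding avg_def by (intro divide_right_mono sum_mono) auto

lemma avg_cong: "(\<And>f. f \<in> rules n \<Longrightarrow> h f = k f) \<Longrightarrow> avg n h = avg n k"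
  unfolding avg_def by (auto intro!: arg_cong2[where f="(/)"] sum.cong)

lemma avg_nonneg: "(\<And>f. f \<in> rules n \<Longrightarrow> 0 \<le> h f) \<Longrightarrow> 0 \<le> avg n h"
  unfolding avg_def by (intro divide_nonneg_nonneg sum_nonneg) auto

lemma avg_add: "avg n (\<lambda>f. h f + k f) = avg n h + avg n k"
  by (simp add: avg_def sum.distrib add_divide_distrib)

lemma avg_diff: "avg n (\<lambda>f. h f - k f) = avg n h - avg n k"
  by (simp add: avg_def sum_subtractf diff_divide_distrib)

lemma avg_cmult: "avg n (\<lambda>f. c * h f) = c * avg n h"
  by (simp add: avg_def sum_distrib_left)

lemma avg_multc: "avg n (\<lambda>f. h f * c) = avg n h * c"
  by (simp add: avg_def sum_distrib_right)

lemma avg_sum: "avg n (\<lambda>f. \<Sum>a\<in>A. h a f) = (\<Sum>a\<in>A. avg n (h a))"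
  unfolding avg_def by (subst sum.swap) (simp add: sum_divide_distrib)

lemma pr_mono: "(\<And>f. f \<in> rules n \<Longrightarrow> P f \<Longrightarrow> Q f) \<Longrightarrow> pr n P \<le> pr n Q"
  by (intro avg_mono) auto

lemma pr_nonneg [simp]: "0 \<le> pr n P"
  by (rule avg_nonneg) auto

lemma pr_eq_0: "(\<And>f. f \<in> rules n \<Longrightarrow> \<not> P f) \<Longrightarrow> pr n P = 0"
  using avg_cong[of n "\<lambda>f. of_bool (P f)" "\<lambda>f. 0"] by simp

lemma prob_random_rule: "measure_pmf.prob (random_rule n) {f. P f} = pr n P"
proof -
  have "(\<Sum>f\<in>rules n. of_bool (P f) :: real) = real (card (rules n \<inter> {f. P f}))"
    by (simp add: of_bool_def sum.If_cases)
  then show ?thesis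
    unfolding random_rule_def avg_def by (simp add: measure_pmf_of_set)
qed

text \<open>Replacing the entries of a uniform rule in \<open>I\<close> by those of an independent copy gives a
  uniform rule, because swapping those entries is an involution on pairs of rules.\<close>

lemma avg_resample: "avg n h = avg n (\<lambda>f. avg n (\<lambda>g. h (override_on f g I)))"
proof -
  let ?R = "rules n" and ?\<Phi> = "\<lambda>(f, g). (override_on f g I, override_on g f I)"
  have inv: "?\<Phi> (?\<Phi> p) = p" for p
    by (cases p) (auto simp: override_on_def fun_eq_iff)
  have "bij_betw ?\<Phi> (?R \<times> ?R) (?R \<times> ?R)"
    by (rule bij_betwI[where g = ?\<Phi>]) (use inv in \<open>auto simp: override_on_rules\<close>)
  then have "(\<Sum>p\<in>?R \<times> ?R. h (fst (?\<Phi> p))) = (\<Sum>p\<in>?R \<times> ?R. h (fst p))"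
    by (rule sum.reindex_bij_betw)
  then have "(\<Sum>f\<in>?R. \<Sum>g\<in>?R. h (override_on f g I)) = real (card ?R) * (\<Sum>f\<in>?R. h f)"
    using sum.cartesian_product[of "\<lambda>f g. h f" ?R ?R]
    by (simp add: sum.cartesian_product case_prod_unfold flip: sum_distrib_left)
  then show ?thesis
    by (simp add: avg_def sum_divide_distrib[symmetric])
qed

text \<open>Since \<open>override_on f g I\<close> takes its entries in \<open>I\<close> from
  \<open>g\<close>, the hypotheses say that \<open>P\<close> reads only entries in \<open>I\<close>
  and \<open>Q\<close> only the others. Resampling \<open>I\<close> then factors the
  average.\<close>

lemma pr_indep:
  assumes "\<And>f g. f \<in> rules n \<Longrightarrow> g \<in> rules n \<Longrightarrow> P (override_on f g I) = P g"
    and "\<And>f g. f \<in> rules n \<Longrightarrow> g \<in> rules n \<Longrightarrow> Q (override_on f g I) = Q f"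
  shows "pr n (\<lambda>f. P f \<and> Q f) = pr n P * pr n Q"
proof -
  have "pr n (\<lambda>f. P f \<and> Q f) = avg n (\<lambda>f. avg n (\<lambda>g. of_bool (Q f) * of_bool (P g)))"
    by (subst avg_resample[where I = I]) (auto intro!: avg_cong simp: assms)
  then show ?thesis
    by (simp add: avg_cmult avg_multc mult.commute)
qed

lemma pr_entries:
  assumes "Q \<subseteq> {..<n} \<times> {..<n}" and "\<And>q. q \<in> Q \<Longrightarrow> r q < n"
  shows "pr n (\<lambda>f. \<forall>q\<in>Q. f q = r q) = (1 / real n) ^ card Q"
proof -
  let ?X = "{..<n} \<times> {..<n}"
  have fin: "finite Q" "finite ?X"
    using assms(1) finite_subset by auto
  have eq: "rules n \<inter> {f. \<forall>q\<in>Q. f q = r q} = PiE ?X (\<lambda>q. if q \<in> Q then {r q} else {..<n})"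
  proof -
    have "(\<forall>i\<in>?X. f i < n) \<and> (\<forall>q\<in>Q. f q = r q) \<longleftrightarrow>
        (\<forall>i\<in>?X. f i \<in> (if i \<in> Q then {r i} else {..<n}))" for f :: ca_rule
      using subsetD[OF assms(1)] assms(2) by (smt (verit) lessThan_iff singletonD singletonI)
    note * = this
    have "f \<in> rules n \<inter> {f. \<forall>q\<in>Q. f q = r q} \<longleftrightarrow>
        ((\<forall>i\<in>?X. f i < n) \<and> (\<forall>q\<in>Q. f q = r q)) \<and> f \<in> extensional ?X" for f
      unfolding rules_def PiE_iff Int_iff mem_Collect_eq lessThan_iff by (simp only: ac_simps)
    then show ?thesis
      unfolding * by (intro set_eqI) (simp only: PiE_iff)
  qed
  have "card (PiE ?X (\<lambda>q. if q \<in> Q then {r q} else {..<n})) = (\<Prod>q\<in>?X. if q \<in> Q then 1 else n)"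
    by (subst card_PiE) (auto intro!: prod.cong)
  also have "\<dots> = n ^ (n * n - card Q)"
    using assms(1) fin
    by (simp add: prod.If_cases card_Diff_subset Diff_eq[symmetric] Int_absorb1)
  finally have c: "card (rules n \<inter> {f. \<forall>q\<in>Q. f q = r q}) = n ^ (n * n - card Q)"
    by (simp add: eq)
  have R: "card (rules n) = n ^ (n * n)"
    unfolding rules_def by (simp add: card_PiE)
  have le: "card Q \<le> n * n"
    using card_mono[OF fin(2) assms(1)] by simp
  show ?thesis
  proof (cases "n = 0")
    case True
    then show ?thesis using assms(1) by simp
  next
    case False
    have "real n ^ (n * n) = real n ^ (n * n - card Q) * real n ^ card Q"
      using le by (simp add: power_add[symmetric])
    then show ?thesis
      using False c R
      by (simp add: avg_def of_bool_def sum.If_cases power_one_over field_simps)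
  qed
qed

lemma avg_entry:
  assumes "a < n" "b < n"
  shows "avg n (\<lambda>f. h (f (a, b))) = (\<Sum>y<n. h y) / real n"
proof -
  have "avg n (\<lambda>f. h (f (a, b))) = avg n (\<lambda>f. \<Sum>y<n. h y * of_bool (f (a, b) = y))"
    using rules_less[OF _ assms] by (intro avg_cong) (auto simp: of_bool_def if_distrib cong: if_cong)
  also have "\<dots> = (\<Sum>y<n. h y * pr n (\<lambda>f. f (a, b) = y))"
    by (simp only: avg_sum avg_cmult)
  also have "\<dots> = (\<Sum>y<n. h y * (1 / real n))"
  proof -
    have "pr n (\<lambda>f. f (a, b) = y) = 1 / real n" if "y < n" for y
      using assms that pr_entries[of "{(a, b)}" n "\<lambda>_. y"] by simp
    then show ?thesis by simp
  qed
  finally show ?thesis by (simp add: sum_divide_distrib)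
qed

section \<open>Attracting columns\<close>

text \<open>Equivalently, every orbit that starts in \<open>U\<close> leaves \<open>U\<close>; for
  finite \<open>U\<close> the graph of \<phi> on \<open>U\<close> is a forest whose roots are mapped
  outside. Closed sets avoid iterates and behave well when a vertex is contracted.\<close>

definition trapfree :: "('u \<Rightarrow> 'u) \<Rightarrow> 'u set \<Rightarrow> bool" where
  "trapfree \<phi> U \<longleftrightarrow> (\<forall>C\<subseteq>U. C \<noteq> {} \<longrightarrow> \<not> \<phi> ` C \<subseteq> C)"

lemma trapfree_cong: "(\<And>u. u \<in> U \<Longrightarrow> \<phi> u = \<psi> u) \<Longrightarrow> trapfree \<phi> U = trapfree \<psi> U"
  unfolding trapfree_def by (metis image_cong subsetD)

text \<open>If \<open>\<phi> x\<close> lies in \<open>U\<close>, the vertex \<open>x\<close> can be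
  contracted: arrows into \<open>x\<close> are redirected to \<open>\<phi> x\<close>. If
  \<open>\<phi> x\<close> lies outside \<open>insert x U\<close>, no closed set contains
  \<open>x\<close> or a vertex mapped to \<open>x\<close>, so \<open>x\<close> may be treated as
  exterior.\<close>

lemma trapfree_insert:
  assumes "x \<notin> U"
  shows "trapfree \<phi> (insert x U) \<longleftrightarrow> \<phi> x \<noteq> x \<and>
    (if \<phi> x \<in> U then trapfree (\<lambda>u. if \<phi> u = x then \<phi> x else \<phi> u) U else trapfree \<phi> U)"
    (is "?L \<longleftrightarrow> _ \<and> (if _ then trapfree ?\<psi> U else _)")
proof -
  consider "\<phi> x = x" | "\<phi> x \<noteq> x" "\<phi> x \<in> U" | "\<phi> x \<noteq> x" "\<phi> x \<notin> U" by blast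
  then show ?thesis
  proof cases
    case 1
    then have "{x} \<subseteq> insert x U \<and> {x} \<noteq> {} \<and> \<phi> ` {x} \<subseteq> {x}" by simp
    then have "\<not> ?L" unfolding trapfree_def by blast
    with 1 show ?thesis by simp
  next
    case 2
    have "?L \<longleftrightarrow> trapfree ?\<psi> U"
    proof (rule iffI)
      assume L: ?L
      show "trapfree ?\<psi> U" unfolding trapfree_def
      proof (intro allI impI notI)
        fix C assume C: "C \<subseteq> U" "C \<noteq> {}" "?\<psi> ` C \<subseteq> C"
        \<comment> \<open>Undoes the contraction: a vertex of \<open>C\<close> mapped to
          \<open>x\<close> was redirected to \<open>\<phi> x\<close>, so \<open>x\<close> is needed
          only if \<open>\<phi> x\<close> belongs to \<open>C\<close>.\<close>
        let ?D = "if \<phi> x \<in> C then insert x C else C"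
        have "\<phi> ` ?D \<subseteq> ?D"
          using C by (auto simp: image_subset_iff split: if_splits)
        moreover have "?D \<subseteq> insert x U" "?D \<noteq> {}" using C by auto
        ultimately show False using L unfolding trapfree_def by blast
      qed
    next
      assume R: "trapfree ?\<psi> U"
      show ?L unfolding trapfree_def
      proof (intro allI impI notI)
        fix C assume C: "C \<subseteq> insert x U" "C \<noteq> {}" "\<phi> ` C \<subseteq> C"
        have "C - {x} \<subseteq> U" using C by auto
        moreover have "C - {x} \<noteq> {}" using C 2 by blast
        moreover have "?\<psi> ` (C - {x}) \<subseteq> C - {x}"
          using imageI[of _ C \<phi>, THEN subsetD[OF C(3)]] 2 by auto
        ultimately show False using R unfolding trapfree_def by blast
      qed
    qed
    with 2 show ?thesis by simp
  next
    case 3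
    have "?L \<longleftrightarrow> trapfree \<phi> U"
    proof
      assume "trapfree \<phi> U"
      show ?L unfolding trapfree_def
      proof (intro allI impI notI)
        fix C assume C: "C \<subseteq> insert x U" "C \<noteq> {}" "\<phi> ` C \<subseteq> C"
        then have "x \<notin> C" using 3 by blast
        then show False using C \<open>trapfree \<phi> U\<close> unfolding trapfree_def by blast
      qed
    qed (auto simp: trapfree_def)
    with 3 show ?thesis by simp
  qed
qed

text \<open>A weighted form of Cayley's formula. Revealing the image of one vertex \<open>x\<close> either creates a
  loop, or merges \<open>x\<close> with another vertex of \<open>U\<close>, or removes \<open>x\<close> from \<open>U\<close>.\<close>

lemma pr_trapfree:
  assumes "n > 0" "a < n" "finite U" "U \<subseteq> {..<n}"
  shows "pr n (\<lambda>f. trapfree (\<lambda>u. W (f (a, u))) U) = 1 - real (card {y. y < n \<and> W y \<in> U}) / real n"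
  using assms(3,4)
proof (induction U arbitrary: W rule: finite_induct)
  case empty
  then show ?case by (simp add: trapfree_def)
next
  case (insert x U)
  define \<mu> where "\<mu> = (\<lambda>(W :: nat \<Rightarrow> nat) U. real (card {y. y < n \<and> W y \<in> U}) / real n)"
  have IH: "pr n (\<lambda>f. trapfree (\<lambda>u. W (f (a, u))) U) = 1 - \<mu> W U" for W
    using insert by (simp add: \<mu>_def)
  have x: "x < n" using insert by auto
  \<comment> \<open>Merging \<open>x\<close> with its image \<open>z\<close> replaces the map
    \<open>W\<close> by \<open>M z\<close>, which is why \<open>W\<close> varies in the induction.
    By the next fact, \<open>U\<close> inherits the weight of \<open>insert x U\<close>.\<close>
  define M where "M = (\<lambda>(z::nat) (v::nat). if W v = x then z else W v)"
  have \<mu>M: "\<mu> (M z) U = \<mu> W (insert x U)" if "z \<in> U" for z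
    using that insert.hyps unfolding \<mu>_def M_def by (auto intro!: arg_cong[where f=card])
  have \<mu>i: "real (card {y. y < n \<and> W y = x}) + real (card {y. y < n \<and> W y \<in> U})
      = real (card {y. y < n \<and> W y \<in> insert x U})"
    using insert.hyps
    by (subst of_nat_add[symmetric], subst card_Un_disjoint[symmetric])
       (auto intro!: arg_cong[where f=card])
  have "pr n (\<lambda>f. trapfree (\<lambda>u. W (f (a, u))) (insert x U))
    = avg n (\<lambda>f. pr n (\<lambda>g. trapfree (\<lambda>u. W (override_on g f {(a, x)} (a, u))) (insert x U)))"
  proof -
    have "pr n (\<lambda>f. trapfree (\<lambda>u. W (f (a, u))) (insert x U))
      = avg n (\<lambda>f. pr n (\<lambda>g. trapfree (\<lambda>u. W (override_on f g (- {(a, x)}) (a, u))) (insert x U)))"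
      by (rule avg_resample)
    moreover have "override_on f g (- {(a, x)}) = override_on g f {(a, x)}" for f g :: ca_rule
      by (auto simp: override_on_def fun_eq_iff)
    ultimately show ?thesis by simp
  qed
  also have "\<dots> = avg n (\<lambda>f. (if W (f (a, x)) = x then 0
      else if W (f (a, x)) \<in> U then 1 - \<mu> W (insert x U) else 1 - \<mu> W U))" (is "_ = avg n ?r")
  proof (rule avg_cong)
    fix f assume "f \<in> rules n"
    have "trapfree (\<lambda>u. W (override_on g f {(a, x)} (a, u))) (insert x U) \<longleftrightarrow>
       W (f (a, x)) \<noteq> x \<and> (if W (f (a, x)) \<in> U then trapfree (\<lambda>u. M (W (f (a, x))) (g (a, u))) U
        else trapfree (\<lambda>u. W (g (a, u))) U)" for g
      unfolding trapfree_insert[OF insert.hyps(2)]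
      by (intro conj_cong if_cong refl trapfree_cong)
         (use insert.hyps in \<open>auto simp: M_def override_on_def\<close>)
    then show "pr n (\<lambda>g. trapfree (\<lambda>u. W (override_on g f {(a, x)} (a, u))) (insert x U)) = ?r f"
      by (simp add: IH \<mu>M)
  qed
  also have "\<dots> = (\<Sum>y<n. if W y = x then 0 else if W y \<in> U then 1 - \<mu> W (insert x U) else 1 - \<mu> W U) / n"
    using avg_entry[OF assms(2) x, of "\<lambda>y. if W y = x then 0 else if W y \<in> U then 1 - \<mu> W (insert x U) else 1 - \<mu> W U"] .
  also have "\<dots> = 1 - \<mu> W (insert x U)"
  proof -
    let ?A = "{y. y < n \<and> W y = x}" and ?B = "{y. y < n \<and> W y \<in> U}"
    have "(\<Sum>y<n. if W y = x then 0 else if W y \<in> U then 1 - \<mu> W (insert x U) else 1 - \<mu> W U)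
      = (\<Sum>y<n. (1 - \<mu> W U) - (1 - \<mu> W U) * of_bool (W y = x)
          - (\<mu> W (insert x U) - \<mu> W U) * of_bool (W y \<in> U))"
      using insert.hyps by (intro sum.cong) auto
    also have "\<dots> = n * (1 - \<mu> W U) - (1 - \<mu> W U) * card ?A - (\<mu> W (insert x U) - \<mu> W U) * card ?B"
      by (simp add: sum_subtractf sum_distrib_left[symmetric] of_bool_def sum.If_cases
          lessThan_def Collect_conj_eq[symmetric])
    also have "\<dots> = n * (1 - \<mu> W (insert x U))"
    proof -
      \<comment> \<open>With \<open>a = A / n\<close> and \<open>b = B / n\<close> the claim divided
        by \<open>n\<close> reads \<open>(1 - b) - (1 - b) * a - a * b = 1 - a - b\<close>.\<close>
      define A B where "A = real (card ?A)" and "B = real (card ?B)"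
      have *: "\<mu> W (insert x U) = (A + B) / n" "\<mu> W U = B / n"
        using \<mu>i by (simp_all add: \<mu>_def A_def B_def)
      show ?thesis using assms(1) unfolding A_def[symmetric] B_def[symmetric] *
        by (simp add: field_simps)
    qed
    finally show ?thesis using assms(1) by simp
  qed
  finally show ?case by (simp add: \<mu>_def)
qed

section \<open>Orbits driven by a column and their attraction to the next column\<close>

fun orb :: "ca_rule \<Rightarrow> (int \<Rightarrow> nat) \<Rightarrow> nat \<Rightarrow> nat \<Rightarrow> nat" where
  "orb f c x 0 = x"
| "orb f c x (Suc s) = f (c (int s), orb f c x s)"

definition attracts :: "nat \<Rightarrow> ca_rule \<Rightarrow> (int \<Rightarrow> nat) \<Rightarrow> (int \<Rightarrow> nat) \<Rightarrow> bool" where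
  "attracts n f c d \<longleftrightarrow> (\<forall>i. f (c i, d i) = d (i + 1)) \<and> (\<forall>x<n. \<exists>s. orb f c x s = d (int s))"

definition periodic :: "int \<Rightarrow> (int \<Rightarrow> 'a) \<Rightarrow> bool" where
  "periodic p c \<longleftrightarrow> (\<forall>i. c (i + p) = c i)"

lemma periodicD: "periodic p c \<Longrightarrow> c (i + p) = c i"
  by (simp add: periodic_def)

lemma periodic_mult:
  assumes "periodic p c" shows "c (i + k * p) = c i"
proof -
  have nat: "c (i + int m * p) = c i" for m i
  proof (induction m)
    case (Suc m)
    have "c (i + int (Suc m) * p) = c ((i + int m * p) + p)" by (simp add: algebra_simps)
    with Suc show ?case using assms by (simp add: periodic_def)
  qed simp
  show ?thesis
  proof (cases "k \<ge> 0")
    case True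
    then show ?thesis using nat[of i "nat k"] by simp
  next
    case False
    then show ?thesis using nat[of "i + k * p" "nat (- k)"] by (simp add: algebra_simps)
  qed
qed

lemma periodic_mod: "periodic p c \<Longrightarrow> c (i mod p) = c i"
  using periodic_mult[of p c i "- (i div p)"] by (simp add: minus_div_mult_eq_mod)

lemma periodic_cong: "periodic p c \<Longrightarrow> i mod p = j mod p \<Longrightarrow> c i = c j"
  by (metis periodic_mod)

lemma periodic_shift: "periodic p c \<Longrightarrow> periodic p (\<lambda>i. c (i + r))"
  unfolding periodic_def by (metis add.assoc add.commute)

lemma orb_less:
  assumes "f \<in> rules n" "\<And>i. c i < n" "x < n" shows "orb f c x s < n"
  by (induction s) (use assms rules_less in auto)

lemma orb_add: "orb f c x (r + s) = orb f (\<lambda>i. c (i + int r)) (orb f c x r) s"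
  by (induction s) (auto simp: algebra_simps)

lemma orb_attracted:
  assumes "\<And>i. f (c i, d i) = d (i + 1)" and "orb f c x s = d (int s)" and "s \<le> t"
  shows "orb f c x t = d (int t)"
  using assms(3)
proof (induction t rule: dec_induct)
  case (step t)
  then show ?case using assms(1)[of "int t"] by (simp add: add.commute)
qed (rule assms(2))

text \<open>The definition of \<open>attracts\<close> only treats orbits that start in phase 0. An
  orbit started in another phase is followed for \<open>s0\<close> steps, until the phase is 0
  modulo \<open>p\<close>; from there the definition applies.\<close>

lemma attracts_shift:
  assumes "attracts n f c d" "f \<in> rules n" "\<And>i. c i < n"
    and "p > 0" "periodic p c" "periodic p d"
  shows "attracts n f (\<lambda>i. c (i + r)) (\<lambda>i. d (i + r))"
proof -
  have "\<exists>s. orb f (\<lambda>i. c (i + r)) x s = d (int s + r)" if "x < n" for x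
  proof -
    define s0 where "s0 = nat ((- r) mod p)"
    have s0: "(int s0 + r) mod p = 0"
      using assms(4) by (simp add: s0_def mod_simps)
    have sh: "e (i + (int s0 + r)) = e i" if "periodic p e" for e :: "int \<Rightarrow> nat" and i
      using periodic_cong[OF that, of "i + (int s0 + r)" i] s0 by (metis add.right_neutral mod_add_right_eq)
    define y where "y = orb f (\<lambda>i. c (i + r)) x s0"
    have "y < n" unfolding y_def using assms(2,3) that by (intro orb_less) auto
    then obtain s where s: "orb f c y s = d (int s)"
      using assms(1) unfolding attracts_def by blast
    have "orb f (\<lambda>i. c (i + r)) x (s0 + s) = orb f (\<lambda>i. c (i + (int s0 + r))) y s"
      by (simp add: orb_add y_def algebra_simps)
    also have "\<dots> = d (int s)" using s sh[OF assms(5)] by simp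
    also have "\<dots> = d (int (s0 + s) + r)" using sh[OF assms(6), of "int s"] by (simp add: algebra_simps)
    finally show ?thesis by blast
  qed
  moreover have "f (c (i + r), d (i + r)) = d (i + 1 + r)" for i
    using assms(1) unfolding attracts_def by (metis add.assoc add.commute)
  ultimately show ?thesis unfolding attracts_def by simp
qed

text \<open>Once an orbit meets \<open>d\<close> it stays on \<open>d\<close>, so it suffices to
  look at times congruent to \<open>m\<close> and at the return map over one period. Phase
  \<open>m\<close> is chosen so that the return map applies the row \<open>c m\<close> before all
  others; it is then a fixed map after a random row, the shape treated by
  \<open>pr_trapfree\<close>.\<close>

lemma attracts_iff_trapfree:
  assumes f: "f \<in> rules n" and c: "\<And>i. c i < n" "periodic (int (Suc m)) c"
    and d: "\<And>i. d i < n" "periodic (int (Suc m)) d" "\<And>i. f (c i, d i) = d (i + 1)"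
  shows "attracts n f c d \<longleftrightarrow> trapfree (\<lambda>u. orb f c (f (c (int m), u)) m) ({..<n} - {d (int m)})"
proof -
  define \<phi> where "\<phi> = (\<lambda>u. orb f c (f (c (int m), u)) m)"
  have per: "c (i + int m + 1 + k * (int m + 1)) = c (i)" "d (i + int m + k * (int m + 1)) = d (i + int m)"  for i k
  proof -
    show "c (i + int m + 1 + k * (int m + 1)) = c i"
      using periodic_mult[OF c(2), of i "k + 1"] by (simp add: algebra_simps)
    show "d (i + int m + k * (int m + 1)) = d (i + int m)"
      using periodic_mult[OF d(2), of "i + int m" "k"] by (simp add: algebra_simps)
  qed
  have iter: "orb f c x (m + k * Suc m) = (\<phi> ^^ k) (orb f c x m)" for x k
  proof (induction k)
    case (Suc k)
    have "orb f c x (m + Suc k * Suc m) = orb f c x ((m + k * Suc m) + Suc m)" by (simp add: algebra_simps)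
    also have "\<dots> = orb f (\<lambda>i. c (i + int (m + k * Suc m))) (orb f c x (m + k * Suc m)) (1 + m)"
      by (subst orb_add) simp
    also have "\<dots> = orb f (\<lambda>i. c (i + int (m + k * Suc m) + 1)) (f (c (int (m + k * Suc m)), orb f c x (m + k * Suc m))) m"
      by (subst orb_add) (simp add: algebra_simps)
    also have "(\<lambda>i. c (i + int (m + k * Suc m) + 1)) = c"
      using per(1)[of _ "int k"] by (simp add: algebra_simps fun_eq_iff)
    also have "c (int (m + k * Suc m)) = c (int m)"
      using periodic_mult[OF c(2), of "int m" "int k"] by (simp add: algebra_simps)
    also have "orb f c (f (c (int m), orb f c x (m + k * Suc m))) m = (\<phi> ^^ Suc k) (orb f c x m)"
      using Suc by (simp add: \<phi>_def)
    finally show ?case .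
  qed simp
  have D: "d (int (m + k * Suc m)) = d (int m)" for k
    using per(2)[of 0 "int k"] by (simp add: algebra_simps)
  have \<phi>less: "\<phi> y < n" if "y < n" for y
    unfolding \<phi>_def using f c that by (intro orb_less[OF f] rules_less[OF f]) auto
  have "attracts n f c d \<longleftrightarrow> (\<forall>x<n. \<exists>s. orb f c x s = d (int s))"
    using d(3) by (simp add: attracts_def)
  also have "\<dots> \<longleftrightarrow> (\<forall>x<n. \<exists>k. (\<phi> ^^ k) (orb f c x m) = d (int m))"
  proof (intro all_cong iffI)
    fix x assume "\<exists>s. orb f c x s = d (int s)"
    then obtain s where "orb f c x s = d (int s)" by blast
    then have "orb f c x (m + s * Suc m) = d (int (m + s * Suc m))"
      by (rule orb_attracted[where d=d, OF d(3)]) simp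
    then show "\<exists>k. (\<phi> ^^ k) (orb f c x m) = d (int m)" using iter D by metis
  next
    fix x assume "\<exists>k. (\<phi> ^^ k) (orb f c x m) = d (int m)"
    then show "\<exists>s. orb f c x s = d (int s)" using iter D by metis
  qed
  also have "\<dots> \<longleftrightarrow> trapfree \<phi> ({..<n} - {d (int m)})"
  proof
    assume L: "\<forall>x<n. \<exists>k. (\<phi> ^^ k) (orb f c x m) = d (int m)"
    show "trapfree \<phi> ({..<n} - {d (int m)})" unfolding trapfree_def
    proof (intro allI impI notI)
      fix C assume C: "C \<subseteq> {..<n} - {d (int m)}" "C \<noteq> {}" "\<phi> ` C \<subseteq> C"
      then obtain y where y: "y \<in> C" by blast
      \<comment> \<open>\<open>L\<close> speaks of starts at time 0, so it is applied to the
        successor of \<open>y\<close>, whose orbit is at \<open>\<phi> y\<close> at time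
        \<open>m\<close>.\<close>
      have "f (c (int m), y) < n" using y C c by (intro rules_less[OF f]) auto
      then obtain k where "(\<phi> ^^ k) (\<phi> y) = d (int m)" using L by (auto simp: \<phi>_def)
      moreover have "(\<phi> ^^ k) (\<phi> y) \<in> C"
        by (induction k) (use y C in auto)
      ultimately show False using C by auto
    qed
  next
    assume R: "trapfree \<phi> ({..<n} - {d (int m)})"
    show "\<forall>x<n. \<exists>k. (\<phi> ^^ k) (orb f c x m) = d (int m)"
    proof (intro allI impI, rule ccontr)
      fix x assume x: "x < n" and no: "\<nexists>k. (\<phi> ^^ k) (orb f c x m) = d (int m)"
      let ?C = "range (\<lambda>k. (\<phi> ^^ k) (orb f c x m))"
      have "(\<phi> ^^ k) (orb f c x m) < n" for k
        by (induction k) (use x f c orb_less \<phi>less in auto)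
      then have "?C \<subseteq> {..<n} - {d (int m)}" using no by auto
      moreover have "\<phi> ` ?C \<subseteq> ?C"
        by (auto simp: image_iff) (metis funpow.simps(2) o_apply)
      ultimately show False using R unfolding trapfree_def by blast
    qed
  qed
  finally show ?thesis unfolding \<phi>_def .
qed

text \<open>The rows \<open>c 0\<close>, ..., \<open>c (s - 1)\<close> are distinct, so each step
  meets a fresh row. As long as the orbit differs from \<open>d\<close>, the step reads two
  different entries of this row: one has to take the prescribed value, the other has to miss it.
  This gives one factor \<open>1 / n\<close> and one factor \<open>1 - 1 / n\<close>.\<close>

lemma pr_orb_avoids:
  assumes "n > 0" "inj_on c {0..<int s}" "\<And>i. c i < n" "\<And>i. d i < n" "y < n" "y \<noteq> d 0"
  shows "pr n (\<lambda>f. (\<forall>i\<in>{0..<int s}. f (c i, d i) = d (i + 1)) \<and> orb f c y s \<noteq> d (int s))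
    = (1 / real n * (1 - 1 / real n)) ^ s"
  using assms(2)
proof (induction s)
  case 0
  then show ?case using assms by simp
next
  case (Suc s)
  define G where "G = (\<lambda>f. (\<forall>i\<in>{0..<int s}. f (c i, d i) = d (i + 1)) \<and> orb f c y s \<noteq> d (int s))"
  have IH: "pr n G = (1 / real n * (1 - 1 / real n)) ^ s"
    unfolding G_def using Suc.prems by (intro Suc.IH) (auto simp: inj_on_def)
  let ?I = "{c (int s)} \<times> UNIV"
  have ne: "c (int i) \<noteq> c (int s)" if "i < s" for i
    using inj_onD[OF Suc.prems, of "int i" "int s"] that by auto
  have orb: "orb (override_on f g ?I) c y i = orb f c y i" if "i \<le> s" for i f g
    using that by (induction i) (use ne in \<open>auto simp: override_on_def\<close>)
  have pre: "(\<forall>i\<in>{0..<int s}. (override_on f g ?I) (c i, d i) = d (i + 1))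
      \<longleftrightarrow> (\<forall>i\<in>{0..<int s}. f (c i, d i) = d (i + 1))" for f g
  proof -
    have "c i \<noteq> c (int s)" if "i \<in> {0..<int s}" for i
      using ne[of "nat i"] that by (auto simp: nat_less_iff)
    then show ?thesis by (intro ball_cong refl) (simp add: override_on_def)
  qed
  define H where "H = (\<lambda>f. \<forall>i\<in>{0..<int s}. f (c i, d i) = d (i + 1))"
  have split: "(\<forall>i\<in>{0..<int (Suc s)}. f (c i, d i) = d (i + 1))
      \<longleftrightarrow> f (c (int s), d (int s)) = d (int s + 1) \<and> H f" for f
  proof -
    have "{0..<int (Suc s)} = insert (int s) {0..<int s}" by auto
    then show ?thesis by (simp add: H_def)
  qed
  have H: "H (override_on f g ?I) = H f" for f g
    unfolding H_def by (rule pre)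
  have G: "G f \<longleftrightarrow> H f \<and> orb f c y s \<noteq> d (int s)" for f
    by (simp add: G_def H_def)
  have "pr n (\<lambda>f. (\<forall>i\<in>{0..<int (Suc s)}. f (c i, d i) = d (i + 1)) \<and> orb f c y (Suc s) \<noteq> d (int (Suc s)))
     = avg n (\<lambda>f. of_bool (G f) * (1 / real n * (1 - 1 / real n)))"
  proof (subst avg_resample[where I = ?I], rule avg_cong)
    fix f assume f: "f \<in> rules n"
    let ?z = "orb f c y s"
    have z: "?z < n" using f assms by (intro orb_less) auto
    have eq: "((\<forall>i\<in>{0..<int (Suc s)}. (override_on f g ?I) (c i, d i) = d (i + 1)) \<and>
        orb (override_on f g ?I) c y (Suc s) \<noteq> d (int (Suc s))) \<longleftrightarrow>
       G f \<and> g (c (int s), d (int s)) = d (int s + 1) \<and> g (c (int s), ?z) \<noteq> d (int s + 1)" for g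
    proof -
      have "override_on f g ?I (c (int s), b) = g (c (int s), b)" for b
        by (simp add: override_on_def)
      then show ?thesis
        unfolding split H G orb.simps(2) orb[OF order_refl]
        by (auto simp: add.commute)
    qed
    show "pr n (\<lambda>g. (\<forall>i\<in>{0..<int (Suc s)}. (override_on f g ?I) (c i, d i) = d (i + 1)) \<and>
        orb (override_on f g ?I) c y (Suc s) \<noteq> d (int (Suc s)))
      = of_bool (G f) * (1 / real n * (1 - 1 / real n))"
    proof (cases "G f")
      case True
      then have zd: "?z \<noteq> d (int s)" by (simp add: G_def)
      let ?a = "c (int s)" and ?w = "d (int s + 1)"
      have "pr n (\<lambda>g. g (?a, d (int s)) = ?w \<and> g (?a, ?z) \<noteq> ?w)
        = pr n (\<lambda>g. g (?a, d (int s)) = ?w) - pr n (\<lambda>g. g (?a, d (int s)) = ?w \<and> g (?a, ?z) = ?w)"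
        unfolding avg_diff[symmetric] by (intro avg_cong) auto
      also have "\<dots> = 1 / real n - (1 / real n)\<^sup>2"
        using pr_entries[of "{(?a, d (int s))}" n "\<lambda>_. ?w"]
          pr_entries[of "{(?a, d (int s)), (?a, ?z)}" n "\<lambda>_. ?w"] assms zd z
        by (simp add: power2_eq_square eq_commute[of "d (int s)"])
      finally show ?thesis using True unfolding eq by (simp add: power2_eq_square right_diff_distrib)
    next
      case False
      then show ?thesis unfolding eq by simp
    qed
  qed
  also have "\<dots> = (1 / real n * (1 - 1 / real n)) ^ Suc s"
    unfolding avg_multc IH by simp
  finally show ?case .
qed

lemma pr_pattern_inj:
  assumes "inj_on q J" "\<And>j. j \<in> J \<Longrightarrow> q j \<in> {..<n} \<times> {..<n}" "\<And>j. j \<in> J \<Longrightarrow> r j < n"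
  shows "pr n (\<lambda>f. \<forall>j\<in>J. f (q j) = r j) = (1 / real n) ^ card J"
proof -
  have "(\<forall>j\<in>J. f (q j) = r j) \<longleftrightarrow> (\<forall>z\<in>q ` J. f z = r (inv_into J q z))" for f
    using assms(1) by simp
  moreover have "pr n (\<lambda>f. \<forall>z\<in>q ` J. f z = r (inv_into J q z)) = (1 / real n) ^ card (q ` J)"
  proof (rule pr_entries)
    show "q ` J \<subseteq> {..<n} \<times> {..<n}" using assms(2) by blast
  qed (use assms in auto)
  ultimately show ?thesis using card_image[OF assms(1)] by simp
qed

text \<open>After the value \<open>d 0\<close> of the last row at \<open>d (p - 1)\<close> is fixed, the rest of that row is free,
  and \<open>pr_trapfree\<close> turns the probability of attraction into the probability that the orbit of a
  uniform point has met \<open>d\<close> by time \<open>p - 1\<close>.\<close>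

lemma pr_attracts:
  assumes "p > 0" "inj_on c {0..<int p}" "periodic (int p) c" "periodic (int p) d"
    and "\<And>i. c i < n" "\<And>i. d i < n"
  shows "pr n (\<lambda>f. attracts n f c d) = (1 / real n) ^ p * (1 - (1 - 1 / real n) ^ p)"
proof -
  obtain m where p: "p = Suc m" using assms(1) by (cases p) auto
  have n: "n > 0" using assms(5)[of 0] by simp
  let ?a = "c (int m)" and ?D = "d (int m)"
  have d0: "d (int m + 1) = d 0"
    using periodicD[OF assms(4), of 0] by (simp add: p add.commute)
  \<comment> \<open>The entry at \<open>?D\<close> is left out so that resampling \<open>I\<close>
    preserves \<open>G\<close>; orbits up to time \<open>m\<close> read only other rows and are
    preserved too.\<close>
  define I where "I = {(?a, b) |b. b \<noteq> ?D}"
  define G where "G = (\<lambda>f. \<forall>i\<in>{0..<int p}. f (c i, d i) = d (i + 1))"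
  have ne: "c (int i) \<noteq> c (int m)" if "i < m" for i
    using inj_onD[OF assms(2), of "int i" "int m"] that by (auto simp: p)
  have G_all: "G f \<longleftrightarrow> (\<forall>i. f (c i, d i) = d (i + 1))" for f
  proof
    assume G: "G f"
    show "\<forall>i. f (c i, d i) = d (i + 1)"
    proof
      fix i
      let ?j = "i mod int p"
      have "f (c ?j, d ?j) = d (?j + 1)" using G assms(1) by (simp add: G_def)
      moreover have "d (?j + 1) = d (i + 1)"
        by (rule periodic_cong[OF assms(4)]) (simp add: mod_simps)
      ultimately show "f (c i, d i) = d (i + 1)"
        using periodic_mod[OF assms(3)] periodic_mod[OF assms(4)] by simp
    qed
  qed (simp add: G_def)
  have orb: "orb (override_on f g I) c y i = orb f c y i" if "i \<le> m" for i f g y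
    using that by (induction i) (use ne in \<open>auto simp: override_on_def I_def\<close>)
  have GI: "G (override_on f g I) = G f" for f g
  proof -
    have "(c i, d i) \<notin> I" if "i \<in> {0..<int p}" for i
      using ne[of "nat i"] that by (cases "i = int m") (auto simp: I_def p nat_less_iff)
    then show ?thesis unfolding G_def by (intro ball_cong refl) (simp add: override_on_def)
  qed
  have "pr n (\<lambda>f. attracts n f c d) = pr n (\<lambda>f. G f \<and> trapfree (\<lambda>u. orb f c (f (?a, u)) m) ({..<n} - {?D}))"
  proof (rule avg_cong)
    fix f assume f: "f \<in> rules n"
    have "attracts n f c d \<longleftrightarrow> trapfree (\<lambda>u. orb f c (f (?a, u)) m) ({..<n} - {?D})" if "G f"
      using attracts_iff_trapfree[OF f assms(5)] assms(3,4,6) that by (simp add: G_all p)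
    moreover have "G f" if "attracts n f c d"
      using that by (simp add: G_all attracts_def)
    ultimately show "of_bool (attracts n f c d)
      = (of_bool (G f \<and> trapfree (\<lambda>u. orb f c (f (?a, u)) m) ({..<n} - {?D})) :: real)"
      by (cases "G f") auto
  qed
  also have "\<dots> = avg n (\<lambda>f. of_bool (G f) * (real (card {y. y < n \<and> orb f c y m = ?D}) / real n))"
  proof (subst avg_resample[where I = I], rule avg_cong)
    fix f assume f: "f \<in> rules n"
    have "trapfree (\<lambda>u. orb (override_on f g I) c (override_on f g I (?a, u)) m) ({..<n} - {?D})
      \<longleftrightarrow> trapfree (\<lambda>u. orb f c (g (?a, u)) m) ({..<n} - {?D})" for g
      by (intro trapfree_cong) (simp only: orb[OF order_refl], simp add: override_on_def I_def)
    then have "pr n (\<lambda>g. G (override_on f g I) \<and>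
        trapfree (\<lambda>u. orb (override_on f g I) c (override_on f g I (?a, u)) m) ({..<n} - {?D}))
      = of_bool (G f) * pr n (\<lambda>g. trapfree (\<lambda>u. orb f c (g (?a, u)) m) ({..<n} - {?D}))"
      by (simp add: GI avg_cmult)
    also have "pr n (\<lambda>g. trapfree (\<lambda>u. orb f c (g (?a, u)) m) ({..<n} - {?D}))
      = 1 - real (card {y. y < n \<and> orb f c y m \<in> {..<n} - {?D}}) / real n"
      using n assms(5) by (intro pr_trapfree[where W = "\<lambda>y. orb f c y m"]) auto
    also have "\<dots> = real (card {y. y < n \<and> orb f c y m = ?D}) / real n"
    proof -
      have "{y. y < n \<and> orb f c y m \<in> {..<n} - {?D}} = {..<n} - {y. y < n \<and> orb f c y m = ?D}"
        using orb_less[OF f assms(5)] by auto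
      moreover have "card ({..<n} - {y. y < n \<and> orb f c y m = ?D}) = n - card {y. y < n \<and> orb f c y m = ?D}"
        by (subst card_Diff_subset) auto
      moreover have "card {y. y < n \<and> orb f c y m = ?D} \<le> n"
        using card_mono[of "{..<n}" "{y. y < n \<and> orb f c y m = ?D}"] by auto
      ultimately show ?thesis using n by (simp add: of_nat_diff field_simps)
    qed
    finally show "pr n (\<lambda>g. G (override_on f g I) \<and>
        trapfree (\<lambda>u. orb (override_on f g I) c (override_on f g I (?a, u)) m) ({..<n} - {?D}))
      = of_bool (G f) * (real (card {y. y < n \<and> orb f c y m = ?D}) / real n)" .
  qed
  also have "\<dots> = avg n (\<lambda>f. (1 / n) * (\<Sum>y<n. of_bool (G f \<and> orb f c y m = ?D)))"
    by (intro avg_cong) (auto simp: of_bool_def sum.If_cases Collect_conj_eq lessThan_def)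
  also have "\<dots> = (1 / n) * (\<Sum>y<n. pr n (\<lambda>f. G f \<and> orb f c y m = ?D))"
    by (simp only: avg_cmult avg_sum)
  also have "(\<Sum>y<n. pr n (\<lambda>f. G f \<and> orb f c y m = ?D))
    = (\<Sum>y<n. (1 / real n) ^ p - of_bool (y \<noteq> d 0) * ((1 / n) * (1 / real n * (1 - 1 / real n)) ^ m))"
  proof (intro sum.cong refl)
    fix y assume "y \<in> {..<n}"
    then have y: "y < n" by simp
    define Q where "Q = (\<lambda>f. (\<forall>i\<in>{0..<int m}. f (c i, d i) = d (i + 1)))"
    have G_Q: "G f \<longleftrightarrow> f (?a, ?D) = d 0 \<and> Q f" for f
    proof -
      have "{0..<int p} = insert (int m) {0..<int m}" by (auto simp: p)
      then show ?thesis unfolding G_def Q_def using d0 by simp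
    qed
    have "pr n (\<lambda>f. f (?a, ?D) = d 0 \<and> (Q f \<and> orb f c y m \<noteq> ?D))
      = pr n (\<lambda>f. f (?a, ?D) = d 0) * pr n (\<lambda>f. Q f \<and> orb f c y m \<noteq> ?D)"
    proof (rule pr_indep[where I = "{?a} \<times> UNIV"])
      fix f g :: ca_rule
      have o: "orb (override_on f g ({?a} \<times> UNIV)) c y i = orb f c y i" if "i \<le> m" for i
        using that by (induction i) (use ne in \<open>auto simp: override_on_def\<close>)
      have "Q (override_on f g ({?a} \<times> UNIV)) = Q f"
      proof -
        have "c i \<noteq> ?a" if "i \<in> {0..<int m}" for i
          using ne[of "nat i"] that by (auto simp: nat_less_iff)
        then show ?thesis unfolding Q_def by (intro ball_cong refl) (simp add: override_on_def)
      qed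
      then show "(Q (override_on f g ({?a} \<times> UNIV)) \<and> orb (override_on f g ({?a} \<times> UNIV)) c y m \<noteq> ?D)
          = (Q f \<and> orb f c y m \<noteq> ?D)" using o by simp
    qed (simp add: override_on_def)
    also have "pr n (\<lambda>f. f (?a, ?D) = d 0) = 1 / n"
      using pr_entries[of "{(?a, ?D)}" n "\<lambda>_. d 0"] assms by simp
    also have "pr n (\<lambda>f. Q f \<and> orb f c y m \<noteq> ?D) = of_bool (y \<noteq> d 0) * (1 / real n * (1 - 1 / real n)) ^ m"
    proof (cases "y = d 0")
      case True
      have "orb f c y m = ?D" if Q: "Q f" for f
      proof -
        have "orb f c y i = d (int i)" if "i \<le> m" for i
          using that
        proof (induction i)
          case (Suc i)
          then have "f (c (int i), d (int i)) = d (int i + 1)" using Q by (auto simp: Q_def)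
          then show ?case using Suc by (simp add: add.commute)
        qed (simp add: True)
        then show ?thesis by simp
      qed
      then have "pr n (\<lambda>f. Q f \<and> orb f c y m \<noteq> ?D) = 0" by (intro pr_eq_0) blast
      with True show ?thesis by simp
    next
      case False
      then show ?thesis unfolding Q_def
        using assms(2,5,6) y n by (subst pr_orb_avoids) (auto simp: p inj_on_def)
    qed
    finally have miss: "pr n (\<lambda>f. f (?a, ?D) = d 0 \<and> (Q f \<and> orb f c y m \<noteq> ?D))
      = of_bool (y \<noteq> d 0) * ((1 / n) * (1 / real n * (1 - 1 / real n)) ^ m)" by simp
    have "pr n G = (1 / real n) ^ p"
    proof -
      have "inj_on (\<lambda>i. (c i, d i)) {0..<int p}" using assms(2) by (auto simp: inj_on_def)
      then show ?thesis
        unfolding G_def using assms(5,6) by (subst pr_pattern_inj) auto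
    qed
    moreover have "pr n (\<lambda>f. G f \<and> orb f c y m = ?D)
       = pr n G - pr n (\<lambda>f. f (?a, ?D) = d 0 \<and> (Q f \<and> orb f c y m \<noteq> ?D))"
      unfolding avg_diff[symmetric] by (intro avg_cong) (auto simp: G_Q)
    ultimately show "pr n (\<lambda>f. G f \<and> orb f c y m = ?D)
      = (1 / real n) ^ p - of_bool (y \<noteq> d 0) * ((1 / n) * (1 / real n * (1 - 1 / real n)) ^ m)"
      using miss by simp
  qed
  also have "\<dots> = n * (1 / real n) ^ p - (real n - 1) * ((1 / n) * (1 / real n * (1 - 1 / real n)) ^ m)"
  proof -
    have "{..<n} \<inter> {y. y \<noteq> d 0} = {..<n} - {d 0}" by auto
    then have "(\<Sum>y<n. of_bool (y \<noteq> d 0) :: real) = real n - 1"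
      using assms(6)[of 0] by (simp add: of_bool_def sum.If_cases card_Diff_singleton of_nat_diff)
    then show ?thesis by (simp only: sum_subtractf flip: sum_distrib_right) simp
  qed
  also have "(1 / n) * \<dots> = (1 / real n) ^ p * (1 - (1 - 1 / real n) ^ p)"
  proof -
    \<comment> \<open>The \<open>n - 1\<close> starting points other than \<open>d 0\<close> supply
      the last of the \<open>p\<close> factors \<open>1 - 1 / n\<close>.\<close>
    have e: "real n - 1 = real n * (1 - 1 / real n)" using n by (simp add: field_simps)
    show ?thesis using n unfolding p e by (simp add: power_mult_distrib field_simps)
  qed
  finally show ?thesis .
qed

section \<open>Counting patterns of entries\<close>

lemma pr_pattern:
  assumes "\<And>j. j \<in> J \<Longrightarrow> q j \<in> {..<n} \<times> {..<n}" "\<And>j. j \<in> J \<Longrightarrow> r j < n"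
  shows "pr n (\<lambda>f. \<forall>j\<in>J. f (q j) = r j) \<le> (1 / real n) ^ card (q ` J)"
proof (cases "\<forall>j\<in>J. \<forall>j'\<in>J. q j = q j' \<longrightarrow> r j = r j'")
  case True
  have r: "r (inv_into J q (q j)) = r j" if "j \<in> J" for j
    using True that by (metis f_inv_into_f imageI inv_into_into)
  have "(\<forall>j\<in>J. f (q j) = r j) \<longleftrightarrow> (\<forall>z\<in>q ` J. f z = r (inv_into J q z))" for f
    using r by auto
  moreover have "pr n (\<lambda>f. \<forall>z\<in>q ` J. f z = r (inv_into J q z)) = (1 / real n) ^ card (q ` J)"
  proof (rule pr_entries)
    show "q ` J \<subseteq> {..<n} \<times> {..<n}" using assms(1) by blast
  qed (use assms(2) r in auto)
  ultimately show ?thesis by simp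
next
  case False
  then obtain j j' where "j \<in> J" "j' \<in> J" "q j = q j'" "r j \<noteq> r j'" by blast
  then have "pr n (\<lambda>f. \<forall>j\<in>J. f (q j) = r j) = 0"
    by (intro pr_eq_0) metis
  then show ?thesis by simp
qed

text \<open>The rule maps the queries \<open>q ` J\<close> onto the values \<open>r ` J\<close>, injectively if there are equally many
  of both.\<close>

lemma pattern_backward:
  assumes "finite J" "\<And>j. j \<in> J \<Longrightarrow> f (q j) = r j" "card (q ` J) \<le> card (r ` J)"
    and "j \<in> J" "j' \<in> J" "r j = r j'"
  shows "q j = q j'"
proof -
  have "r ` J = f ` q ` J" using assms(2) by (auto simp: image_iff)
  then have "card (f ` q ` J) = card (q ` J)"
    using assms(1,3) card_image_le[of "q ` J" f] by simp
  then have "inj_on f (q ` J)" using assms(1) by (simp add: eq_card_imp_inj_on)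
  then show ?thesis using assms(2,4-6) by (metis imageI inj_onD)
qed

lemma card_le_pattern:
  assumes "finite J" "\<And>j. j \<in> J \<Longrightarrow> f (q j) = r j"
  shows "card (r ` J) \<le> card (q ` J)"
proof -
  have "r ` J = f ` q ` J" using assms(2) by (auto simp: image_iff)
  then show ?thesis using assms(1) card_image_le[of "q ` J" f] by simp
qed

lemma sum_of_bool: "finite A \<Longrightarrow> (\<Sum>a\<in>A. of_bool (P a)) = real (card {a\<in>A. P a})"
proof -
  assume "finite A"
  moreover have "A \<inter> {a. P a} = {a\<in>A. P a}" by blast
  ultimately show ?thesis by (simp add: of_bool_def sum.If_cases)
qed

section \<open>Weighted counts of arrays by their number of distinct values\<close>

definition weight_bound :: "nat \<Rightarrow> real" where
  "weight_bound k = real (Suc k) ^ Suc k"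

text \<open>With \<open>m = card I\<close>, an array with \<open>k\<close> distinct values is a map
  into one of at most \<open>n ^ k\<close> value sets, and each set admits at most
  \<open>m ^ m\<close> maps. The weight cancels \<open>n ^ k\<close>, and the \<open>m + 1\<close>
  possible values of \<open>k\<close> give \<open>(m + 1) * m ^ m\<close>, uniformly in
  \<open>n\<close>.\<close>

lemma sum_weight_le:
  assumes "n > 0" "finite I" "inj_on \<phi> A" "\<phi> ` A \<subseteq> I \<rightarrow>\<^sub>E {..<n}"
  shows "(\<Sum>a\<in>A. (1 / real n) ^ card (\<phi> a ` I)) \<le> weight_bound (card I)"
proof -
  let ?F = "I \<rightarrow>\<^sub>E {..<n}" and ?m = "card I"
  have fin: "finite ?F" using assms(2) by (intro finite_PiE) auto
  have N: "real (card {v\<in>?F. card (v ` I) = k}) \<le> real ?m ^ ?m * real n ^ k" if "k \<le> ?m" for k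
  proof -
    let ?B = "{B. B \<subseteq> {..<n} \<and> card B = k}"
    have "{v\<in>?F. card (v ` I) = k} \<subseteq> (\<Union>B\<in>?B. I \<rightarrow>\<^sub>E B)"
    proof
      fix v assume "v \<in> {v\<in>?F. card (v ` I) = k}"
      then have "v ` I \<in> ?B" "v \<in> I \<rightarrow>\<^sub>E v ` I" by (auto simp: PiE_iff)
      then show "v \<in> (\<Union>B\<in>?B. I \<rightarrow>\<^sub>E B)" by blast
    qed
    moreover have finB: "finite ?B" by simp
    moreover have "finite (I \<rightarrow>\<^sub>E B)" if "B \<in> ?B" for B
      using that assms(2) by (intro finite_PiE) (auto intro: finite_subset)
    ultimately have "card {v\<in>?F. card (v ` I) = k} \<le> card (\<Union>B\<in>?B. I \<rightarrow>\<^sub>E B)"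
      by (intro card_mono finite_UN_I) auto
    also have "\<dots> \<le> (\<Sum>B\<in>?B. card (I \<rightarrow>\<^sub>E B))"
      using finB by (rule card_UN_le)
    also have "\<dots> = (\<Sum>B\<in>?B. k ^ ?m)"
      using assms(2) by (intro sum.cong) (auto simp: card_PiE)
    also have "\<dots> = (n choose k) * k ^ ?m"
      using n_subsets[of "{..<n}" k] by simp
    also have "\<dots> \<le> n ^ k * ?m ^ ?m"
    proof (rule mult_mono)
      show "n choose k \<le> n ^ k"
        by (cases "k \<le> n") (auto intro: binomial_le_pow simp: binomial_eq_0)
    qed (use that in \<open>auto intro: power_mono\<close>)
    finally have "real (card {v\<in>?F. card (v ` I) = k}) \<le> real (n ^ k * ?m ^ ?m)"
      by (rule of_nat_mono)
    then show ?thesis by (simp add: mult.commute)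
  qed
  have "(\<Sum>a\<in>A. (1 / real n) ^ card (\<phi> a ` I)) = (\<Sum>v\<in>\<phi> ` A. (1 / real n) ^ card (v ` I))"
    using assms(3) by (simp add: sum.reindex)
  also have "\<dots> \<le> (\<Sum>v\<in>?F. (1 / real n) ^ card (v ` I))"
    using assms(4) fin by (intro sum_mono2) auto
  also have "\<dots> = (\<Sum>v\<in>?F. \<Sum>k\<in>{..?m}. of_bool (card (v ` I) = k) * (1 / real n) ^ k)"
    by (intro sum.cong refl) (simp add: card_image_le assms(2) of_bool_def if_distrib[of "\<lambda>u. u * _"] cong: if_cong)
  also have "\<dots> = (\<Sum>k\<in>{..?m}. real (card {v\<in>?F. card (v ` I) = k}) * (1 / real n) ^ k)"
    by (subst sum.swap) (simp only: sum_distrib_right[symmetric] sum_of_bool[OF fin])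
  also have "\<dots> \<le> (\<Sum>k\<in>{..?m}. (real ?m ^ ?m * real n ^ k) * (1 / real n) ^ k)"
    using N by (intro sum_mono mult_right_mono) auto
  also have "\<dots> = (\<Sum>k\<in>{..?m}. real ?m ^ ?m)"
    using assms(1) by (intro sum.cong) (auto simp: power_one_over)
  also have "\<dots> \<le> weight_bound ?m"
    by (simp add: weight_bound_def) (intro mult_left_mono power_mono, auto)
  finally show ?thesis .
qed

lemma weight_bound_mono: "k \<le> l \<Longrightarrow> weight_bound k \<le> weight_bound l"
  unfolding weight_bound_def
  by (rule order_trans[OF power_mono power_increasing]) auto

section \<open>Minimal periods and injective cyclic words\<close>

definition primitive :: "nat \<Rightarrow> (int \<Rightarrow> nat) \<Rightarrow> bool" where
  "primitive p c \<longleftrightarrow> (\<forall>q. 0 < q \<and> q < int p \<longrightarrow> \<not> periodic q c)"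

lemma primitive_dvd:
  assumes "p > 0" "periodic (int p) c" "primitive p c" "periodic r c"
  shows "int p dvd r"
proof (rule ccontr)
  assume "\<not> int p dvd r"
  then have "0 < r mod int p"
    using assms(1) pos_mod_sign[of "int p" r] mod_0_imp_dvd[of r "int p"] by linarith
  moreover have "r mod int p < int p" using assms(1) by simp
  moreover have "periodic (r mod int p) c"
    unfolding periodic_def
  proof
    fix i
    have "c (i + r mod int p) = c (i + r)"
      by (rule periodic_cong[OF assms(2)]) (simp add: mod_simps)
    then show "c (i + r mod int p) = c i" using periodicD[OF assms(4)] by simp
  qed
  ultimately show False using assms(3) unfolding primitive_def by blast
qed

text \<open>In patterns without surplus queries, equality of two states passes to their
  predecessors, hence only into the past. For periodic data the distant past is also the
  future.\<close>

lemma backward_periodic: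
  assumes "N > 0" "periodic N g" "\<And>s::nat. g (- int s)"
  shows "g t"
proof -
  define s where "s = nat ((- t) mod N)"
  have "g t = g (- int s)"
    using assms(1) by (intro periodic_cong[OF assms(2)]) (simp add: s_def mod_simps)
  then show ?thesis using assms(3) by simp
qed

text \<open>Cyclic words of distinct states. Extensionality makes them a finite set to sum over; the
  periodic extension is supplied by \<open>wrap\<close>.\<close>

definition arr :: "nat \<Rightarrow> nat set \<Rightarrow> (int \<Rightarrow> nat) set" where
  "arr m Y = {x \<in> {0..<int m} \<rightarrow>\<^sub>E Y. inj_on x {0..<int m}}"

definition wrap :: "nat \<Rightarrow> (int \<Rightarrow> nat) \<Rightarrow> int \<Rightarrow> nat" where
  "wrap m x i = x (i mod int m)"

lemma periodic_wrap: "periodic (int m) (wrap m x)"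
  by (simp add: periodic_def wrap_def)

lemma wrap_in: "x \<in> arr m Y \<Longrightarrow> m > 0 \<Longrightarrow> wrap m x i \<in> Y"
  by (auto simp: arr_def wrap_def PiE_iff)

lemma wrap_inj: "x \<in> arr m Y \<Longrightarrow> m > 0 \<Longrightarrow> wrap m x i = wrap m x j \<longleftrightarrow> i mod int m = j mod int m"
  by (auto simp: arr_def wrap_def inj_on_eq_iff)

lemma wrap_id: "i \<in> {0..<int m} \<Longrightarrow> wrap m x i = x i"
  by (simp add: wrap_def)

lemma range_wrap: "m > 0 \<Longrightarrow> range (wrap m x) = x ` {0..<int m}"
proof
  assume "m > 0"
  then show "range (wrap m x) \<subseteq> x ` {0..<int m}" by (auto simp: wrap_def)
  show "x ` {0..<int m} \<subseteq> range (wrap m x)" by (auto simp: wrap_def) (metis mod_pos_pos_trivial rangeI)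
qed

lemma wrap_image:
  assumes "m > 0" shows "(\<lambda>i. wrap m x (i + s)) ` {0..<int m} = x ` {0..<int m}"
proof -
  have "wrap m x i \<in> (\<lambda>i. wrap m x (i + s)) ` {0..<int m}" for i
  proof (rule image_eqI[where x = "(i - s) mod int m"])
    show "wrap m x i = wrap m x ((i - s) mod int m + s)" by (simp add: wrap_def mod_simps)
  qed (use assms in auto)
  then have "(\<lambda>i. wrap m x (i + s)) ` {0..<int m} = range (wrap m x)" by blast
  then show ?thesis using range_wrap[OF assms] by simp
qed

lemma finite_arr: "finite Y \<Longrightarrow> finite (arr m Y)"
  unfolding arr_def by (rule finite_subset[OF Collect_subset]) (auto intro: finite_PiE)

lemma card_arr_le: "finite Y \<Longrightarrow> card (arr m Y) \<le> card Y ^ m"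
proof -
  assume "finite Y"
  then have "card (arr m Y) \<le> card ({0..<int m} \<rightarrow>\<^sub>E Y)"
    unfolding arr_def by (intro card_mono) (auto intro: finite_PiE)
  then show ?thesis by (simp add: card_PiE)
qed

lemma card_arr_ge:
  assumes "finite Y" "m \<le> card Y" shows "(card Y - m) ^ m \<le> card (arr m Y)"
proof -
  have "card (arr m Y) = prod ((-) (card Y)) {0..<m}"
    unfolding arr_def using card_inj_on_subset_funcset[of "{0..<int m}" Y "{0..<int m}"] assms by simp
  also have "\<dots> \<ge> (\<Prod>i\<in>{0..<m}. card Y - m)"
    by (intro prod_mono) auto
  finally show ?thesis by simp
qed

text \<open>One coincidence spreads to all earlier positions by the last hypothesis and to all
  positions by the common period \<open>m * m'\<close>. Each word then has the length of the other
  as a period, and as both are injective the lengths divide each other.\<close>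

lemma arr_rotation:
  assumes x: "x \<in> arr m Y" "m > 0" and x': "x' \<in> arr m' Y'" "m' > 0"
    and "wrap m x i = wrap m' x' j"
    and stp: "\<And>i j. wrap m x i = wrap m' x' j \<Longrightarrow> wrap m x (i - 1) = wrap m' x' (j - 1)"
  shows "m = m'" "wrap m' x' t = wrap m x (t + (i - j))"
proof -
  have bwd: "wrap m x (i - int s) = wrap m' x' (j - int s)" for s
  proof (induction s)
    case 0
    show ?case using assms(5) by simp
  next
    case (Suc s)
    have "i - int (Suc s) = i - int s - 1" "j - int (Suc s) = j - int s - 1" by simp_all
    then show ?case using stp[OF Suc] by (simp only:)
  qed
  have all: "wrap m x (i + t) = wrap m' x' (j + t)" for t
  proof (rule backward_periodic[where N = "int m * int m'" and g = "\<lambda>t. wrap m x (i + t) = wrap m' x' (j + t)"])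
    show "periodic (int m * int m') (\<lambda>t. wrap m x (i + t) = wrap m' x' (j + t))"
      unfolding periodic_def
    proof
      fix t
      have "wrap m x (i + (t + int m * int m')) = wrap m x (i + t)"
        using periodic_mult[OF periodic_wrap, of m x "i + t" "int m'"] by (simp add: algebra_simps)
      moreover have "wrap m' x' (j + (t + int m * int m')) = wrap m' x' (j + t)"
        using periodic_mult[OF periodic_wrap, of m' x' "j + t" "int m"] by (simp add: algebra_simps)
      ultimately show "(wrap m x (i + (t + int m * int m')) = wrap m' x' (j + (t + int m * int m')))
          = (wrap m x (i + t) = wrap m' x' (j + t))" by simp
    qed
    show "0 < int m * int m'" using assms(2,4) by simp
    show "wrap m x (i + - int s) = wrap m' x' (j + - int s)" for s
      using bwd[of s] by simp
  qed
  have "wrap m' x' (j + int m) = wrap m' x' j" "wrap m x (i + int m') = wrap m x i"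
    using all[of "int m"] all[of "int m'"] all[of 0]
      periodicD[OF periodic_wrap, of m x i] periodicD[OF periodic_wrap, of m' x' j] by simp_all
  then have "(j + int m) mod int m' = j mod int m'" "(i + int m') mod int m = i mod int m"
    unfolding wrap_inj[OF x] wrap_inj[OF x'] .
  then have "int m' dvd (j + int m) - j" "int m dvd (i + int m') - i"
    by (simp_all only: mod_eq_dvd_iff)
  then have "m' dvd m" "m dvd m'" by simp_all
  then show "m = m'" by (rule dvd_antisym[rotated])
  show "wrap m' x' t = wrap m x (t + (i - j))"
    using all[of "t - j"] by (simp add: algebra_simps)
qed

section \<open>Fresh cycles\<close>

definition cyc :: "ca_rule \<Rightarrow> (int \<Rightarrow> nat) \<Rightarrow> nat \<Rightarrow> (int \<Rightarrow> nat) \<Rightarrow> bool" where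
  "cyc f c m x \<longleftrightarrow> (\<forall>i\<in>{0..<int m}. f (c i, x i) = wrap m x (i + 1))"

text \<open>Only cycles with \<open>l * p\<close> distinct states are considered. They are numerous
  enough for the second moment method, and each has probability exactly
  \<open>(1 / n) ^ (l * p)\<close>, even if \<open>c\<close> repeats states.\<close>

definition no_fresh :: "nat \<Rightarrow> ca_rule \<Rightarrow> (int \<Rightarrow> nat) \<Rightarrow> nat \<Rightarrow> nat set \<Rightarrow> bool" where
  "no_fresh n f c p V \<longleftrightarrow> (\<forall>l>0. \<forall>x\<in>arr (l * p) ({..<n} - V). \<not> cyc f c (l * p) x)"

lemma cyc_orb:
  assumes "cyc f c (l * p) x" "periodic (int p) c" "l > 0" "p > 0"
  shows "orb f c (x 0) s = wrap (l * p) x (int s)"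
proof (induction s)
  case (Suc s)
  let ?i = "int s mod int (l * p)"
  have "f (c ?i, x ?i) = wrap (l * p) x (?i + 1)"
    using assms by (auto simp: cyc_def)
  moreover have "c ?i = c (int s)"
  proof (rule periodic_cong[OF assms(2)])
    show "?i mod int p = int s mod int p" by (simp add: mod_mod_cancel)
  qed
  moreover have "wrap (l * p) x (?i + 1) = wrap (l * p) x (int (Suc s))"
    by (simp add: wrap_def mod_simps add.commute)
  ultimately show ?case using Suc by (simp add: wrap_def)
qed (use assms in \<open>simp add: wrap_def\<close>)

text \<open>A fresh cycle is a driven orbit that avoids \<open>V\<close> forever, so it never meets
  the column \<open>d\<close>.\<close>

lemma attracts_no_fresh:
  assumes "attracts n f c d" "periodic (int p) c" "p > 0" "\<And>i. d i \<in> V"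
  shows "no_fresh n f c p V"
  unfolding no_fresh_def
proof (intro allI impI ballI notI)
  fix l x assume l: "(l::nat) > 0" and x: "x \<in> arr (l * p) ({..<n} - V)" and cy: "cyc f c (l * p) x"
  have lp: "l * p > 0" using l assms by simp
  then have "x 0 \<in> {..<n} - V" using wrap_in[OF x, of 0] by (simp add: wrap_def)
  then obtain s where "orb f c (x 0) s = d (int s)" using assms(1) by (auto simp: attracts_def)
  then have "wrap (l * p) x (int s) \<in> V" using cyc_orb[OF cy assms(2) l assms(3)] assms(4) by simp
  then show False using wrap_in[OF x lp, of "int s"] by auto
qed

lemma pr_cyc:
  assumes "x \<in> arr m {..<n}" "m > 0" "\<And>i. c i < n"
  shows "pr n (\<lambda>f. cyc f c m x) = (1 / real n) ^ m"
proof -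
  have "inj_on (\<lambda>i. (c i, x i)) {0..<int m}" using assms(1) by (auto simp: arr_def inj_on_def)
  moreover have "x i < n" if "0 \<le> i" "i < int m" for i using assms(1) that by (auto simp: arr_def PiE_iff)
  moreover have "wrap m x i < n" for i using wrap_in[OF assms(1,2)] by auto
  ultimately show ?thesis unfolding cyc_def using assms(3) by (subst pr_pattern_inj) auto
qed

text \<open>Two cycles share no value, or are rotations of each other, or their union uses more entries of the
  rule than it has values, which costs an additional factor \<open>1 / n\<close>.\<close>

lemma pr_cyc_pair:
  assumes x: "x \<in> arr (l * p) {..<n}" "x' \<in> arr (l' * p) {..<n}"
    and "l > 0" "l' > 0" "p > 0" "n > 0"
    and c: "\<And>i. c i < n" "periodic (int p) c" "primitive p c"
  shows "pr n (\<lambda>f. cyc f c (l * p) x \<and> cyc f c (l' * p) x')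
    \<le> (1 / real n) ^ card (x ` {0..<int (l * p)} \<union> x' ` {0..<int (l' * p)}) * (1 / real n)
      + (1 / real n) ^ (l * p) * (1 / real n) ^ (l' * p)
      + of_bool (l = l' \<and> (\<exists>r<l. \<forall>i. wrap (l' * p) x' i = wrap (l * p) x (i + int r * int p))) * (1 / real n) ^ (l * p)"
    (is "?P \<le> ?A + ?B + ?C")
proof -
  let ?m = "l * p" and ?m' = "l' * p"
  have m: "?m > 0" "?m' > 0" using assms by auto
  define J where "J = {0..<int ?m} <+> {0..<int ?m'}"
  define q where "q = case_sum (\<lambda>i. (c i, x i)) (\<lambda>i. (c i, x' i))"
  define r where "r = case_sum (\<lambda>i. wrap ?m x (i + 1)) (\<lambda>i. wrap ?m' x' (i + 1))"
  have finJ: "finite J" by (simp add: J_def)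
  have J: "(\<forall>j\<in>J. P j) \<longleftrightarrow> (\<forall>i\<in>{0..<int ?m}. P (Inl i)) \<and> (\<forall>i\<in>{0..<int ?m'}. P (Inr i))" for P
    by (auto simp: J_def)
  have ev: "cyc f c ?m x \<and> cyc f c ?m' x' \<longleftrightarrow> (\<forall>j\<in>J. f (q j) = r j)" for f
    unfolding J cyc_def by (simp add: q_def r_def)
  have q_in: "q j \<in> {..<n} \<times> {..<n}" "r j < n" if "j \<in> J" for j
    using that wrap_in[OF x(1) m(1)] wrap_in[OF x(2) m(2)] x c(1)
    by (auto simp: J_def q_def r_def arr_def PiE_iff)
  have rJ: "r ` J = x ` {0..<int ?m} \<union> x' ` {0..<int ?m'}"
  proof -
    have "r ` J = (\<lambda>i. wrap ?m x (i + 1)) ` {0..<int ?m} \<union> (\<lambda>i. wrap ?m' x' (i + 1)) ` {0..<int ?m'}"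
      by (simp add: J_def r_def Plus_def image_Un image_image)
    then show ?thesis unfolding wrap_image[OF m(1)] wrap_image[OF m(2)] .
  qed
  have P: "?P \<le> (1 / real n) ^ card (q ` J)"
    unfolding ev using q_in by (rule pr_pattern)
  have pos: "0 \<le> ?A" "0 \<le> ?B" "0 \<le> ?C" by auto
  consider "card (q ` J) > card (r ` J)" | "?P = 0"
    | f where "card (q ` J) \<le> card (r ` J)" "\<And>j. j \<in> J \<Longrightarrow> f (q j) = r j"
  proof (cases "\<exists>f. \<forall>j\<in>J. f (q j) = r j")
    case True
    then obtain f where "\<forall>j\<in>J. f (q j) = r j" ..
    then show ?thesis using that(1) that(3)[of f] by (cases "card (q ` J) > card (r ` J)") auto
  next
    case False
    then have "?P = 0" unfolding ev by (intro pr_eq_0) blast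
    then show ?thesis by (rule that(2))
  qed
  then show ?thesis
  proof cases
    case 1
    then have "(1 / real n) ^ card (q ` J) \<le> (1 / real n) ^ Suc (card (r ` J))"
      using \<open>n > 0\<close> by (intro power_decreasing) auto
    then have "(1 / real n) ^ card (q ` J) \<le> ?A" by (simp add: rJ mult.commute)
    then show ?thesis using P pos by linarith
  next
    case 2
    then show ?thesis using pos by linarith
  next
    case 3
    have bwd: "q j = q j'" if "j \<in> J" "j' \<in> J" "r j = r j'" for j j'
      by (rule pattern_backward[where f = f and r = r and J = J]) (use 3 finJ that in auto)
    show ?thesis
    proof (cases "x ` {0..<int ?m} \<inter> x' ` {0..<int ?m'} = {}")
      case True
      then have ne: "x i \<noteq> x' k" if "i \<in> {0..<int ?m}" "k \<in> {0..<int ?m'}" for i k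
        using that by (metis disjoint_iff imageI)
      have "inj_on (\<lambda>i. snd (q i)) J"
      proof (rule inj_onI)
        fix j j' assume "j \<in> J" "j' \<in> J" "snd (q j) = snd (q j')"
        then show "j = j'"
          using x ne ne[symmetric] unfolding J_def q_def arr_def
          by (elim PlusE) (auto dest: inj_onD)
      qed
      then have "inj_on q J" by (auto simp: inj_on_def)
      moreover have "card J = ?m + ?m'"
        unfolding J_def by (subst card_Plus) (simp_all del: of_nat_mult)
      ultimately have "card (q ` J) = ?m + ?m'" by (simp add: card_image)
      then have "(1 / real n) ^ card (q ` J) = ?B" by (simp only: power_add)
      then show ?thesis using P pos by linarith
    next
      case False
      have stp: "c (i - 1) = c (j - 1) \<and> wrap ?m x (i - 1) = wrap ?m' x' (j - 1)"
        if "wrap ?m x i = wrap ?m' x' j" for i j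
      proof -
        let ?i = "(i - 1) mod int ?m" and ?j = "(j - 1) mod int ?m'"
        have "Inl ?i \<in> J" "Inr ?j \<in> J" using m by (auto simp: J_def)
        moreover have "r (Inl ?i) = r (Inr ?j)"
          using that by (simp add: r_def wrap_def mod_simps)
        ultimately have "q (Inl ?i) = q (Inr ?j)" by (rule bwd)
        then have "c ?i = c ?j" "wrap ?m x (i - 1) = wrap ?m' x' (j - 1)" by (auto simp: q_def wrap_def)
        moreover have "c ?i = c (i - 1)" "c ?j = c (j - 1)"
          by (intro periodic_cong[OF c(2)], simp add: mod_mod_cancel)+
        ultimately show ?thesis by simp
      qed
      from False have "range (wrap ?m x) \<inter> range (wrap ?m' x') \<noteq> {}" using range_wrap m by simp
      then obtain i j where ij: "wrap ?m x i = wrap ?m' x' j" by blast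
      have bwd: "wrap ?m x (i - int s) = wrap ?m' x' (j - int s)" for s
      proof (induction s)
        case 0
        show ?case using ij by simp
      next
        case (Suc s)
        have "i - int (Suc s) = i - int s - 1" "j - int (Suc s) = j - int s - 1" by simp_all
        then show ?case using stp[OF Suc] by (simp only:)
      qed
      \<comment> \<open>The queries also contain the driving states, so these agree along both
        cycles. Hence \<open>i - j\<close> is a period of \<open>c\<close>, and primitivity leaves
        only the \<open>l\<close> rotations by multiples of \<open>p\<close>.\<close>
      have cc: "c (i - 1 + t) = c (j - 1 + t)" for t
      proof (rule backward_periodic[where N = "int p" and g = "\<lambda>t. c (i - 1 + t) = c (j - 1 + t)"])
        show "periodic (int p) (\<lambda>t. c (i - 1 + t) = c (j - 1 + t))"
          using c(2) by (auto simp: periodic_def add.assoc[symmetric])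
        show "c (i - 1 + - int s) = c (j - 1 + - int s)" for s
          using stp[OF bwd[of s]] by (simp add: algebra_simps)
      qed (use \<open>p > 0\<close> in auto)
      have "periodic (i - j) c"
        unfolding periodic_def
      proof
        fix t
        show "c (t + (i - j)) = c t" using cc[of "t - j + 1"] by (simp add: algebra_simps)
      qed
      then have "int p dvd i - j" using primitive_dvd \<open>p > 0\<close> c by blast
      then obtain k where k: "i - j = int p * k" by blast
      have "?m = ?m'"
        by (rule arr_rotation(1)[OF x(1) m(1) x(2) m(2) ij]) (use stp in blast)
      then have ll: "l = l'" using \<open>p > 0\<close> by simp
      have rot: "wrap ?m' x' t = wrap ?m x (t + (i - j))" for t
        by (rule arr_rotation(2)[OF x(1) m(1) x(2) m(2) ij]) (use stp in blast)
      define r where "r = nat (k mod int l)"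
      have "r < l" using \<open>l > 0\<close> by (simp add: r_def nat_less_iff)
      moreover have "wrap ?m' x' t = wrap ?m x (t + int r * int p)" for t
      proof -
        have "wrap ?m' x' t = wrap ?m x (t + int p * k)" by (simp only: rot k)
        also have "\<dots> = wrap ?m x (t + int r * int p)"
        proof (rule periodic_cong[OF periodic_wrap])
          have "int r * int p = (k * int p) mod int ?m"
          proof -
            have "int r = k mod int l" using \<open>l > 0\<close> by (simp add: r_def)
            then show ?thesis by (simp only: mult_mod_left of_nat_mult)
          qed
          then show "(t + int p * k) mod int ?m = (t + int r * int p) mod int ?m"
            by (simp only: mod_add_right_eq mult.commute[of "int p" k])
        qed
        finally show ?thesis .
      qed
      ultimately have "?C = (1 / real n) ^ ?m" using ll by auto
      moreover have "?P \<le> pr n (\<lambda>f. cyc f c ?m x)" by (rule pr_mono) auto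
      moreover have "\<dots> = (1 / real n) ^ ?m" using pr_cyc[OF x(1) m(1) c(1)] by simp
      ultimately show ?thesis using pos by linarith
    qed
  qed
qed

text \<open>Concatenating the two words into one array over the disjoint union of their index sets
  reduces pairs to the weighted count of single arrays.\<close>

lemma sum_pair_weight:
  assumes "n > 0" "m > 0" "m' > 0" "Y \<subseteq> {..<n}" "Y' \<subseteq> {..<n}"
  shows "(\<Sum>x\<in>arr m Y. \<Sum>x'\<in>arr m' Y'. (1 / real n) ^ card (x ` {0..<int m} \<union> x' ` {0..<int m'}))
    \<le> weight_bound (m + m')"
proof -
  let ?I = "{0..<int m} <+> {0..<int m'}"
  define \<phi> where "\<phi> = (\<lambda>(x :: int \<Rightarrow> nat, x' :: int \<Rightarrow> nat). restrict (case_sum x x') ?I)"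
  have im: "\<phi> a ` ?I = fst a ` {0..<int m} \<union> snd a ` {0..<int m'}" for a
    by (cases a) (simp add: \<phi>_def Plus_def image_Un image_image)
  have inj: "inj_on \<phi> (arr m Y \<times> arr m' Y')"
  proof (rule inj_onI)
    fix a b assume a: "a \<in> arr m Y \<times> arr m' Y'" and b: "b \<in> arr m Y \<times> arr m' Y'" and eq: "\<phi> a = \<phi> b"
    have "fst a = fst b"
    proof (rule PiE_ext)
      show "fst a i = fst b i" if "i \<in> {0..<int m}" for i
        using fun_cong[OF eq, of "Inl i"] that by (simp add: \<phi>_def case_prod_unfold InlI)
    qed (use a b in \<open>auto simp: arr_def\<close>)
    moreover have "snd a = snd b"
    proof (rule PiE_ext)
      show "snd a i = snd b i" if "i \<in> {0..<int m'}" for i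
        using fun_cong[OF eq, of "Inr i"] that by (simp add: \<phi>_def case_prod_unfold InrI)
    qed (use a b in \<open>auto simp: arr_def\<close>)
    ultimately show "a = b" by (simp add: prod_eq_iff)
  qed
  have ran: "\<phi> ` (arr m Y \<times> arr m' Y') \<subseteq> ?I \<rightarrow>\<^sub>E {..<n}"
    using assms(4,5) by (auto simp: subset_eq \<phi>_def arr_def PiE_iff)
  have "(\<Sum>a\<in>arr m Y \<times> arr m' Y'. (1 / real n) ^ card (\<phi> a ` ?I)) \<le> weight_bound (card ?I)"
    by (rule sum_weight_le[OF assms(1) _ inj ran]) simp
  moreover have "(\<Sum>x\<in>arr m Y. \<Sum>x'\<in>arr m' Y'. (1 / real n) ^ card (x ` {0..<int m} \<union> x' ` {0..<int m'}))
    = (\<Sum>a\<in>arr m Y \<times> arr m' Y'. (1 / real n) ^ card (\<phi> a ` ?I))"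
    by (simp add: im sum.cartesian_product case_prod_unfold)
  ultimately show ?thesis by (simp add: card_Plus)
qed

lemma card_rotations_le:
  assumes "finite R" "m > 0"
  shows "card {x'\<in>arr m Y. \<exists>r\<in>R. \<forall>i. wrap m x' i = wrap m x (i + g r)} \<le> card R"
proof -
  have "{x'\<in>arr m Y. \<exists>r\<in>R. \<forall>i. wrap m x' i = wrap m x (i + g r)}
      \<subseteq> (\<lambda>r. restrict (\<lambda>i. wrap m x (i + g r)) {0..<int m}) ` R"
  proof
    fix x' assume "x' \<in> {x'\<in>arr m Y. \<exists>r\<in>R. \<forall>i. wrap m x' i = wrap m x (i + g r)}"
    then obtain r where r: "x' \<in> arr m Y" "r \<in> R" "\<And>i. wrap m x' i = wrap m x (i + g r)" by blast
    have "x' = restrict (\<lambda>i. wrap m x (i + g r)) {0..<int m}"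
      using r(1) r(3) wrap_id[of _ m x'] by (intro extensionalityI[of _ "{0..<int m}"]) (auto simp: arr_def PiE_iff)
    then show "x' \<in> (\<lambda>r. restrict (\<lambda>i. wrap m x (i + g r)) {0..<int m}) ` R" using r(2) by blast
  qed
  then show ?thesis
    using assms(1) by (meson card_image_le card_mono finite_imageI le_trans)
qed

text \<open>Second moment method for the number \<open>X\<close> of fresh cycles of length at most \<open>L * p\<close>. The weight
  \<open>1 / l\<close> compensates the \<open>l\<close> rotations of a cycle, so the mean and the variance of \<open>X\<close> are both close
  to \<open>harm L\<close>.\<close>

lemma pr_no_fresh_le:
  assumes c: "\<And>i. c i < n" "periodic (int p) c" "primitive p c" and "p > 0" "L > 0"
    and \<rho>: "\<And>l. l \<in> {1..L} \<Longrightarrow> \<rho> * real n ^ (l * p) \<le> real (card (arr (l * p) ({..<n} - V)))"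
  shows "pr n (\<lambda>f. no_fresh n f c p V) \<le> 2 * (1 - \<rho>) + 1 / harm L + weight_bound (2 * L * p) / real n"
proof -
  have n: "n > 0" using c(1)[of 0] by simp
  define Y where "Y = {..<n} - V"
  have Y: "Y \<subseteq> {..<n}" "finite Y" by (auto simp: Y_def)
  have finY: "finite (arr m Y)" for m using Y(2) by (rule finite_arr)
  have arrY: "x \<in> arr m {..<n}" if "x \<in> arr m Y" for x m
    using that Y by (auto simp: arr_def PiE_iff)
  define H where "H = (\<Sum>l\<in>{1..L}. 1 / real l)"
  have Hh: "H = harm L" by (simp add: H_def harm_def inverse_eq_divide)
  have H: "H > 0" unfolding Hh using \<open>L > 0\<close> by simp
  define X :: "ca_rule \<Rightarrow> real" where
    "X = (\<lambda>f. \<Sum>l\<in>{1..L}. (1 / real l) * (\<Sum>x\<in>arr (l * p) Y. of_bool (cyc f c (l * p) x)))"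
  have card_le: "real (card (arr m Y)) * (1 / real n) ^ m \<le> 1" for m
  proof -
    have "card (arr m Y) \<le> card Y ^ m" by (rule card_arr_le[OF Y(2)])
    also have "\<dots> \<le> n ^ m" using card_mono[of "{..<n}" Y] Y by (intro power_mono) auto
    finally have "real (card (arr m Y)) \<le> real n ^ m" by (metis of_nat_le_iff of_nat_power)
    then show ?thesis using n by (simp add: power_one_over)
  qed
  have X0: "X f = 0" if "no_fresh n f c p V" for f
    using that unfolding X_def no_fresh_def Y_def by (intro sum.neutral) auto
  \<comment> \<open>Chebyshev's inequality in pointwise form: the indicator of \<open>X = 0\<close>
    is at most \<open>(1 - X / H)\<^sup>2\<close>.\<close>
  have "pr n (\<lambda>f. no_fresh n f c p V) \<le> avg n (\<lambda>f. 1 - (2 / H) * X f + (1 / H\<^sup>2) * (X f * X f))"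
  proof (rule avg_mono)
    fix f
    have "1 - (2 / H) * X f + (1 / H\<^sup>2) * (X f * X f) = (1 - X f / H)\<^sup>2"
      using H by (simp add: power2_eq_square field_simps)
    then show "of_bool (no_fresh n f c p V) \<le> 1 - (2 / H) * X f + (1 / H\<^sup>2) * (X f * X f)"
      using X0[of f] by (auto simp: of_bool_def)
  qed
  also have "\<dots> = 1 - (2 / H) * avg n X + (1 / H\<^sup>2) * avg n (\<lambda>f. X f * X f)"
    by (simp only: avg_add avg_diff avg_cmult avg_const)
  also have "\<dots> \<le> 1 - (2 / H) * (\<rho> * H) + (1 / H\<^sup>2) * (H\<^sup>2 + H + H\<^sup>2 * weight_bound (2 * L * p) / real n)"
  proof (intro add_mono diff_mono mult_left_mono order_refl)
    have "avg n X = (\<Sum>l\<in>{1..L}. (1 / real l) * (\<Sum>x\<in>arr (l * p) Y. pr n (\<lambda>f. cyc f c (l * p) x)))"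
      unfolding X_def by (simp only: avg_sum avg_cmult)
    also have "\<dots> = (\<Sum>l\<in>{1..L}. (1 / real l) * (real (card (arr (l * p) Y)) * (1 / real n) ^ (l * p)))"
      using pr_cyc[OF arrY _ c(1)] \<open>p > 0\<close> by (intro sum.cong refl) simp
    also have "\<dots> \<ge> (\<Sum>l\<in>{1..L}. (1 / real l) * \<rho>)"
    proof (intro sum_mono mult_left_mono)
      fix l assume "l \<in> {1..L}"
      then have "\<rho> * real n ^ (l * p) * (1 / real n) ^ (l * p) \<le> real (card (arr (l * p) Y)) * (1 / real n) ^ (l * p)"
        using \<rho> unfolding Y_def by (intro mult_right_mono) auto
      then show "\<rho> \<le> real (card (arr (l * p) Y)) * (1 / real n) ^ (l * p)"
        using n by (simp add: power_one_over)
    qed simp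
    finally show "\<rho> * H \<le> avg n X" by (simp add: H_def sum_distrib_left mult.commute)
  next
    let ?W = "weight_bound (2 * L * p)"
    define S where "S = (\<lambda>l l'. \<Sum>x\<in>arr (l * p) Y. \<Sum>x'\<in>arr (l' * p) Y.
        pr n (\<lambda>f. cyc f c (l * p) x \<and> cyc f c (l' * p) x'))"
    have "avg n (\<lambda>f. X f * X f) = avg n (\<lambda>f. \<Sum>l\<in>{1..L}. \<Sum>l'\<in>{1..L}. (1 / real l) * (1 / real l') *
        (\<Sum>x\<in>arr (l * p) Y. \<Sum>x'\<in>arr (l' * p) Y. of_bool (cyc f c (l * p) x \<and> cyc f c (l' * p) x')))"
      unfolding X_def sum_product of_bool_conj
      by (intro avg_cong sum.cong refl) (simp add: sum_product mult_ac)
    also have "\<dots> = (\<Sum>l\<in>{1..L}. \<Sum>l'\<in>{1..L}. (1 / real l) * (1 / real l') * S l l')"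
      unfolding S_def by (simp only: avg_sum avg_cmult)
    \<comment> \<open>The terms bound the three contributions of \<open>pr_cyc_pair\<close>: surplus
      queries, disjoint pairs and the \<open>l\<close> rotations. After weighting, the rotations
      contribute only \<open>H\<close>, against \<open>H\<^sup>2\<close> for the disjoint
      pairs.\<close>
    also have "\<dots> \<le> (\<Sum>l\<in>{1..L}. \<Sum>l'\<in>{1..L}. (1 / real l) * (1 / real l') *
        (?W / real n + 1 + of_bool (l = l') * real l))"
    proof (intro sum_mono mult_left_mono)
      fix l l' assume l: "l \<in> {1..L}" "l' \<in> {1..L}"
      let ?m = "l * p" and ?m' = "l' * p"
      have m: "?m > 0" "?m' > 0" using l \<open>p > 0\<close> by auto
      have W: "weight_bound (?m + ?m') \<le> ?W"
        using l by (intro weight_bound_mono) (simp add: add_mult_distrib[symmetric])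
      have "S l l' \<le> (\<Sum>x\<in>arr ?m Y. \<Sum>x'\<in>arr ?m' Y.
          (1 / real n) ^ card (x ` {0..<int ?m} \<union> x' ` {0..<int ?m'}) * (1 / real n)
          + (1 / real n) ^ ?m * (1 / real n) ^ ?m'
          + of_bool (l = l' \<and> (\<exists>r<l. \<forall>i. wrap ?m' x' i = wrap ?m x (i + int r * int p))) * (1 / real n) ^ ?m)"
        unfolding S_def using l \<open>p > 0\<close> n c arrY by (intro sum_mono pr_cyc_pair) auto
      also have "\<dots> = (\<Sum>x\<in>arr ?m Y. \<Sum>x'\<in>arr ?m' Y. (1 / real n) ^ card (x ` {0..<int ?m} \<union> x' ` {0..<int ?m'})) * (1 / real n)
          + (real (card (arr ?m Y)) * (1 / real n) ^ ?m) * (real (card (arr ?m' Y)) * (1 / real n) ^ ?m')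
          + (\<Sum>x\<in>arr ?m Y. (\<Sum>x'\<in>arr ?m' Y.
              of_bool (l = l' \<and> (\<exists>r<l. \<forall>i. wrap ?m' x' i = wrap ?m x (i + int r * int p)))) * (1 / real n) ^ ?m)"
        by (simp only: sum.distrib sum_distrib_right sum_distrib_left sum_constant mult_ac)
      also have "\<dots> \<le> ?W * (1 / real n) + 1 * 1 + (\<Sum>x\<in>arr ?m Y. (of_bool (l = l') * real l) * (1 / real n) ^ ?m)"
      proof (intro add_mono mult_mono mult_right_mono sum_mono card_le)
        show "(\<Sum>x\<in>arr ?m Y. \<Sum>x'\<in>arr ?m' Y. (1 / real n) ^ card (x ` {0..<int ?m} \<union> x' ` {0..<int ?m'})) \<le> ?W"
          using sum_pair_weight[OF n m Y(1) Y(1)] W by linarith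
      next
        fix x
        show "(\<Sum>x'\<in>arr ?m' Y. of_bool (l = l' \<and> (\<exists>r<l. \<forall>i. wrap ?m' x' i = wrap ?m x (i + int r * int p))))
            \<le> of_bool (l = l') * real l"
        proof (cases "l = l'")
          case True
          have "card {x'\<in>arr ?m Y. \<exists>r\<in>{..<l}. \<forall>i. wrap ?m x' i = wrap ?m x (i + int r * int p)} \<le> card {..<l}"
            using m by (intro card_rotations_le[where g = "\<lambda>r. int r * int p"]) auto
          then show ?thesis using True unfolding sum_of_bool[OF finY] by (simp add: Bex_def)
        qed simp
      qed (auto simp: weight_bound_def)
      also have "\<dots> = ?W / real n + 1 + of_bool (l = l') * real l * (real (card (arr ?m Y)) * (1 / real n) ^ ?m)"
        by simp
      also have "\<dots> \<le> ?W / real n + 1 + of_bool (l = l') * real l * 1"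
        by (intro add_mono mult_left_mono card_le) auto
      finally show "S l l' \<le> ?W / real n + 1 + of_bool (l = l') * real l" by simp
    qed simp
    also have "\<dots> = (\<Sum>l\<in>{1..L}. \<Sum>l'\<in>{1..L}. (1 / real l) * (1 / real l') * (?W / real n + 1)
        + (1 / real l') * of_bool (l = l'))"
      by (intro sum.cong refl) (auto simp: distrib_left)
    also have "\<dots> = (\<Sum>l\<in>{1..L}. \<Sum>l'\<in>{1..L}. (1 / real l) * (1 / real l')) * (?W / real n + 1)
        + (\<Sum>l\<in>{1..L}. \<Sum>l'\<in>{1..L}. (1 / real l') * of_bool (l = l'))"
      by (simp only: sum.distrib sum_distrib_right)
    also have "(\<Sum>l\<in>{1..L}. \<Sum>l'\<in>{1..L}. (1 / real l) * (1 / real l')) = H * H"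
      by (simp only: H_def sum_product)
    also have "(\<Sum>l\<in>{1..L}. \<Sum>l'\<in>{1..L}. (1 / real l') * of_bool (l = l')) = H"
      unfolding H_def by (intro sum.cong refl) (simp add: of_bool_def if_distrib cong: if_cong)
    finally show "avg n (\<lambda>f. X f * X f) \<le> H\<^sup>2 + H + H\<^sup>2 * ?W / real n"
      by (simp add: power2_eq_square distrib_left)
  qed (use H in auto)
  also have "\<dots> = 2 * (1 - \<rho>) + 1 / harm L + weight_bound (2 * L * p) / real n"
  proof -
    define w where "w = weight_bound (2 * L * p) / real n"
    have "(2 / H) * (\<rho> * H) = 2 * \<rho>" using H by simp
    moreover have "(1 / H\<^sup>2) * (H\<^sup>2 + H + H\<^sup>2 * w) = 1 + 1 / H + w"
      using H by (simp add: distrib_left power2_eq_square)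
    ultimately show ?thesis by (simp add: Hh w_def)
  qed
  finally show ?thesis .
qed

text \<open>The length bound \<open>L\<close> is fixed before \<open>n\<close>, large enough for
  \<open>1 / harm L\<close> to be small; the other error terms vanish as \<open>n\<close> grows.
  They depend on \<open>c\<close> and \<open>V\<close> only through \<open>p\<close> and
  \<open>M\<close>, so the bound is uniform, which is needed when summing over all tiles.\<close>

lemma pr_no_fresh:
  assumes "p > 0" "\<epsilon> > 0"
  shows "\<forall>\<^sub>F n in sequentially. \<forall>c V. (\<forall>i. c i < n) \<and> periodic (int p) c \<and> primitive p c \<and> V \<subseteq> {..<n} \<and> card V \<le> M
    \<longrightarrow> pr n (\<lambda>f. no_fresh n f c p V) \<le> \<epsilon>"
proof -
  have "\<forall>\<^sub>F L in sequentially. (harm L :: real) > 2 / \<epsilon>"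
    using harm_at_top unfolding filterlim_at_top_dense by blast
  then have "\<forall>\<^sub>F L in sequentially. (harm L :: real) > 2 / \<epsilon> \<and> L > 0"
    using eventually_gt_at_top[of 0] by eventually_elim auto
  then obtain L where L: "(harm L :: real) > 2 / \<epsilon>" "L > 0"
    using eventually_happens'[OF sequentially_bot] by blast
  have hL: "1 / harm L < \<epsilon> / 2"
  proof -
    have "2 / \<epsilon> * (\<epsilon> / 2) < harm L * (\<epsilon> / 2)" using L(1) assms(2) by (intro mult_strict_right_mono) auto
    moreover have "(harm L :: real) > 0" using L(2) by simp
    ultimately show ?thesis using assms(2) by (simp add: divide_less_eq mult.commute)
  qed
  \<comment> \<open>Each position of a word has at least \<open>n - K\<close> choices: at most
    \<open>M\<close> states are forbidden, and distinctness costs at most \<open>L * p\<close>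
    more.\<close>
  define K where "K = M + L * p"
  define \<rho> where "\<rho> = (\<lambda>n. (1 - real K / real n) ^ (L * p))"
  have "(\<lambda>n. 2 * (1 - \<rho> n) + weight_bound (2 * L * p) / real n) \<longlonglongrightarrow> 2 * (1 - (1 - 0) ^ (L * p)) + 0"
    unfolding \<rho>_def by (intro tendsto_intros lim_const_over_n)
  then have "(\<lambda>n. 2 * (1 - \<rho> n) + weight_bound (2 * L * p) / real n) \<longlonglongrightarrow> 0" by simp
  then have "\<forall>\<^sub>F n in sequentially. 2 * (1 - \<rho> n) + weight_bound (2 * L * p) / real n < \<epsilon> / 2"
    using assms(2) by (intro order_tendstoD) auto
  then show ?thesis
    using eventually_ge_at_top[of K] eventually_gt_at_top[of 0]
  proof eventually_elim
    case (elim n)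
    show ?case
    proof (intro allI impI)
      fix c V assume *: "(\<forall>i. c i < n) \<and> periodic (int p) c \<and> primitive p c \<and> V \<subseteq> {..<n} \<and> card V \<le> M"
      have cY: "card ({..<n} - V) \<ge> n - M" using * card_Diff_subset[of V "{..<n}"] finite_subset[of V "{..<n}"] by (simp add: diff_le_mono2)
      have "\<rho> n * real n ^ (l * p) \<le> real (card (arr (l * p) ({..<n} - V)))" if l: "l \<in> {1..L}" for l
      proof -
        have lp: "l * p \<le> L * p" using l by simp
        have 1: "0 \<le> 1 - real K / real n" "1 - real K / real n \<le> 1" using elim by (auto simp: field_simps)
        have "\<rho> n * real n ^ (l * p) \<le> (1 - real K / real n) ^ (l * p) * real n ^ (l * p)"
          unfolding \<rho>_def using 1 by (intro mult_right_mono power_decreasing lp) auto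
        also have "\<dots> = real (n - K) ^ (l * p)"
          using elim by (simp add: power_mult_distrib[symmetric] of_nat_diff field_simps)
        also have "\<dots> \<le> real (card ({..<n} - V) - l * p) ^ (l * p)"
        proof -
          have "n - K \<le> card ({..<n} - V) - l * p" using cY lp unfolding K_def by linarith
          then show ?thesis by (intro power_mono) auto
        qed
        also have "\<dots> \<le> real (card (arr (l * p) ({..<n} - V)))"
        proof -
          have "l * p \<le> card ({..<n} - V)" using cY lp elim unfolding K_def by linarith
          then show ?thesis
            unfolding of_nat_power[symmetric] of_nat_le_iff by (intro card_arr_ge) auto
        qed
        finally show ?thesis .
      qed
      then have "pr n (\<lambda>f. no_fresh n f c p V) \<le> 2 * (1 - \<rho> n) + 1 / harm L + weight_bound (2 * L * p) / real n"
        using * assms(1) L(2) by (intro pr_no_fresh_le) auto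
      then show "pr n (\<lambda>f. no_fresh n f c p V) \<le> \<epsilon>" using hL elim by linarith
    qed
  qed
qed

lemma no_fresh_override:
  assumes "p > 0"
  shows "no_fresh n (override_on f g (UNIV \<times> (- V))) c p V = no_fresh n g c p V"
proof -
  have "cyc (override_on f g (UNIV \<times> (- V))) c (l * p) x = cyc g c (l * p) x"
    if "x \<in> arr (l * p) ({..<n} - V)" for l x
    unfolding cyc_def using that by (intro ball_cong refl) (auto simp: override_on_def arr_def PiE_iff)
  then show ?thesis unfolding no_fresh_def by simp
qed

text \<open>The pattern reads entries with second argument in \<open>V\<close>, whereas fresh cycles
  read only entries with second argument outside \<open>V\<close>, so the probabilities
  multiply.\<close>

lemma pr_pattern_no_fresh:
  assumes "\<And>j. j \<in> J \<Longrightarrow> q j \<in> {..<n} \<times> {..<n}" "\<And>j. j \<in> J \<Longrightarrow> r j < n"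
    and "\<And>j. j \<in> J \<Longrightarrow> snd (q j) \<in> V" "p > 0" "pr n (\<lambda>f. no_fresh n f c p V) \<le> \<epsilon>"
  shows "pr n (\<lambda>f. no_fresh n f c p V \<and> (\<forall>j\<in>J. f (q j) = r j)) \<le> \<epsilon> * (1 / real n) ^ card (q ` J)"
proof -
  have "pr n (\<lambda>f. no_fresh n f c p V \<and> (\<forall>j\<in>J. f (q j) = r j))
    = pr n (\<lambda>f. no_fresh n f c p V) * pr n (\<lambda>f. \<forall>j\<in>J. f (q j) = r j)"
  proof (rule pr_indep[where I = "UNIV \<times> (- V)"])
    fix f g :: ca_rule
    have "override_on f g (UNIV \<times> (- V)) (q j) = f (q j)" if "j \<in> J" for j
      using assms(3)[OF that] by (cases "q j") (auto simp: override_on_def)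
    then show "(\<forall>j\<in>J. override_on f g (UNIV \<times> (- V)) (q j) = r j) = (\<forall>j\<in>J. f (q j) = r j)" by simp
  qed (rule no_fresh_override[OF assms(4)])
  also have "\<dots> \<le> \<epsilon> * (1 / real n) ^ card (q ` J)"
    using pr_pattern[where J = J and q = q and r = r, OF assms(1,2)] assms(5)
      order_trans[OF pr_nonneg assms(5)]
    by (intro mult_mono) auto
  finally show ?thesis .
qed

section \<open>Weak robustness\<close>

lemma run_0 [simp]: "run f \<xi> 0 = \<xi>"
  by (simp add: run_def)

lemma run_Suc: "run f \<xi> (Suc t) x = f (run f \<xi> t (x - 1), run f \<xi> t x)"
  by (simp add: run_def step_def)

lemma run_add: "run f \<xi> (s + t) = run f (run f \<xi> s) t"
  by (simp add: run_def funpow_add add.commute[of s])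

lemma run_less: "f \<in> rules n \<Longrightarrow> \<xi> \<in> configs n \<Longrightarrow> run f \<xi> t x < n"
  by (induction t arbitrary: x) (auto simp: configs_def run_Suc rules_less)

lemma run_shift: "(\<And>x. \<xi> (x + k) = \<xi> x) \<Longrightarrow> run f \<xi> t (x + k) = run f \<xi> t x"
proof (induction t arbitrary: x)
  case (Suc t)
  have "x + k - 1 = (x - 1) + k" by simp
  with Suc show ?case by (simp only: run_Suc)
qed simp

lemma run_mult: "run f \<xi> \<tau> = \<xi> \<Longrightarrow> run f \<xi> (k * \<tau>) = \<xi>"
  by (induction k) (simp_all add: run_add)

lemma run_mod: "run f \<xi> \<tau> = \<xi> \<Longrightarrow> run f \<xi> (t mod \<tau>) = run f \<xi> t"
  using run_add[of f \<xi> "(t div \<tau>) * \<tau>" "t mod \<tau>"] run_mult[of f \<xi> \<tau> "t div \<tau>"] by simp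

text \<open>The column at \<open>x\<close>, extended periodically to all integer times, so that
  phases can be shifted in both directions.\<close>

definition diag :: "ca_rule \<Rightarrow> config \<Rightarrow> nat \<Rightarrow> int \<Rightarrow> int \<Rightarrow> nat" where
  "diag f \<xi> \<tau> x t = run f \<xi> (nat (t mod int \<tau>)) x"

lemma diag_int: "run f \<xi> \<tau> = \<xi> \<Longrightarrow> diag f \<xi> \<tau> x (int t) = run f \<xi> t x"
proof -
  assume "run f \<xi> \<tau> = \<xi>"
  moreover have "nat (int t mod int \<tau>) = t mod \<tau>" by (simp flip: of_nat_mod)
  ultimately show ?thesis by (simp add: diag_def run_mod)
qed

lemma diag_periodic: "periodic (int \<tau>) (diag f \<xi> \<tau> x)"
  by (simp add: periodic_def diag_def)

lemma diag_rec:
  assumes "run f \<xi> \<tau> = \<xi>" "\<tau> > 0"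
  shows "f (diag f \<xi> \<tau> x t, diag f \<xi> \<tau> (x + 1) t) = diag f \<xi> \<tau> (x + 1) (t + 1)"
proof -
  define s where "s = nat (t mod int \<tau>)"
  have "int s mod int \<tau> = t mod int \<tau>" using assms(2) by (simp add: s_def)
  then have "diag f \<xi> \<tau> y t = diag f \<xi> \<tau> y (int s)" "diag f \<xi> \<tau> y (t + 1) = diag f \<xi> \<tau> y (int (Suc s))" for y
  proof -
    show "diag f \<xi> \<tau> y t = diag f \<xi> \<tau> y (int s)"
      by (rule periodic_cong[OF diag_periodic]) (use \<open>int s mod int \<tau> = t mod int \<tau>\<close> in simp)
    have "(t + 1) mod int \<tau> = (int s + 1) mod int \<tau>"
      using \<open>int s mod int \<tau> = t mod int \<tau>\<close> by (metis mod_add_left_eq)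
    then show "diag f \<xi> \<tau> y (t + 1) = diag f \<xi> \<tau> y (int (Suc s))"
      by (intro periodic_cong[OF diag_periodic]) (simp add: add.commute)
  qed
  then show ?thesis by (simp only: diag_int[OF assms(1)] run_Suc) simp
qed

text \<open>If the orbit of some state \<open>x\<close> never meets the next column, changing \<xi>
  to \<open>x\<close> at the single cell \<open>y + 1\<close> gives a proper configuration whose
  front stays at \<open>y\<close> forever, so its velocity is 0.\<close>

lemma weakly_robust_attracts:
  assumes f: "f \<in> rules n" and \<xi>: "\<xi> \<in> configs n" "run f \<xi> \<tau> = \<xi>" "\<tau> > 0"
    and wr: "weakly_robust n f \<xi>"
  shows "attracts n f (diag f \<xi> \<tau> y) (diag f \<xi> \<tau> (y + 1))"
proof (rule ccontr)
  assume "\<not> ?thesis"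
  then obtain x where x: "x < n" "\<And>s. orb f (diag f \<xi> \<tau> y) x s \<noteq> diag f \<xi> \<tau> (y + 1) (int s)"
    using diag_rec[OF \<xi>(2,3)] unfolding attracts_def by blast
  define \<eta> where "\<eta> = \<xi>(y + 1 := x)"
  have "proper n \<xi> \<eta>"
  proof -
    have "\<forall>z\<le>y. \<eta> z = \<xi> z" by (simp add: \<eta>_def)
    moreover have "\<eta> \<in> configs n" using \<xi>(1) x(1) by (simp add: configs_def \<eta>_def)
    ultimately show ?thesis unfolding proper_def by blast
  qed
  have agree: "run f \<eta> t z = run f \<xi> t z" if "z \<le> y" for t z
    using that by (induction t arbitrary: z) (auto simp: \<eta>_def run_Suc)
  have orb: "run f \<eta> t (y + 1) = orb f (diag f \<xi> \<tau> y) x t" for t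
  proof (induction t)
    case (Suc t)
    then show ?case by (simp add: run_Suc agree diag_int[OF \<xi>(2)])
  qed (simp add: \<eta>_def)
  have set: "{z. \<forall>w\<le>z. run f \<eta> t w = run f \<xi> t w} = {..y}" for t
  proof (intro set_eqI iffI)
    fix z assume z: "z \<in> {z. \<forall>w\<le>z. run f \<eta> t w = run f \<xi> t w}"
    have "run f \<eta> t (y + 1) \<noteq> run f \<xi> t (y + 1)"
      using x(2)[of t] by (simp add: orb diag_int[OF \<xi>(2)])
    then have "\<not> y + 1 \<le> z" using z by auto
    then show "z \<in> {..y}" by simp
  qed (use agree in auto)
  have front: "front f \<xi> \<eta> t = ereal (real_of_int y)" for t
    unfolding front_def set by (intro antisym SUP_least SUP_upper) auto
  have "velocity f \<xi> \<eta> = liminf (\<lambda>t. ereal (real_of_int y / real t))"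
    unfolding velocity_def front
    by (intro Liminf_eq eventually_mono[OF eventually_gt_at_top[of 0]]) auto
  also have "\<dots> = 0"
  proof (rule lim_imp_Liminf)
    show "(\<lambda>t. ereal (real_of_int y / real t)) \<longlonglongrightarrow> 0"
      using tendsto_ereal[OF lim_const_over_n[of "real_of_int y"]] by (simp add: zero_ereal_def)
  qed simp
  finally have "expansion_velocity n f \<xi> \<le> 0"
    unfolding expansion_velocity_def using \<open>proper n \<xi> \<eta>\<close> by (metis INF_lower mem_Collect_eq)
  then show False using wr unfolding weakly_robust_def by simp
qed

text \<open>Up to periodicity there are finitely many columns, phases and starting states, so one
  time \<open>K\<close> suffices for every collapse. The front thus advances by at least one cell
  every \<open>K\<close> steps, and every proper configuration has velocity at least
  \<open>1 / K\<close>.\<close>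

lemma attracts_weakly_robust:
  assumes f: "f \<in> rules n" and \<xi>: "\<xi> \<in> configs n" "run f \<xi> \<tau> = \<xi>" "\<tau> > 0"
    and \<sigma>: "\<sigma> > 0" "\<And>x. \<xi> (x + int \<sigma>) = \<xi> x"
    and att: "\<And>y. attracts n f (diag f \<xi> \<tau> y) (diag f \<xi> \<tau> (y + 1))"
  shows "weakly_robust n f \<xi>"
proof -
  let ?U = "diag f \<xi> \<tau>"
  have less: "?U y t < n" for y t unfolding diag_def using run_less[OF f \<xi>(1)] .
  have rec: "f (?U y i, ?U (y + 1) i) = ?U (y + 1) (i + 1)" for y i by (rule diag_rec[OF \<xi>(2,3)])
  have Uy: "?U (y + int \<sigma>) = ?U y" for y
    by (rule ext) (simp add: diag_def run_shift[of \<xi> "int \<sigma>", OF \<sigma>(2)])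
  have Uymod: "?U (y mod int \<sigma>) = ?U y" for y
    using periodic_mod[of "int \<sigma>" ?U y] Uy by (simp add: periodic_def)
  have "\<exists>s. orb f (\<lambda>i. ?U y (i + r)) a s = ?U (y + 1) (int s + r)" if "a < n" for y r a
    using attracts_shift[OF att f less _ diag_periodic diag_periodic, of y r] \<xi>(3) that
    unfolding attracts_def by auto
  note ex = this
  define S where "S = (\<lambda>y r a. SOME s. orb f (\<lambda>i. ?U y (i + r)) a s = ?U (y + 1) (int s + r))"
  have S: "orb f (\<lambda>i. ?U y (i + r)) a (S y r a) = ?U (y + 1) (int (S y r a) + r)" if "a < n" for y r a
    unfolding S_def using ex[OF that] by (rule someI_ex)
  define K where "K = Suc (Max ((\<lambda>(y, r, a). S y r a) ` ({0..<int \<sigma>} \<times> {0..<int \<tau>} \<times> {..<n})))"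
  have K: "\<exists>s\<le>K. orb f (\<lambda>i. ?U y (i + r)) a s = ?U (y + 1) (int s + r)" if a: "a < n" for y r a
  proof -
    let ?y = "y mod int \<sigma>" and ?r = "r mod int \<tau>"
    have "S ?y ?r a \<le> K"
      unfolding K_def using a \<xi>(3) \<sigma>(1)
      by (intro le_SucI Max_ge) (auto intro!: image_eqI[of _ _ "(?y, ?r, a)"])
    moreover have "?U (?y + 1) = ?U (y + 1)"
      using Uymod[of "?y + 1"] Uymod[of "y + 1"] by (simp add: mod_add_left_eq)
    moreover have "?U z (i + ?r) = ?U z (i + r)" for z i
      by (rule periodic_cong[OF diag_periodic]) (simp add: mod_add_right_eq)
    ultimately show ?thesis
      using S[OF a, of ?y ?r] by (intro exI[of _ "S ?y ?r a"]) (simp add: Uymod)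
  qed
  have Kpos: "K > 0" by (simp add: K_def)
  have vel: "ereal (1 / real K) \<le> velocity f \<xi> \<eta>" if pp: "proper n \<xi> \<eta>" for \<eta>
  proof -
    from pp obtain y0 where \<eta>: "\<eta> \<in> configs n" and y0: "\<And>x. x \<le> y0 \<Longrightarrow> \<eta> x = \<xi> x"
      unfolding proper_def by blast
    have agree: "run f \<eta> t x = run f \<xi> t x" if "x \<le> y0 + int j" "t \<ge> j * K" for j t x
      using that
    proof (induction j arbitrary: t x)
      case 0
      then show ?case by (induction t arbitrary: x) (auto simp: y0 run_Suc)
    next
      case (Suc j)
      show ?case
      proof (cases "x \<le> y0 + int j")
        case True
        then show ?thesis using Suc.IH[of x t] Suc.prems by simp
      next
        case False
        then have x: "x = (y0 + int j) + 1" using Suc.prems by simp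
        let ?y = "y0 + int j" and ?r = "j * K"
        note IHj = Suc.IH
        have orb: "run f \<eta> (?r + s) x = orb f (\<lambda>i. ?U ?y (i + int ?r)) (run f \<eta> ?r x) s" for s
        proof (induction s)
          case (Suc s)
          have "run f \<eta> (?r + s) ?y = ?U ?y (int s + int ?r)"
            using IHj[of ?y "?r + s"] diag_int[OF \<xi>(2), of ?y "?r + s"] by (simp add: add.commute)
          with Suc show ?case by (simp add: run_Suc x)
        qed simp
        have "run f \<eta> ?r x < n" using run_less[OF f \<eta>] .
        from K[OF this, of ?y "int ?r"] obtain s where s: "s \<le> K"
          "orb f (\<lambda>i. ?U ?y (i + int ?r)) (run f \<eta> ?r x) s = ?U (?y + 1) (int s + int ?r)" by blast
        have st: "s \<le> t - ?r" using s(1) Suc.prems(2) by simp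
        have step_U: "f (?U ?y (i + int ?r), ?U (?y + 1) (i + int ?r)) = ?U (?y + 1) (i + 1 + int ?r)" for i
        proof -
          have "i + 1 + int ?r = i + int ?r + 1" by simp
          then show ?thesis using rec[of ?y "i + int ?r"] by (simp only:)
        qed
        have "orb f (\<lambda>i. ?U ?y (i + int ?r)) (run f \<eta> ?r x) (t - ?r) = ?U (?y + 1) (int (t - ?r) + int ?r)"
          by (rule orb_attracted[where d = "\<lambda>i. ?U (?y + 1) (i + int ?r)", OF step_U s(2) st])
        moreover have "?r + (t - ?r) = t" using Suc.prems(2) by simp
        ultimately show ?thesis
          using orb[of "t - ?r"] diag_int[OF \<xi>(2), of "?y + 1" t]
          by (simp only: x of_nat_add[symmetric] add.commute[of "t - ?r"])
      qed
    qed
    \<comment> \<open>The \<open>- 1\<close> pays for rounding \<open>t / K\<close> down to the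
      number of completed collapses.\<close>
    have lower: "ereal ((real_of_int y0 - 1) / real t + 1 / real K) \<le> front f \<xi> \<eta> t / ereal (real t)" if t: "t > 0" for t
    proof -
      have "ereal (real_of_int (y0 + int (t div K))) \<le> front f \<xi> \<eta> t"
        unfolding front_def using agree[of _ "t div K" t] by (intro SUP_upper) auto
      moreover have "real_of_int y0 - 1 + real t / real K \<le> real_of_int (y0 + int (t div K))"
      proof -
        have "t \<le> (t div K + 1) * K"
          using dividend_less_div_times[OF Kpos, of t] by simp
        then have "real t \<le> real ((t div K + 1) * K)" by (rule of_nat_mono)
        then have "real t / real K \<le> real (t div K) + 1"
          using Kpos by (simp add: divide_le_eq distrib_right)
        then show ?thesis by simp
      qed
      ultimately have "ereal (real_of_int y0 - 1 + real t / real K) \<le> front f \<xi> \<eta> t"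
        by (meson ereal_less_eq(3) order_trans)
      then have "ereal (real_of_int y0 - 1 + real t / real K) / ereal (real t) \<le> front f \<xi> \<eta> t / ereal (real t)"
        using t by (intro ereal_divide_right_mono) auto
      then show ?thesis using t by (simp add: add_divide_distrib)
    qed
    have "(\<lambda>t. ereal ((real_of_int y0 - 1) / real t + 1 / real K)) \<longlonglongrightarrow> ereal (0 + 1 / real K)"
      by (intro tendsto_ereal tendsto_add lim_const_over_n tendsto_const)
    then have "ereal (1 / real K) = liminf (\<lambda>t. ereal ((real_of_int y0 - 1) / real t + 1 / real K))"
      by (intro lim_imp_Liminf[symmetric]) auto
    also have "\<dots> \<le> velocity f \<xi> \<eta>"
      unfolding velocity_def
      by (intro Liminf_mono eventually_mono[OF eventually_gt_at_top[of 0]] lower)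
    finally show ?thesis .
  qed
  have "ereal (1 / real K) \<le> expansion_velocity n f \<xi>"
    unfolding expansion_velocity_def by (intro INF_greatest) (use vel in auto)
  moreover have "(0 :: ereal) < ereal (1 / real K)" using Kpos by simp
  ultimately show ?thesis unfolding weakly_robust_def by (rule less_le_trans[rotated])
qed

section \<open>Columns that are rotations of each other\<close>

lemma orb_cong: "(\<And>i b. f (c i, b) = g (c i, b)) \<Longrightarrow> orb f c x s = orb g c x s"
  by (induction s) auto

text \<open>Attraction by \<open>c\<close> reads only the rows of the states of \<open>c\<close>.
  This is what makes attractions by disjoint columns independent.\<close>

lemma attracts_cong:
  assumes "\<And>i b. f (c i, b) = g (c i, b)" shows "attracts n f c d = attracts n g c d"
  unfolding attracts_def using assms orb_cong[of f c g, OF assms] by simp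

definition rot_attr :: "nat \<Rightarrow> ca_rule \<Rightarrow> nat \<Rightarrow> nat \<Rightarrow> (int \<Rightarrow> nat) \<Rightarrow> bool" where
  "rot_attr n f p h c \<longleftrightarrow> attracts n f (wrap p c) (\<lambda>i. wrap p c (i + int h))"

lemma wrap_primitive: "c \<in> arr p Y \<Longrightarrow> p > 0 \<Longrightarrow> primitive p (wrap p c)"
  unfolding primitive_def
proof (intro allI impI notI)
  fix q assume c: "c \<in> arr p Y" "p > 0" and q: "0 < q \<and> q < int p" "periodic q (wrap p c)"
  then have "wrap p c (0 + q) = wrap p c 0" by (simp only: periodicD)
  then have "q mod int p = 0" using wrap_inj[OF c, of "0 + q" 0] by simp
  then show False using q by simp
qed

lemma inj_on_wrap: "c \<in> arr p Y \<Longrightarrow> p > 0 \<Longrightarrow> inj_on (wrap p c) {0..<int p}"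
  by (auto simp: inj_on_def wrap_inj)

lemma pr_rot_attr:
  assumes "c \<in> arr p {..<n}" "p > 0"
  shows "pr n (\<lambda>f. rot_attr n f p h c) = (1 / real n) ^ p * (1 - (1 - 1 / real n) ^ p)"
  unfolding rot_attr_def
proof (rule pr_attracts)
  show "periodic (int p) (wrap p c)" by (rule periodic_wrap)
  show "periodic (int p) (\<lambda>i. wrap p c (i + int h))"
    by (rule periodic_shift[OF periodic_wrap])
qed (use assms inj_on_wrap wrap_in[OF assms] in auto)

lemma survival_le: "n > 0 \<Longrightarrow> 1 - (1 - 1 / real n) ^ p \<le> real p / real n"
  using Bernoulli_inequality[of "- (1 / real n)" p] by simp

lemma survival_nonneg: "n > 0 \<Longrightarrow> 0 \<le> 1 - (1 - 1 / real n) ^ p"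
  by (simp add: power_le_one)

text \<open>The first error term comes from surplus queries: they cost \<open>1 / n\<close>, and the
  absence of fresh cycles for \<open>c\<close> costs \<epsilon>. The second comes from disjoint
  columns, which collapse independently. Without surplus queries, a common state forces the columns
  to be rotations of each other with the same slope, which the last term accounts for.\<close>

lemma pr_rot_attr_pair:
  assumes c: "c \<in> arr p {..<n}" "p > 0" "h < p" and c': "c' \<in> arr p' {..<n}" "p' > 0" "h' < p'"
    and "0 \<le> \<epsilon>" and nf: "pr n (\<lambda>f. no_fresh n f (wrap p c) p (c ` {0..<int p} \<union> c' ` {0..<int p'})) \<le> \<epsilon>"
  shows "pr n (\<lambda>f. rot_attr n f p h c \<and> rot_attr n f p' h' c')
    \<le> (1 / real n) ^ card (c ` {0..<int p} \<union> c' ` {0..<int p'}) * (\<epsilon> / real n + real p * real p' / (real n)\<^sup>2)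
      + of_bool (p = p' \<and> h = h' \<and> (\<exists>r<p. \<forall>i. wrap p' c' i = wrap p c (i + int r)))
        * pr n (\<lambda>f. rot_attr n f p h c)"
    (is "?P \<le> ?A * (?e + ?d) + ?C")
proof -
  let ?V = "c ` {0..<int p} \<union> c' ` {0..<int p'}"
  let ?c = "wrap p c" and ?c' = "wrap p' c'"
  have n: "n > 0" using wrap_in[OF c(1,2), of 0] by simp
  define J where "J = {0..<int p} <+> {0..<int p'}"
  define q where "q = case_sum (\<lambda>i. (?c i, ?c (i + int h))) (\<lambda>i. (?c' i, ?c' (i + int h')))"
  define r where "r = case_sum (\<lambda>i. ?c (i + (int h + 1))) (\<lambda>i. ?c' (i + (int h' + 1)))"
  have finJ: "finite J" by (simp add: J_def)
  have V: "?c i \<in> ?V" "?c' i \<in> ?V" for i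
    using range_wrap[of p c] range_wrap[of p' c'] c(2) c'(2) by (metis Un_iff rangeI)+
  have Vn: "?V \<subseteq> {..<n}" using c c' by (auto simp: arr_def PiE_iff)
  have less: "?c i < n" "?c' i < n" for i using wrap_in[OF c(1,2)] wrap_in[OF c'(1,2)] by auto
  have ev: "f (q j) = r j" if "rot_attr n f p h c" "rot_attr n f p' h' c'" "j \<in> J" for f j
  proof -
    have "f (?c i, ?c (i + int h)) = ?c (i + (int h + 1))" "f (?c' i, ?c' (i + int h')) = ?c' (i + (int h' + 1))" for i
    proof -
      have "i + (int k + 1) = i + 1 + int k" for k by simp
      then show "f (?c i, ?c (i + int h)) = ?c (i + (int h + 1))" "f (?c' i, ?c' (i + int h')) = ?c' (i + (int h' + 1))"
        using that(1,2) unfolding rot_attr_def attracts_def by (simp_all only:)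
    qed
    then show ?thesis by (cases j) (simp_all only: q_def r_def sum.case)
  qed
  have q_in: "q j \<in> {..<n} \<times> {..<n}" "r j < n" "snd (q j) \<in> ?V" for j
    using less V by (cases j; simp add: q_def r_def)+
  have rJ: "r ` J = ?V"
  proof -
    have "r ` J = (\<lambda>i. ?c (i + (int h + 1))) ` {0..<int p} \<union> (\<lambda>i. ?c' (i + (int h' + 1))) ` {0..<int p'}"
      by (simp add: J_def r_def Plus_def image_Un image_image)
    then show ?thesis unfolding wrap_image[OF c(2)] wrap_image[OF c'(2)] .
  qed
  have pos: "0 \<le> ?A" "0 \<le> ?e" "0 \<le> ?d" "0 \<le> ?C" using \<open>0 \<le> \<epsilon>\<close> by auto
  have pos': "0 \<le> ?A * ?e" "0 \<le> ?A * ?d" using pos by (simp_all only: mult_nonneg_nonneg)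
  consider "card (q ` J) > card (r ` J)" | "?P = 0"
    | f where "card (q ` J) \<le> card (r ` J)" "\<And>j. j \<in> J \<Longrightarrow> f (q j) = r j"
  proof (cases "\<exists>f. rot_attr n f p h c \<and> rot_attr n f p' h' c'")
    case True
    then obtain f where f: "rot_attr n f p h c" "rot_attr n f p' h' c'" by blast
    show ?thesis
    proof (cases "card (q ` J) > card (r ` J)")
      case True
      then show ?thesis by (rule that(1))
    next
      case False
      then have "card (q ` J) \<le> card (r ` J)" by simp
      then show ?thesis using ev[OF f] by (rule that(3))
    qed
  next
    case False
    then have "?P = 0" by (intro pr_eq_0) blast
    then show ?thesis by (rule that(2))
  qed
  then show ?thesis
  proof cases
    case 1
    have "?P \<le> pr n (\<lambda>f. no_fresh n f ?c p ?V \<and> (\<forall>j\<in>J. f (q j) = r j))"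
    proof (rule pr_mono)
      fix f assume f: "rot_attr n f p h c \<and> rot_attr n f p' h' c'"
      then have "no_fresh n f ?c p ?V"
        using attracts_no_fresh[OF _ periodic_wrap c(2)] V(1) unfolding rot_attr_def by blast
      then show "no_fresh n f ?c p ?V \<and> (\<forall>j\<in>J. f (q j) = r j)" using ev f by blast
    qed
    also have "\<dots> \<le> \<epsilon> * (1 / real n) ^ card (q ` J)"
      using q_in c(2) nf by (intro pr_pattern_no_fresh) auto
    also have "\<dots> \<le> \<epsilon> * (1 / real n) ^ Suc (card (r ` J))"
      using 1 n \<open>0 \<le> \<epsilon>\<close> by (intro mult_left_mono power_decreasing) auto
    also have "\<dots> = ?A * ?e" by (simp add: rJ)
    finally show ?thesis using pos pos' unfolding distrib_left by linarith
  next
    case 2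
    then show ?thesis using pos pos' unfolding distrib_left by linarith
  next
    case 3
    have bwd: "q j = q j'" if "j \<in> J" "j' \<in> J" "r j = r j'" for j j'
      by (rule pattern_backward[where f = f and r = r and J = J]) (use 3 finJ that in auto)
    show ?thesis
    proof (cases "c ` {0..<int p} \<inter> c' ` {0..<int p'} = {}")
      case True
      have "?P = pr n (\<lambda>f. rot_attr n f p h c) * pr n (\<lambda>f. rot_attr n f p' h' c')"
      proof (rule pr_indep[where I = "(c ` {0..<int p}) \<times> UNIV"])
        fix f g :: ca_rule
        show "rot_attr n (override_on f g (c ` {0..<int p} \<times> UNIV)) p h c = rot_attr n g p h c"
          unfolding rot_attr_def using range_wrap[OF c(2), of c]
          by (intro attracts_cong) (auto simp: override_on_def)
        have "?c' i \<notin> c ` {0..<int p}" for i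
          using True range_wrap[OF c'(2), of c'] by blast
        then show "rot_attr n (override_on f g (c ` {0..<int p} \<times> UNIV)) p' h' c' = rot_attr n f p' h' c'"
          unfolding rot_attr_def by (intro attracts_cong) (auto simp: override_on_def)
      qed
      also have "\<dots> \<le> ((1 / real n) ^ p * (real p / real n)) * ((1 / real n) ^ p' * (real p' / real n))"
        unfolding pr_rot_attr[OF c(1,2)] pr_rot_attr[OF c'(1,2)]
        using survival_le[OF n] survival_nonneg[OF n]
        by (intro mult_mono mult_left_mono mult_nonneg_nonneg) auto
      also have "\<dots> = (1 / real n) ^ (p + p') * ?d"
        by (simp add: power_add power2_eq_square)
      also have "p + p' = card ?V"
      proof -
        have "card (c ` {0..<int p}) = p" "card (c' ` {0..<int p'}) = p'"
          using c c' by (simp_all add: arr_def card_image)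
        then show ?thesis using True by (subst card_Un_disjoint) auto
      qed
      finally show ?thesis using pos pos' unfolding distrib_left by linarith
    next
      case False
      have stp: "?c (i - 1) = ?c' (j - 1) \<and> ?c (i - 1 - int h) = ?c' (j - 1 - int h')"
        if "?c i = ?c' j" for i j
      proof -
        let ?i = "(i - 1 - int h) mod int p" and ?j = "(j - 1 - int h') mod int p'"
        have "Inl ?i \<in> J" "Inr ?j \<in> J" using c c' by (auto simp: J_def)
        moreover have sh: "wrap m x ((k - 1 - int s) mod int m + (int s + 1)) = wrap m x k"
           "wrap m x ((k - 1 - int s) mod int m + int s) = wrap m x (k - 1)"
           "wrap m x ((k - 1 - int s) mod int m) = wrap m x (k - 1 - int s)" for m x k s
          by (simp_all add: wrap_def mod_simps)
        then have "r (Inl ?i) = r (Inr ?j)"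
          using that by (simp add: r_def)
        ultimately have "q (Inl ?i) = q (Inr ?j)" by (rule bwd)
        then show ?thesis by (simp add: q_def sh)
      qed
      from False have "range ?c \<inter> range ?c' \<noteq> {}" using range_wrap c(2) c'(2) by simp
      then obtain i j where ij: "?c i = ?c' j" by blast
      have pp: "p = p'"
        by (rule arr_rotation(1)[OF c(1,2) c'(1,2) ij]) (use stp in blast)
      have rot: "?c' t = ?c (t + (i - j))" for t
        by (rule arr_rotation(2)[OF c(1,2) c'(1,2) ij]) (use stp in blast)
      \<comment> \<open>The first component of a query lies \<open>h\<close> phases behind the
        second, and \<open>h'\<close> phases for the other column. Comparing these positions in the
        injective word \<open>c\<close> identifies the slopes modulo \<open>p\<close>.\<close>
      have "?c (i - 1 - int h) = ?c (j - 1 - int h' + (i - j))"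
        using stp[OF ij] rot by metis
      then have "(i - 1 - int h) mod int p = (i - 1 - int h') mod int p"
        unfolding wrap_inj[OF c(1,2)] by (simp add: algebra_simps)
      then have "int p dvd (i - 1 - int h) - (i - 1 - int h')" by (simp only: mod_eq_dvd_iff)
      then have "int p dvd int h' - int h" by (simp add: algebra_simps)
      then have "int h' mod int p = int h mod int p" by (simp only: mod_eq_dvd_iff)
      then have hh: "h = h'" using c(3) c'(3) pp by simp
      define s where "s = nat ((i - j) mod int p)"
      have "s < p" using c(2) by (simp add: s_def nat_less_iff)
      moreover have "?c' t = ?c (t + int s)" for t
      proof -
        have "?c (t + (i - j)) = ?c (t + int s)"
          by (rule periodic_cong[OF periodic_wrap]) (use c(2) in \<open>simp add: s_def mod_simps\<close>)
        then show ?thesis by (simp only: rot)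
      qed
      ultimately have "?C = pr n (\<lambda>f. rot_attr n f p h c)" using pp hh by auto
      moreover have "?P \<le> pr n (\<lambda>f. rot_attr n f p h c)" by (rule pr_mono) auto
      ultimately show ?thesis using pos pos' unfolding distrib_left by linarith
    qed
  qed
qed

section \<open>Moments of the number of columns that attract a rotation of themselves\<close>

definition turn :: "nat \<Rightarrow> (int \<Rightarrow> nat) \<Rightarrow> nat \<Rightarrow> int \<Rightarrow> nat" where
  "turn p c r = restrict (\<lambda>i. wrap p c (i + int r)) {0..<int p}"

lemma rot_attr_turn:
  assumes "f \<in> rules n" "c \<in> arr p {..<n}" "p > 0" "rot_attr n f p h c"
  shows "turn p c r \<in> arr p {..<n}" "rot_attr n f p h (turn p c r)" "inj_on (turn p c) {..<p}"
proof -
  have w: "wrap p (turn p c r) i = wrap p c (i + int r)" for i r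
  proof -
    have "wrap p (turn p c r) i = wrap p c (i mod int p + int r)" using assms(3) by (simp add: turn_def wrap_def)
    then show ?thesis by (simp add: wrap_def mod_simps)
  qed
  show "turn p c r \<in> arr p {..<n}"
  proof -
    have "inj_on (turn p c r) {0..<int p}"
    proof (rule inj_onI)
      fix i j assume ij: "i \<in> {0..<int p}" "j \<in> {0..<int p}" "turn p c r i = turn p c r j"
      then have "(i + int r) mod int p = (j + int r) mod int p"
        using wrap_inj[OF assms(2,3)] by (simp add: turn_def)
      then have "i mod int p = j mod int p" by (metis add_diff_cancel_right' mod_diff_left_eq)
      then show "i = j" using ij by simp
    qed
    then show ?thesis using wrap_in[OF assms(2,3)] by (auto simp: arr_def turn_def)
  qed
  show "rot_attr n f p h (turn p c r)"
  proof -
    have "attracts n f (\<lambda>i. wrap p c (i + int r)) (\<lambda>i. (\<lambda>i. wrap p c (i + int h)) (i + int r))"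
      using assms wrap_in[OF assms(2,3)] periodic_wrap periodic_shift[OF periodic_wrap]
      unfolding rot_attr_def by (intro attracts_shift[where p = "int p"]) auto
    then show ?thesis unfolding rot_attr_def w by (simp add: add.commute add.left_commute)
  qed
  show "inj_on (turn p c) {..<p}"
  proof (rule inj_onI)
    fix r s assume rs: "r \<in> {..<p}" "s \<in> {..<p}" "turn p c r = turn p c s"
    then have "wrap p c (int r) = wrap p c (int s)" using w[of r 0] w[of s 0] by simp
    then show "r = s" using rs wrap_inj[OF assms(2,3)] by simp
  qed
qed

definition rot_index :: "(nat \<times> nat) set \<Rightarrow> bool" where
  "rot_index K \<longleftrightarrow> finite K \<and> (\<forall>(p, h)\<in>K. h < p)"

text \<open>The factor \<open>1 / p\<close> compensates the \<open>p\<close> temporal shifts of a column.\<close>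

definition rot_count :: "(nat \<times> nat) set \<Rightarrow> nat \<Rightarrow> ca_rule \<Rightarrow> real" where
  "rot_count K n f = (\<Sum>(p, h)\<in>K. (1 / real p) * (\<Sum>c\<in>arr p {..<n}. of_bool (rot_attr n f p h c)))"

definition has_rot :: "(nat \<times> nat) set \<Rightarrow> nat \<Rightarrow> ca_rule \<Rightarrow> bool" where
  "has_rot K n f \<longleftrightarrow> (\<exists>(p, h)\<in>K. \<exists>c\<in>arr p {..<n}. rot_attr n f p h c)"

text \<open>The \<open>p\<close> rotations of a column found are distinct and also counted, each
  with weight \<open>1 / p\<close>, so the count is at least 1.\<close>

lemma has_rot_le:
  assumes "rot_index K" "f \<in> rules n"
  shows "of_bool (has_rot K n f) \<le> rot_count K n f"
proof (cases "has_rot K n f")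
  case True
  then obtain p h c where *: "(p, h) \<in> K" "c \<in> arr p {..<n}" "rot_attr n f p h c"
    unfolding has_rot_def by blast
  have p: "p > 0" using assms(1) *(1) by (auto simp: rot_index_def)
  note d = rot_attr_turn[OF assms(2) *(2) p *(3)]
  have fin: "finite (arr p {..<n})" by (simp add: finite_arr)
  have "p = card (turn p c ` {..<p})" using d(3) by (simp add: card_image)
  also have "\<dots> \<le> card {c\<in>arr p {..<n}. rot_attr n f p h c}"
    using d(1,2) fin by (intro card_mono) auto
  finally have "1 \<le> (1 / real p) * (\<Sum>c\<in>arr p {..<n}. of_bool (rot_attr n f p h c))"
    unfolding sum_of_bool[OF fin] using p by simp
  also have "\<dots> \<le> rot_count K n f"
  proof -
    have "(\<lambda>(p, h). (1 / real p) * (\<Sum>c\<in>arr p {..<n}. of_bool (rot_attr n f p h c))) (p, h) \<le> rot_count K n f"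
      unfolding rot_count_def using assms(1)
      by (intro member_le_sum *(1)) (auto simp: rot_index_def sum_nonneg)
    then show ?thesis by simp
  qed
  finally show ?thesis using True by simp
qed (simp add: rot_count_def sum_nonneg split: prod.splits)

text \<open>From \<open>2 * x - x * x \<le> 1\<close> for all real \<open>x\<close>, and the count
  vanishing when there is no such column. Combined with the second moment this gives the lower
  bound.\<close>

lemma has_rot_ge: "2 * rot_count K n f - rot_count K n f * rot_count K n f \<le> of_bool (has_rot K n f)"
proof (cases "has_rot K n f")
  case True
  have "0 \<le> (1 - rot_count K n f)\<^sup>2" by simp
  then show ?thesis using True by (simp add: power2_eq_square algebra_simps)
next
  case False
  then have "rot_count K n f = 0"
    unfolding rot_count_def has_rot_def by (intro sum.neutral) auto
  then show ?thesis by simp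
qed

lemma avg_rot_count:
  assumes "rot_index K"
  shows "avg n (rot_count K n)
    = (\<Sum>(p, h)\<in>K. (1 / real p) * (\<Sum>c\<in>arr p {..<n}. pr n (\<lambda>f. rot_attr n f p h c)))"
  unfolding rot_count_def case_prod_unfold by (simp only: avg_sum avg_cmult)

lemma card_arr_ratio: "(\<lambda>n. real (card (arr p {..<n})) * (1 / real n) ^ p) \<longlonglongrightarrow> 1"
proof (rule tendsto_sandwich)
  have "(\<lambda>n. (1 - real p / real n) ^ p) \<longlonglongrightarrow> (1 - 0) ^ p"
    by (intro tendsto_intros lim_const_over_n)
  then show "(\<lambda>n. (1 - real p / real n) ^ p) \<longlonglongrightarrow> 1" by simp
  show "\<forall>\<^sub>F n in sequentially. (1 - real p / real n) ^ p \<le> real (card (arr p {..<n})) * (1 / real n) ^ p"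
    using eventually_ge_at_top[of p] eventually_gt_at_top[of 0]
  proof eventually_elim
    case (elim n)
    have "(1 - real p / real n) ^ p = real (n - p) ^ p * (1 / real n) ^ p"
      using elim by (simp add: power_mult_distrib[symmetric] of_nat_diff field_simps)
    also have "\<dots> \<le> real (card (arr p {..<n})) * (1 / real n) ^ p"
      using card_arr_ge[of "{..<n}" p] elim
      by (intro mult_right_mono) (simp_all add: of_nat_power[symmetric] del: of_nat_power of_nat_diff)
    finally show ?case .
  qed
  show "\<forall>\<^sub>F n in sequentially. real (card (arr p {..<n})) * (1 / real n) ^ p \<le> 1"
    using eventually_gt_at_top[of 0]
  proof eventually_elim
    case (elim n)
    have "real (card (arr p {..<n})) \<le> real n ^ p"
      using card_arr_le[of "{..<n}" p] by (simp add: of_nat_power[symmetric] del: of_nat_power)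
    then show ?case using elim by (simp add: power_one_over)
  qed
qed simp

lemma survival_lim: "(\<lambda>n. real n * (1 - (1 - 1 / real n) ^ p)) \<longlonglongrightarrow> real p"
proof -
  have "(\<lambda>n. \<Sum>i<p. (1 - 1 / real n) ^ i) \<longlonglongrightarrow> (\<Sum>i<p. (1 - 0) ^ i)"
    by (intro tendsto_intros lim_const_over_n)
  moreover have "\<forall>\<^sub>F n in sequentially. (\<Sum>i<p. (1 - 1 / real n) ^ i) = real n * (1 - (1 - 1 / real n) ^ p)"
    using eventually_gt_at_top[of 0]
  proof eventually_elim
    case (elim n)
    then show ?case using one_diff_power_eq[of "1 - 1 / real n" p] by simp
  qed
  ultimately show ?thesis by (simp add: tendsto_cong)
qed

text \<open>There are about \<open>n ^ p\<close> words, each with probability about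
  \<open>p / n ^ (p + 1)\<close>, and the weight \<open>1 / p\<close> cancels the factor
  \<open>p\<close>.\<close>

lemma avg_rot_count_lim:
  assumes "rot_index K"
  shows "(\<lambda>n. real n * avg n (rot_count K n)) \<longlonglongrightarrow> real (card K)"
proof -
  have K: "p > 0" if "(p, h) \<in> K" for p h using that assms by (auto simp: rot_index_def)
  have "real n * avg n (rot_count K n) = (\<Sum>(p, h)\<in>K. (1 / real p) *
      ((real (card (arr p {..<n})) * (1 / real n) ^ p) * (real n * (1 - (1 - 1 / real n) ^ p))))" for n
    unfolding avg_rot_count[OF assms] sum_distrib_left
    using K by (intro sum.cong refl) (auto simp: pr_rot_attr)
  moreover have "(\<lambda>n. \<Sum>(p, h)\<in>K. (1 / real p) *
      ((real (card (arr p {..<n})) * (1 / real n) ^ p) * (real n * (1 - (1 - 1 / real n) ^ p))))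
      \<longlonglongrightarrow> (\<Sum>(p, h)\<in>K. (1 / real p) * (1 * real p))"
    unfolding case_prod_unfold
    by (intro tendsto_sum tendsto_mult tendsto_const card_arr_ratio survival_lim)
  moreover have "(\<Sum>(p, h)\<in>K. (1 / real p) * (1 * real p)) = real (card K)"
  proof -
    have "(\<Sum>(p, h)\<in>K. (1 / real p) * (1 * real p)) = (\<Sum>a\<in>K. 1)"
      using K by (intro sum.cong) auto
    then show ?thesis by simp
  qed
  ultimately show ?thesis by simp
qed

text \<open>Only pairs of rotations of one column with the same slope survive up to o(1/n). A column
  has \<open>p\<close> of them, each pair weighted \<open>1 / p\<^sup>2\<close>, so together they
  reproduce the mean.\<close>

lemma avg_rot_count_sq:
  assumes K: "rot_index K" and "\<epsilon> > 0"
  shows "\<forall>\<^sub>F n in sequentially. avg n (\<lambda>f. rot_count K n f * rot_count K n f)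
    \<le> avg n (rot_count K n) + \<epsilon> / real n"
proof -
  have fin: "finite K" and Kh: "\<And>a. a \<in> K \<Longrightarrow> snd a < fst a"
    using K by (auto simp: rot_index_def)
  \<comment> \<open>Two columns together have at most \<open>2 * P\<close> states, the size bound
    passed to \<open>pr_no_fresh\<close>. The inserted 1 gives \<open>Max\<close> a value if
    \<open>K\<close> is empty.\<close>
  define P where "P = Max (insert 1 (fst ` K))"
  have P: "fst a \<le> P" if "a \<in> K" for a using that fin by (simp add: P_def)
  define W where "W = weight_bound (2 * P)"
  define D where "D = (real (card K))\<^sup>2 * W"
  have W0: "W \<ge> 0" by (simp add: W_def weight_bound_def)
  then have D0: "D \<ge> 0" by (simp add: D_def)
  define \<epsilon>' where "\<epsilon>' = \<epsilon> / (2 * (D + 1))"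
  have \<epsilon>': "\<epsilon>' > 0" "D * \<epsilon>' \<le> \<epsilon> / 2"
    using D0 assms(2) by (auto simp: \<epsilon>'_def field_simps)
  have "\<forall>\<^sub>F n in sequentially. \<forall>a\<in>K. \<forall>c V. (\<forall>i. c i < n) \<and> periodic (int (fst a)) c \<and> primitive (fst a) c
      \<and> V \<subseteq> {..<n} \<and> card V \<le> 2 * P \<longrightarrow> pr n (\<lambda>f. no_fresh n f c (fst a) V) \<le> \<epsilon>'"
    using fin \<epsilon>'(1) Kh by (intro eventually_ball_finite ballI pr_no_fresh) (auto intro: le_less_trans)
  moreover have "\<forall>\<^sub>F n in sequentially. D * (real P)\<^sup>2 / real n < \<epsilon> / 2"
    using lim_const_over_n[of "D * (real P)\<^sup>2"] assms(2) by (intro order_tendstoD) auto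
  ultimately show ?thesis using eventually_gt_at_top[of 0]
  proof eventually_elim
    case (elim n)
    define S where "S = (\<lambda>a b. \<Sum>c\<in>arr (fst a) {..<n}. \<Sum>c'\<in>arr (fst b) {..<n}.
        pr n (\<lambda>f. rot_attr n f (fst a) (snd a) c \<and> rot_attr n f (fst b) (snd b) c'))"
    define E where "E = (\<lambda>a. \<Sum>c\<in>arr (fst a) {..<n}. pr n (\<lambda>f. rot_attr n f (fst a) (snd a) c))"
    define err where "err = \<epsilon>' / real n + (real P)\<^sup>2 / (real n)\<^sup>2"
    have err0: "err \<ge> 0" using \<epsilon>'(1) by (simp add: err_def)
    have S: "S a b \<le> W * err + of_bool (a = b) * real (fst a) * E a" if ab: "a \<in> K" "b \<in> K" for a b
    proof -
      obtain p h p' h' where [simp]: "a = (p, h)" "b = (p', h')" by (cases a, cases b) auto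
      have p: "p > 0" "h < p" "p' > 0" "h' < p'" "p \<le> P" "p' \<le> P"
        using Kh[OF ab(1)] Kh[OF ab(2)] P[OF ab(1)] P[OF ab(2)] by auto
      let ?same = "\<lambda>c c'. p = p' \<and> h = h' \<and> (\<exists>r<p. \<forall>i. wrap p' c' i = wrap p c (i + int r))"
      have "S a b \<le> (\<Sum>c\<in>arr p {..<n}. \<Sum>c'\<in>arr p' {..<n}.
          (1 / real n) ^ card (c ` {0..<int p} \<union> c' ` {0..<int p'}) * err
          + of_bool (?same c c') * pr n (\<lambda>f. rot_attr n f p h c))"
        unfolding S_def fst_conv snd_conv \<open>a = (p, h)\<close> \<open>b = (p', h')\<close>
      proof (intro sum_mono)
        fix c c' assume c: "c \<in> arr p {..<n}" "c' \<in> arr p' {..<n}"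
        let ?V = "c ` {0..<int p} \<union> c' ` {0..<int p'}"
        have "card ?V \<le> card (c ` {0..<int p}) + card (c' ` {0..<int p'})" by (rule card_Un_le)
        also have "\<dots> \<le> 2 * P"
          using c p by (simp add: arr_def card_image)
        finally have "card ?V \<le> 2 * P" .
        moreover have "?V \<subseteq> {..<n}" using c by (auto simp: arr_def PiE_iff)
        moreover have "\<forall>i. wrap p c i < n" using wrap_in[OF c(1) p(1)] by auto
        ultimately have "pr n (\<lambda>f. no_fresh n f (wrap p c) p ?V) \<le> \<epsilon>'"
          using elim(1) ab(1) periodic_wrap[of p c] wrap_primitive[OF c(1) p(1)]
          by (metis \<open>a = (p, h)\<close> fst_conv)
        then have "pr n (\<lambda>f. rot_attr n f p h c \<and> rot_attr n f p' h' c')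
            \<le> (1 / real n) ^ card ?V * (\<epsilon>' / real n + real p * real p' / (real n)\<^sup>2)
              + of_bool (?same c c') * pr n (\<lambda>f. rot_attr n f p h c)"
          using c p \<epsilon>'(1) by (intro pr_rot_attr_pair) auto
        also have "\<dots> \<le> (1 / real n) ^ card ?V * err + of_bool (?same c c') * pr n (\<lambda>f. rot_attr n f p h c)"
        proof -
          have "real p * real p' \<le> (real P)\<^sup>2" using p by (auto simp: power2_eq_square intro!: mult_mono)
          then have "\<epsilon>' / real n + real p * real p' / (real n)\<^sup>2 \<le> err"
            unfolding err_def by (intro add_left_mono divide_right_mono) auto
          then show ?thesis by (intro add_right_mono mult_left_mono) auto
        qed
        finally show "pr n (\<lambda>f. rot_attr n f p h c \<and> rot_attr n f p' h' c')
          \<le> (1 / real n) ^ card ?V * err + of_bool (?same c c') * pr n (\<lambda>f. rot_attr n f p h c)" .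
      qed
      also have "\<dots> = (\<Sum>c\<in>arr p {..<n}. \<Sum>c'\<in>arr p' {..<n}. (1 / real n) ^ card (c ` {0..<int p} \<union> c' ` {0..<int p'})) * err
          + (\<Sum>c\<in>arr p {..<n}. (\<Sum>c'\<in>arr p' {..<n}. of_bool (?same c c')) * pr n (\<lambda>f. rot_attr n f p h c))"
        by (simp only: sum.distrib sum_distrib_right)
      also have "\<dots> \<le> W * err + (\<Sum>c\<in>arr p {..<n}. (of_bool (a = b) * real p) * pr n (\<lambda>f. rot_attr n f p h c))"
      proof (intro add_mono mult_right_mono sum_mono err0 pr_nonneg)
        have "weight_bound (p + p') \<le> W" unfolding W_def using p by (intro weight_bound_mono) simp
        then show "(\<Sum>c\<in>arr p {..<n}. \<Sum>c'\<in>arr p' {..<n}. (1 / real n) ^ card (c ` {0..<int p} \<union> c' ` {0..<int p'})) \<le> W"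
          using sum_pair_weight[of n p p' "{..<n}" "{..<n}"] elim(3) p by simp
      next
        fix c
        show "(\<Sum>c'\<in>arr p' {..<n}. of_bool (?same c c')) \<le> of_bool (a = b) * real p"
        proof (cases "a = b")
          case True
          have "card {c'\<in>arr p {..<n}. \<exists>r\<in>{..<p}. \<forall>i. wrap p c' i = wrap p c (i + int r)} \<le> card {..<p}"
            using p by (intro card_rotations_le[where g = int]) auto
          then show ?thesis
            using True unfolding sum_of_bool[OF finite_arr[OF finite_lessThan]] by (simp add: Bex_def)
        qed auto
      qed
      finally show ?thesis by (simp add: E_def sum_distrib_left)
    qed
    have E0: "E a \<ge> 0" for a by (simp add: E_def sum_nonneg)
    have "avg n (\<lambda>f. rot_count K n f * rot_count K n f)
      = avg n (\<lambda>f. \<Sum>a\<in>K. \<Sum>b\<in>K. (1 / real (fst a)) * (1 / real (fst b)) *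
        (\<Sum>c\<in>arr (fst a) {..<n}. \<Sum>c'\<in>arr (fst b) {..<n}.
          of_bool (rot_attr n f (fst a) (snd a) c \<and> rot_attr n f (fst b) (snd b) c')))"
      unfolding rot_count_def case_prod_unfold of_bool_conj sum_product
      by (intro avg_cong sum.cong refl) (simp add: sum_product mult_ac)
    also have "\<dots> = (\<Sum>a\<in>K. \<Sum>b\<in>K. (1 / real (fst a)) * (1 / real (fst b)) * S a b)"
      unfolding S_def by (simp only: avg_sum avg_cmult)
    also have "\<dots> \<le> (\<Sum>a\<in>K. \<Sum>b\<in>K. W * err + of_bool (a = b) * ((1 / real (fst a)) * E a))"
    proof (intro sum_mono)
      fix a b assume ab: "a \<in> K" "b \<in> K"
      have p: "fst a > 0" "fst b > 0" using Kh[OF ab(1)] Kh[OF ab(2)] by auto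
      have "(1 / real (fst a)) * (1 / real (fst b)) * S a b
        \<le> (1 / real (fst a)) * (1 / real (fst b)) * (W * err + of_bool (a = b) * real (fst a) * E a)"
        using S[OF ab] by (intro mult_left_mono) auto
      also have "\<dots> = (1 / real (fst a)) * (1 / real (fst b)) * (W * err) + of_bool (a = b) * ((1 / real (fst a)) * E a)"
        using p by (auto simp: distrib_left)
      also have "\<dots> \<le> 1 * (W * err) + of_bool (a = b) * ((1 / real (fst a)) * E a)"
      proof (intro add_right_mono mult_right_mono)
        have "real (fst a) * real (fst b) \<ge> 1" using p
          by (metis One_nat_def Suc_leI mult_eq_1_iff mult_pos_pos of_nat_1 of_nat_le_iff of_nat_mult)
        then show "1 / real (fst a) * (1 / real (fst b)) \<le> 1" by simp
      qed (use W0 err0 in simp)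
      finally show "(1 / real (fst a)) * (1 / real (fst b)) * S a b
        \<le> W * err + of_bool (a = b) * ((1 / real (fst a)) * E a)" by simp
    qed
    also have "\<dots> = (real (card K))\<^sup>2 * (W * err) + (\<Sum>a\<in>K. (1 / real (fst a)) * E a)"
    proof -
      have "(\<Sum>b\<in>K. of_bool (a = b) * ((1 / real (fst a)) * E a)) = (1 / real (fst a)) * E a" if "a \<in> K" for a
      proof -
        have "(\<Sum>b\<in>K. of_bool (a = b) * X) = X" for X :: real
        proof -
          have "(\<Sum>b\<in>K. of_bool (a = b) * X) = (\<Sum>b\<in>K. if a = b then X else 0)"
            by (intro sum.cong) auto
          then show ?thesis using that fin by simp
        qed
        then show ?thesis .
      qed
      then show ?thesis by (simp add: sum.distrib power2_eq_square)
    qed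
    also have "(\<Sum>a\<in>K. (1 / real (fst a)) * E a) = avg n (rot_count K n)"
      unfolding avg_rot_count[OF K] E_def case_prod_unfold ..
    also have "(real (card K))\<^sup>2 * (W * err) = D * \<epsilon>' / real n + (D * (real P)\<^sup>2 / real n) / real n"
      by (simp add: D_def err_def distrib_left power2_eq_square)
    also have "\<dots> \<le> (\<epsilon> / 2) / real n + (\<epsilon> / 2) / real n"
      using elim \<epsilon>'(2) by (intro add_mono divide_right_mono) auto
    also have "\<dots> = \<epsilon> / real n" by (simp add: field_simps)
    finally show ?case by (simp add: add.commute)
  qed
qed

text \<open>The probability lies between \<open>2 * E X - E X\<^sup>2\<close> and
  \<open>E X\<close>, where \<open>X\<close> is the count and \<open>E\<close> its average; the
  second moment bound makes this gap o(1/n).\<close>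

lemma pr_has_rot_lim:
  assumes "rot_index K"
  shows "(\<lambda>n. real n * pr n (has_rot K n)) \<longlonglongrightarrow> real (card K)"
proof -
  have upper: "pr n (has_rot K n) \<le> avg n (rot_count K n)" for n
    using has_rot_le[OF assms] by (intro avg_mono) auto
  have lower: "2 * avg n (rot_count K n) - avg n (\<lambda>f. rot_count K n f * rot_count K n f) \<le> pr n (has_rot K n)" for n
    unfolding avg_cmult[symmetric] avg_diff[symmetric] by (intro avg_mono has_rot_ge)
  have "(\<lambda>n. real n * avg n (rot_count K n) - real n * pr n (has_rot K n)) \<longlonglongrightarrow> 0"
  proof (rule LIMSEQ_I)
    fix \<epsilon> :: real assume "\<epsilon> > 0"
    then have "\<forall>\<^sub>F n in sequentially. avg n (\<lambda>f. rot_count K n f * rot_count K n f)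
        \<le> avg n (rot_count K n) + (\<epsilon> / 2) / real n"
      by (intro avg_rot_count_sq[OF assms]) simp
    then have "\<forall>\<^sub>F n in sequentially. norm (real n * avg n (rot_count K n) - real n * pr n (has_rot K n) - 0) < \<epsilon>"
      using eventually_gt_at_top[of 0]
    proof eventually_elim
      case (elim n)
      have 1: "avg n (rot_count K n) - pr n (has_rot K n) \<le> (\<epsilon> / 2) / real n" using elim lower[of n] by linarith
      have 2: "0 \<le> avg n (rot_count K n) - pr n (has_rot K n)" using upper[of n] by linarith
      have "real n * (avg n (rot_count K n) - pr n (has_rot K n)) \<le> real n * ((\<epsilon> / 2) / real n)"
        using 1 by (intro mult_left_mono) auto
      also have "\<dots> = \<epsilon> / 2" using elim by simp
      finally show ?case using 2 \<open>\<epsilon> > 0\<close> by (simp add: right_diff_distrib[symmetric] abs_mult)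
    qed
    then show "\<exists>no. \<forall>n\<ge>no. norm (real n * avg n (rot_count K n) - real n * pr n (has_rot K n) - 0) < \<epsilon>"
      by (simp add: eventually_sequentially)
  qed
  from tendsto_diff[OF avg_rot_count_lim[OF assms] this] show ?thesis by simp
qed

section \<open>Tiles of periodic solutions\<close>

text \<open>Here \<open>v\<close> is indexed by time and space in this order, whereas \<open>tile \<tau> \<sigma> v x\<close> is the column at \<open>x\<close>.\<close>

definition tile :: "nat \<Rightarrow> nat \<Rightarrow> (int \<times> int \<Rightarrow> nat) \<Rightarrow> int \<Rightarrow> int \<Rightarrow> nat" where
  "tile \<tau> \<sigma> v x t = v (t mod int \<tau>, x mod int \<sigma>)"

definition cells :: "nat \<Rightarrow> nat \<Rightarrow> (int \<times> int) set" where
  "cells \<tau> \<sigma> = {0..<int \<tau>} \<times> {0..<int \<sigma>}"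

definition attr_tile :: "nat \<Rightarrow> ca_rule \<Rightarrow> nat \<Rightarrow> nat \<Rightarrow> (int \<times> int \<Rightarrow> nat) \<Rightarrow> bool" where
  "attr_tile n f \<tau> \<sigma> v \<longleftrightarrow> (\<forall>x. attracts n f (tile \<tau> \<sigma> v x) (tile \<tau> \<sigma> v (x + 1)))"

lemma tile_periodic: "periodic (int \<tau>) (tile \<tau> \<sigma> v x)"
  by (simp add: periodic_def tile_def)

lemma tile_space_periodic: "periodic (int \<sigma>) (\<lambda>x. tile \<tau> \<sigma> v x t)"
  by (simp add: periodic_def tile_def)

lemma tile_in:
  assumes "v \<in> cells \<tau> \<sigma> \<rightarrow>\<^sub>E Y" "\<tau> > 0" "\<sigma> > 0"
  shows "tile \<tau> \<sigma> v x t \<in> v ` cells \<tau> \<sigma>" "tile \<tau> \<sigma> v x t \<in> Y"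
proof -
  have "(t mod int \<tau>, x mod int \<sigma>) \<in> cells \<tau> \<sigma>" using assms by (simp add: cells_def)
  then show "tile \<tau> \<sigma> v x t \<in> v ` cells \<tau> \<sigma>" "tile \<tau> \<sigma> v x t \<in> Y"
    using assms(1) unfolding tile_def by (auto simp: PiE_iff)
qed

text \<open>As \<open>c\<close> has period \<open>q\<close>, the shift of \<open>d\<close> by
  \<open>q\<close> is also an orbit driven by \<open>c\<close>. It is attracted to \<open>d\<close>,
  so the two agree from some time on, and by the common period \<tau> always.\<close>

lemma attracts_periodic:
  assumes att: "attracts n f c d" and c: "periodic q c" "periodic (int \<tau>) c" "\<tau> > 0"
    and d: "periodic (int \<tau>) d" "\<And>i. d i < n"
  shows "periodic q d"
proof -
  have rec: "f (c i, d i) = d (i + 1)" for i using att by (simp add: attracts_def)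
  have rec': "f (c i, d (i + q)) = d (i + 1 + q)" for i
  proof -
    have "i + q + 1 = i + 1 + q" by simp
    then show ?thesis using rec[of "i + q"] periodicD[OF c(1), of i] by (simp only:)
  qed
  have orb: "orb f c (d q) s = d (int s + q)" for s
    by (rule orb_attracted[where d = "\<lambda>i. d (i + q)" and s = 0]) (use rec' in simp_all)
  obtain s where s: "orb f c (d q) s = d (int s)" using att[unfolded attracts_def] d(2)[of q] by blast
  have late: "d (int t + q) = d (int t)" if "s \<le> t" for t
    using orb_attracted[of f c d, OF rec s that] orb by simp
  show ?thesis
    unfolding periodic_def
  proof
    fix i
    define t where "t = nat (i mod int \<tau>) + s * \<tau>"
    have "s \<le> t" using c(3) by (simp add: t_def trans_le_add2)
    have t: "int t mod int \<tau> = i mod int \<tau>" using c(3) by (simp add: t_def)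
    then have "(int t + q) mod int \<tau> = (i + q) mod int \<tau>" by (metis mod_add_left_eq)
    then show "d (i + q) = d i"
      using late[OF \<open>s \<le> t\<close>] periodic_cong[OF d(1) t] periodic_cong[OF d(1)] by metis
  qed
qed

text \<open>Primitivity of the first column uses robustness: by attraction a smaller period of this
  column would pass to all columns and thus be a temporal period of the whole solution.\<close>

lemma WRPS_tile:
  assumes f: "f \<in> rules n" and \<xi>: "is_PS n f \<tau> \<sigma> \<xi>" and wr: "weakly_robust n f \<xi>"
  obtains v where "v \<in> cells \<tau> \<sigma> \<rightarrow>\<^sub>E {..<n}" "\<tau> > 0" "\<sigma> > 0" "attr_tile n f \<tau> \<sigma> v"
    "primitive \<tau> (tile \<tau> \<sigma> v 0)" "spatial_period (\<lambda>x. tile \<tau> \<sigma> v x 0) \<sigma>"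
proof -
  have conf: "\<xi> \<in> configs n" and sp: "spatial_period \<xi> \<sigma>" and tp: "temporal_period f \<xi> \<tau>"
    using \<xi> by (auto simp: is_PS_def)
  have \<tau>: "\<tau> > 0" "run f \<xi> \<tau> = \<xi>" and \<sigma>: "\<sigma> > 0" "\<And>x. \<xi> (x + int \<sigma>) = \<xi> x"
    using sp tp by (auto simp: spatial_period_def temporal_period_def)
  define v where "v = restrict (\<lambda>(t, x). run f \<xi> (nat t) x) (cells \<tau> \<sigma>)"
  have v: "v \<in> cells \<tau> \<sigma> \<rightarrow>\<^sub>E {..<n}"
    using run_less[OF f conf] by (auto simp: v_def)
  have per_x: "periodic (int \<sigma>) (run f \<xi> t)" for t
    using run_shift[of \<xi> "int \<sigma>", OF \<sigma>(2)] by (simp add: periodic_def)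
  have tile: "tile \<tau> \<sigma> v x = diag f \<xi> \<tau> x" for x
  proof
    fix t
    have "(t mod int \<tau>, x mod int \<sigma>) \<in> cells \<tau> \<sigma>" using \<tau>(1) \<sigma>(1) by (simp add: cells_def)
    then show "tile \<tau> \<sigma> v x t = diag f \<xi> \<tau> x t"
      using periodic_mod[OF per_x] by (simp add: tile_def v_def diag_def)
  qed
  have att: "attr_tile n f \<tau> \<sigma> v"
    unfolding attr_tile_def tile using weakly_robust_attracts[OF f conf \<tau>(2,1) wr] by blast
  have less: "tile \<tau> \<sigma> v x t < n" for x t using tile_in(2)[OF v \<tau>(1) \<sigma>(1)] by auto
  have "primitive \<tau> (tile \<tau> \<sigma> v 0)"
    unfolding primitive_def
  proof (intro allI impI notI)
    fix q assume q: "0 < q \<and> q < int \<tau>" "periodic q (tile \<tau> \<sigma> v 0)"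
    have "periodic q (tile \<tau> \<sigma> v (int x))" for x
    proof (induction x)
      case 0
      then show ?case using q(2) by simp
    next
      case (Suc x)
      have "periodic q (tile \<tau> \<sigma> v (int x + 1))"
      proof (rule attracts_periodic[OF _ Suc tile_periodic \<tau>(1) tile_periodic less])
        show "attracts n f (tile \<tau> \<sigma> v (int x)) (tile \<tau> \<sigma> v (int x + 1))"
          using att unfolding attr_tile_def by blast
      qed
      then show ?case by (simp add: add.commute)
    qed
    \<comment> \<open>The induction only moves to the right of column 0; spatial periodicity
      represents every column by one of these.\<close>
    from this[of "nat (_ mod int \<sigma>)"] have "periodic q (tile \<tau> \<sigma> v (x mod int \<sigma>))" for x
      using \<sigma>(1) by simp
    moreover have "tile \<tau> \<sigma> v (x mod int \<sigma>) = tile \<tau> \<sigma> v x" for x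
      by (rule ext) (simp add: tile_def)
    ultimately have all: "periodic q (diag f \<xi> \<tau> x)" for x by (simp only: tile)
    have "run f \<xi> (nat q) = \<xi>"
    proof
      fix x
      have "run f \<xi> (nat q) x = diag f \<xi> \<tau> x (0 + q)"
        using diag_int[OF \<tau>(2), of x "nat q"] q(1) by simp
      also have "\<dots> = diag f \<xi> \<tau> x 0" using all[of x] by (simp only: periodicD)
      finally show "run f \<xi> (nat q) x = \<xi> x" by (simp add: diag_def)
    qed
    moreover have "0 < nat q" "nat q < \<tau>" using q(1) by auto
    ultimately show False using tp by (auto simp: temporal_period_def)
  qed
  moreover have "(\<lambda>x. tile \<tau> \<sigma> v x 0) = \<xi>"
    unfolding tile by (simp add: diag_def)
  ultimately show thesis using that[OF v \<tau>(1) \<sigma>(1) att] sp by simp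
qed

lemma spatial_period_cong:
  assumes "\<And>x s. \<xi> (x + int s) = \<xi> x \<longleftrightarrow> \<zeta> (x + int s) = \<zeta> x"
  shows "spatial_period \<xi> \<sigma> = spatial_period \<zeta> \<sigma>"
  unfolding spatial_period_def assms ..

text \<open>The minimal period of \<open>h * x\<close> modulo \<tau> is \<tau> / gcd(h, \<tau>). A
  divisor \<sigma> of \<tau> therefore belongs to exactly \<phi>(\<sigma>) slopes
  \<open>h < \<tau>\<close>, where \<phi> is Euler's function, and other \<sigma> to none.\<close>

definition slope_period :: "nat \<Rightarrow> nat \<Rightarrow> nat \<Rightarrow> bool" where
  "slope_period \<tau> h \<sigma> \<longleftrightarrow> spatial_period (\<lambda>x. nat ((int h * x) mod int \<tau>)) \<sigma>"

lemma slope_period_iff: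
  assumes "c \<in> arr \<tau> Y" "\<tau> > 0"
  shows "slope_period \<tau> h \<sigma> \<longleftrightarrow> spatial_period (\<lambda>x. wrap \<tau> c (int h * x)) \<sigma>"
  unfolding slope_period_def
proof (rule spatial_period_cong)
  fix x s
  show "(nat ((int h * (x + int s)) mod int \<tau>) = nat ((int h * x) mod int \<tau>)) =
      (wrap \<tau> c (int h * (x + int s)) = wrap \<tau> c (int h * x))"
    unfolding wrap_inj[OF assms] using assms(2) by (simp add: nat_eq_iff)
qed

text \<open>A tile with more queries than values already costs a factor \<open>1 / n\<close>, and the absence of fresh
  cycles for its first column contributes the factor \<open>\<epsilon>\<close>. Otherwise equality of two states propagates
  over the whole tile. If the first two columns share a state, they are rotations of each other and
  \<open>has_rot\<close> holds; if not, both have to attract their successors, independently of each other.\<close>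

lemma pr_attr_tile:
  assumes v: "v \<in> cells \<tau> \<sigma> \<rightarrow>\<^sub>E {..<n}" and \<tau>: "\<tau> > 0" and \<sigma>: "\<sigma> > 0"
    and prim: "primitive \<tau> (tile \<tau> \<sigma> v 0)" and sp: "spatial_period (\<lambda>x. tile \<tau> \<sigma> v x 0) \<sigma>"
    and K: "\<And>h. h < \<tau> \<Longrightarrow> slope_period \<tau> h \<sigma> \<Longrightarrow> (\<tau>, h) \<in> K"
    and "0 \<le> \<epsilon>" and nf: "pr n (\<lambda>f. no_fresh n f (tile \<tau> \<sigma> v 0) \<tau> (v ` cells \<tau> \<sigma>)) \<le> \<epsilon>"
  shows "pr n (\<lambda>f. attr_tile n f \<tau> \<sigma> v \<and> \<not> has_rot K n f)
    \<le> (1 / real n) ^ card (v ` cells \<tau> \<sigma>) * (\<epsilon> / real n + (real \<tau>)\<^sup>2 / (real n)\<^sup>2)"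
    (is "?P \<le> ?A * (?e + ?d)")
proof -
  let ?V = "v ` cells \<tau> \<sigma>" and ?u = "tile \<tau> \<sigma> v"
  have less: "?u x t < n" and inV: "?u x t \<in> ?V" for x t
    using tile_in[OF v \<tau> \<sigma>, of x t] by auto
  have n: "n > 0" using less[of 0 0] by simp
  define J where "J = cells \<tau> \<sigma>"
  define q where "q = (\<lambda>(t, x). (?u x t, ?u (x + 1) t))"
  define r where "r = (\<lambda>(t, x). ?u (x + 1) (t + 1))"
  have finJ: "finite J" by (simp add: J_def cells_def)
  have ev: "f (q j) = r j" if "attr_tile n f \<tau> \<sigma> v" for f j
    using that unfolding attr_tile_def attracts_def by (cases j) (simp add: q_def r_def)
  have q_in: "q j \<in> {..<n} \<times> {..<n}" "r j < n" "snd (q j) \<in> ?V" for j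
    using less inV by (cases j; simp add: q_def r_def)+
  have rJ: "r ` J = ?V"
  proof
    show "r ` J \<subseteq> ?V" using inV by (auto simp: r_def)
    show "?V \<subseteq> r ` J"
    proof
      fix y assume "y \<in> ?V"
      then obtain t x where tx: "(t, x) \<in> cells \<tau> \<sigma>" "y = v (t, x)" by auto
      let ?j = "((t - 1) mod int \<tau>, (x - 1) mod int \<sigma>)"
      have "?j \<in> J" using \<tau> \<sigma> by (simp add: J_def cells_def)
      moreover have "r ?j = y" using tx by (simp add: r_def tile_def mod_simps cells_def)
      ultimately show "y \<in> r ` J" by blast
    qed
  qed
  have pos: "0 \<le> ?A" "0 \<le> ?e" "0 \<le> ?d" using \<open>0 \<le> \<epsilon>\<close> by auto
  have pos': "0 \<le> ?A * ?e" "0 \<le> ?A * ?d" using pos by (simp_all only: mult_nonneg_nonneg)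
  consider "card (q ` J) > card (r ` J)" | "?P = 0"
    | f where "card (q ` J) \<le> card (r ` J)" "attr_tile n f \<tau> \<sigma> v" "\<not> has_rot K n f"
  proof (cases "\<exists>f. attr_tile n f \<tau> \<sigma> v \<and> \<not> has_rot K n f")
    case True
    then obtain f where f: "attr_tile n f \<tau> \<sigma> v" "\<not> has_rot K n f" by blast
    show ?thesis
    proof (cases "card (q ` J) > card (r ` J)")
      case True
      then show ?thesis by (rule that(1))
    next
      case False
      then have "card (q ` J) \<le> card (r ` J)" by simp
      then show ?thesis using f by (rule that(3))
    qed
  next
    case False
    then have "?P = 0" by (intro pr_eq_0) blast
    then show ?thesis by (rule that(2))
  qed
  then show ?thesis
  proof cases
    case 1
    have "?P \<le> pr n (\<lambda>f. no_fresh n f (?u 0) \<tau> ?V \<and> (\<forall>j\<in>J. f (q j) = r j))"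
    proof (rule pr_mono)
      fix f assume f: "attr_tile n f \<tau> \<sigma> v \<and> \<not> has_rot K n f"
      then have "attracts n f (?u 0) (?u (0 + 1))" unfolding attr_tile_def by blast
      then have "no_fresh n f (?u 0) \<tau> ?V"
        using tile_periodic \<tau> inV by (rule attracts_no_fresh)
      then show "no_fresh n f (?u 0) \<tau> ?V \<and> (\<forall>j\<in>J. f (q j) = r j)" using ev f by blast
    qed
    also have "\<dots> \<le> \<epsilon> * (1 / real n) ^ card (q ` J)"
      using q_in \<tau> nf by (intro pr_pattern_no_fresh) auto
    also have "\<dots> \<le> \<epsilon> * (1 / real n) ^ Suc (card (r ` J))"
      using 1 n \<open>0 \<le> \<epsilon>\<close> by (intro mult_left_mono power_decreasing) auto
    also have "\<dots> = ?A * ?e" by (simp add: rJ)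
    finally show ?thesis using pos pos' unfolding distrib_left by linarith
  next
    case 2
    then show ?thesis using pos pos' unfolding distrib_left by linarith
  next
    case 3
    have bwd: "q j = q j'" if "j \<in> J" "j' \<in> J" "r j = r j'" for j j'
      by (rule pattern_backward[where f = f and r = r and J = J]) (use 3 finJ ev that in auto)
    \<comment> \<open>A state is the value of the query formed by the cells \<open>x - 1\<close> and
      \<open>x\<close> one time step earlier, so without surplus queries it determines both of
      them.\<close>
    have stp: "?u (x - 1) (t - 1) = ?u (x' - 1) (t' - 1)" "?u x (t - 1) = ?u x' (t' - 1)"
      if "?u x t = ?u x' t'" for x t x' t'
    proof -
      let ?j = "\<lambda>x t. ((t - 1) mod int \<tau>, (x - 1) mod int \<sigma>)"
      have "?j x t \<in> J" "?j x' t' \<in> J" using \<tau> \<sigma> by (auto simp: J_def cells_def)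
      moreover have "r (?j x t) = ?u x t" "q (?j x t) = (?u (x - 1) (t - 1), ?u x (t - 1))" for x t
        by (simp_all add: r_def q_def tile_def mod_simps)
      ultimately have "(?u (x - 1) (t - 1), ?u x (t - 1)) = (?u (x' - 1) (t' - 1), ?u x' (t' - 1))"
        using bwd[of "?j x t" "?j x' t'"] that by (simp only:)
      then show "?u (x - 1) (t - 1) = ?u (x' - 1) (t' - 1)" "?u x (t - 1) = ?u x' (t' - 1)" by simp_all
    qed
    have inv_t: "?u x (t + b) = ?u x' (t' + b)" if eq: "?u x t = ?u x' t'" for x t x' t' b
    proof (rule backward_periodic[where N = "int \<tau>" and g = "\<lambda>b. ?u x (t + b) = ?u x' (t' + b)"])
      show "periodic (int \<tau>) (\<lambda>b. ?u x (t + b) = ?u x' (t' + b))"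
        unfolding periodic_def
        using periodicD[OF tile_periodic] by (simp add: add.assoc[symmetric])
      show "?u x (t + - int s) = ?u x' (t' + - int s)" for s
      proof (induction s)
        case 0
        then show ?case using eq by simp
      next
        case (Suc s)
        have "t + - int (Suc s) = t + - int s - 1" "t' + - int (Suc s) = t' + - int s - 1" by simp_all
        then show ?case using stp(2)[OF Suc] by (simp only:)
      qed
    qed (use \<tau> in simp)
    have inv: "?u (x + a) (t + b) = ?u (x' + a) (t' + b)" if eq: "?u x t = ?u x' t'" for x t x' t' a b
    proof -
      \<comment> \<open>The quantifier over \<open>b\<close> turns the diagonal step of
        \<open>stp\<close> into a purely spatial one, because time can be corrected by
        \<open>inv_t\<close>.\<close>
      have "\<forall>b. ?u (x + a) (t + b) = ?u (x' + a) (t' + b)"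
      proof (rule backward_periodic[where N = "int \<sigma>" and g = "\<lambda>a. \<forall>b. ?u (x + a) (t + b) = ?u (x' + a) (t' + b)"])
        show "periodic (int \<sigma>) (\<lambda>a. \<forall>b. ?u (x + a) (t + b) = ?u (x' + a) (t' + b))"
          unfolding periodic_def
          using periodicD[OF tile_space_periodic] by (simp add: add.assoc[symmetric])
        show "\<forall>b. ?u (x + - int s) (t + b) = ?u (x' + - int s) (t' + b)" for s
        proof (induction s)
          case 0
          then show ?case using inv_t[OF eq] by simp
        next
          case (Suc s)
          show ?case
          proof
            fix b
            have "x + - int (Suc s) = x + - int s - 1" "x' + - int (Suc s) = x' + - int s - 1"
              "t + b = t + (b + 1) - 1" "t' + b = t' + (b + 1) - 1" by simp_all
            then show "?u (x + - int (Suc s)) (t + b) = ?u (x' + - int (Suc s)) (t' + b)"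
              using stp(1)[OF Suc[THEN spec, of "b + 1"]] by (simp only:)
          qed
        qed
      qed (use \<sigma> in simp)
      then show ?thesis by blast
    qed
    have col0: "i mod int \<tau> = j mod int \<tau>" if "\<And>b. ?u 0 (i + b) = ?u 0 (j + b)" for i j
    proof -
      have "periodic (i - j) (?u 0)"
        unfolding periodic_def
      proof
        fix t
        show "?u 0 (t + (i - j)) = ?u 0 t" using that[of "t - j"] by (simp add: algebra_simps)
      qed
      then have "int \<tau> dvd i - j" using primitive_dvd[OF \<tau> tile_periodic prim] by blast
      then show ?thesis by (simp only: mod_eq_dvd_iff)
    qed
    have inj0: "i mod int \<tau> = j mod int \<tau>" if "?u 0 i = ?u 0 j" for i j
      using inv[OF that, of 0] by (intro col0) simp
    have inj1: "i mod int \<tau> = j mod int \<tau>" if "?u 1 i = ?u 1 j" for i j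
      using inv[OF that, of "-1"] by (intro col0) simp
    have shared: False if eq: "?u 0 t = ?u 1 t'" for t t'
    proof -
      define h where "h = nat ((t - t') mod int \<tau>)"
      have h: "h < \<tau>" "int h = (t - t') mod int \<tau>" using \<tau> by (simp_all add: h_def nat_less_iff)
      have next_col: "?u (a + 1) s = ?u a (s + int h)" for a s
      proof -
        have "?u (0 + a) (t + (s - t')) = ?u (1 + a) (t' + (s - t'))" by (rule inv[OF eq])
        moreover have "?u a (s + int h) = ?u a (t + (s - t'))"
          by (rule periodic_cong[OF tile_periodic]) (simp add: h(2) mod_simps algebra_simps)
        ultimately show ?thesis by (simp add: add.commute)
      qed
      define c where "c = restrict (?u 0) {0..<int \<tau>}"
      have wc: "wrap \<tau> c = ?u 0"
        using \<tau> by (auto simp: wrap_def c_def fun_eq_iff tile_def)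
      have c: "c \<in> arr \<tau> {..<n}"
      proof -
        have "inj_on c {0..<int \<tau>}"
        proof (rule inj_onI)
          fix i j assume "i \<in> {0..<int \<tau>}" "j \<in> {0..<int \<tau>}" "c i = c j"
          then show "i = j" using inj0[of i j] by (simp add: c_def)
        qed
        then show ?thesis using less by (auto simp: arr_def c_def)
      qed
      have "attracts n f (?u 0) (?u (0 + 1))" using 3(2) unfolding attr_tile_def by blast
      moreover have "?u (0 + 1) = (\<lambda>i. ?u 0 (i + int h))" using next_col by blast
      ultimately have "rot_attr n f \<tau> h c" unfolding rot_attr_def wc by simp
      moreover have "slope_period \<tau> h \<sigma>"
      proof -
        have "?u x 0 = ?u 0 (int h * x)" for x
        proof -
          \<comment> \<open>The state is constant along the line of slope \<open>h\<close> from
            column \<open>x\<close> to column 0. Period 1 expresses this for both signs of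
            \<open>x\<close>.\<close>
          have "periodic 1 (\<lambda>y. ?u y (int h * (x - y)))"
            unfolding periodic_def
          proof
            fix y
            have "int h * (x - y) = int h * (x - (y + 1)) + int h" by (simp add: algebra_simps)
            then show "?u (y + 1) (int h * (x - (y + 1))) = ?u y (int h * (x - y))"
              using next_col[of y "int h * (x - (y + 1))"] by simp
          qed
          from periodic_mult[OF this, of 0 x] show ?thesis by simp
        qed
        then have "spatial_period (\<lambda>x. ?u 0 (int h * x)) \<sigma>" using sp by simp
        then show ?thesis unfolding slope_period_iff[OF c \<tau>] wc .
      qed
      ultimately show False using K[OF h(1)] c 3(3) unfolding has_rot_def by blast
    qed
    define R0 R1 where "R0 = range (?u 0)" and "R1 = range (?u 1)"
    have disj: "R0 \<inter> R1 = {}" using shared unfolding R0_def R1_def by blast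
    \<comment> \<open>\<open>J'\<close> collects the queries outside the rows of the first two
      columns, so the events \<open>A\<close>, \<open>B\<close> and \<open>C\<close> below read
      disjoint sets of rows.\<close>
    define J' where "J' = {j\<in>J. fst (q j) \<notin> R0 \<union> R1}"
    define A where "A = (\<lambda>f. attracts n f (?u 0) (?u 1))"
    define B where "B = (\<lambda>f. attracts n f (?u 1) (?u 2))"
    define C where "C = (\<lambda>f. \<forall>j\<in>J'. f (q j) = r j)"
    have "?P \<le> pr n (\<lambda>f. A f \<and> (B f \<and> C f))"
    proof (rule pr_mono)
      fix f assume f: "attr_tile n f \<tau> \<sigma> v \<and> \<not> has_rot K n f"
      then have "attracts n f (?u x) (?u (x + 1))" for x unfolding attr_tile_def by blast
      from this[of 0] this[of 1] show "A f \<and> (B f \<and> C f)"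
        using f ev by (simp add: A_def B_def C_def)
    qed
    also have "\<dots> = pr n A * pr n (\<lambda>f. B f \<and> C f)"
    proof (rule pr_indep[where I = "R0 \<times> UNIV"])
      fix f g :: ca_rule
      show "A (override_on f g (R0 \<times> UNIV)) = A g"
        unfolding A_def by (intro attracts_cong) (simp add: R0_def override_on_def)
      have "?u 1 i \<notin> R0" for i using disj by (auto simp: R1_def)
      then have "B (override_on f g (R0 \<times> UNIV)) = B f"
        unfolding B_def by (intro attracts_cong) (simp add: override_on_def)
      moreover have "override_on f g (R0 \<times> UNIV) (q j) = f (q j)" if "j \<in> J'" for j
        using that by (cases "q j") (auto simp: J'_def override_on_def)
      then have "C (override_on f g (R0 \<times> UNIV)) = C f" by (simp add: C_def)
      ultimately show "(B (override_on f g (R0 \<times> UNIV)) \<and> C (override_on f g (R0 \<times> UNIV))) = (B f \<and> C f)"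
        by simp
    qed
    also have "pr n (\<lambda>f. B f \<and> C f) = pr n B * pr n C"
    proof (rule pr_indep[where I = "R1 \<times> UNIV"])
      fix f g :: ca_rule
      show "B (override_on f g (R1 \<times> UNIV)) = B g"
        unfolding B_def by (intro attracts_cong) (simp add: R1_def override_on_def)
      have "override_on f g (R1 \<times> UNIV) (q j) = f (q j)" if "j \<in> J'" for j
        using that by (cases "q j") (auto simp: J'_def override_on_def)
      then show "C (override_on f g (R1 \<times> UNIV)) = C f" by (simp add: C_def)
    qed
    also have "pr n A * (pr n B * pr n C)
      \<le> ((1 / real n) ^ \<tau> * (real \<tau> / real n)) * (((1 / real n) ^ \<tau> * (real \<tau> / real n)) * (1 / real n) ^ card (q ` J'))"
    proof -
      have "pr n A = (1 / real n) ^ \<tau> * (1 - (1 - 1 / real n) ^ \<tau>)"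
        unfolding A_def using inj0
        by (intro pr_attracts \<tau> tile_periodic less) (auto simp: inj_on_def dest: inj0)
      moreover have "pr n B = (1 / real n) ^ \<tau> * (1 - (1 - 1 / real n) ^ \<tau>)"
        unfolding B_def using inj1
        by (intro pr_attracts \<tau> tile_periodic less) (auto simp: inj_on_def dest: inj1)
      moreover have "(1 / real n) ^ \<tau> * (1 - (1 - 1 / real n) ^ \<tau>) \<le> (1 / real n) ^ \<tau> * (real \<tau> / real n)"
        using survival_le[OF n, of \<tau>] by (intro mult_left_mono) auto
      ultimately have AB: "pr n A \<le> (1 / real n) ^ \<tau> * (real \<tau> / real n)"
          "pr n B \<le> (1 / real n) ^ \<tau> * (real \<tau> / real n)"
        by (simp_all only:)
      have "pr n C \<le> (1 / real n) ^ card (q ` J')"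
        unfolding C_def using q_in by (intro pr_pattern) auto
      with AB show ?thesis
        by (intro mult_mono mult_nonneg_nonneg pr_nonneg) auto
    qed
    also have "\<dots> = (1 / real n) ^ (card (q ` J') + 2 * \<tau>) * ?d"
      by (simp add: power_add mult_2 power2_eq_square)
    also have "\<dots> \<le> ?A * ?d"
    proof (intro mult_right_mono power_decreasing)
      \<comment> \<open>Equal states have equal right neighbours, so the rows in \<open>R0\<close>
        and \<open>R1\<close> contain at most \<tau> queries each. Hence \<open>J'\<close> keeps all
        but at most \<open>2 * \<tau>\<close> queries, enough to match the number of values.\<close>
      let ?Q = "\<lambda>x. (\<lambda>i. (?u x i, ?u (x + 1) i)) ` {0..<int \<tau>}"
      have row: "(?u x t, ?u (x + 1) t) \<in> ?Q y" if eq: "?u x t = ?u y s" for x t y s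
      proof -
        have "?u (x + 1) (t + 0) = ?u (y + 1) (s + 0)" by (rule inv[OF eq])
        moreover have "?u z s = ?u z (s mod int \<tau>)" for z
          using periodic_mod[OF tile_periodic, of \<tau> \<sigma> v z s] by simp
        ultimately show ?thesis using eq \<tau>
          by (intro image_eqI[where x = "s mod int \<tau>"]) auto
      qed
      have "q ` J \<subseteq> q ` J' \<union> (?Q 0 \<union> ?Q 1)"
      proof
        fix z assume "z \<in> q ` J"
        then obtain t x where tx: "(t, x) \<in> J" "z = (?u x t, ?u (x + 1) t)" by (auto simp: q_def)
        show "z \<in> q ` J' \<union> (?Q 0 \<union> ?Q 1)"
        proof (cases "?u x t \<in> R0 \<union> R1")
          case True
          then show ?thesis unfolding tx(2) R0_def R1_def using row by blast
        next
          case False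
          then have "(t, x) \<in> J'" using tx by (simp add: J'_def q_def)
          then show ?thesis using tx(2) by (auto simp: q_def intro: image_eqI[of _ _ "(t, x)"])
        qed
      qed
      moreover have "finite J'" using finJ by (simp add: J'_def)
      ultimately have "card (q ` J) \<le> card (q ` J' \<union> (?Q 0 \<union> ?Q 1))"
        by (intro card_mono) auto
      moreover have "card (?Q x) \<le> \<tau>" for x
        using card_image_le[of "{0..<int \<tau>}" "\<lambda>i. (?u x i, ?u (x + 1) i)"] by simp
      from this[of 0] this[of 1] have "card (q ` J' \<union> (?Q 0 \<union> ?Q 1)) \<le> card (q ` J') + 2 * \<tau>"
        using card_Un_le[of "q ` J'" "?Q 0 \<union> ?Q 1"] card_Un_le[of "?Q 0" "?Q 1"] by linarith
      ultimately have "card (q ` J) \<le> card (q ` J') + 2 * \<tau>" by linarith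
      moreover have "card (r ` J) \<le> card (q ` J)"
        using card_le_pattern[OF finJ, of f q r] ev[OF 3(2)] by blast
      ultimately show "card ?V \<le> card (q ` J') + 2 * \<tau>" by (simp add: rJ)
    qed (use n in auto)
    finally show ?thesis using pos' unfolding distrib_left by linarith
  qed
qed

section \<open>Asymptotics of the probability\<close>

text \<open>The constant of the theorem is the cardinality of this set.\<close>

definition slope_index :: "nat set \<Rightarrow> nat set \<Rightarrow> (nat \<times> nat) set" where
  "slope_index T S = {(\<tau>, h). \<tau> \<in> T \<and> h < \<tau> \<and> (\<exists>\<sigma>\<in>S. slope_period \<tau> h \<sigma>)}"

lemma rot_index_slope: "finite T \<Longrightarrow> rot_index (slope_index T S)"
proof -
  assume "finite T"
  then have "finite (\<Union>\<tau>\<in>T. {\<tau>} \<times> {..<\<tau>})" by blast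
  then have "finite (slope_index T S)"
    by (rule rev_finite_subset) (auto simp: slope_index_def)
  then show ?thesis by (auto simp: rot_index_def slope_index_def)
qed

text \<open>A column \<open>c\<close> and a slope \<open>h\<close> generate the solution with state
  \<open>wrap \<tau> c (t + h * x)\<close> at time \<open>t\<close> and place \<open>x\<close>. All
  its columns are rotations of \<open>c\<close>, so the one collapse makes every column attracting;
  injectivity of \<open>c\<close> makes \<tau> minimal.\<close>

lemma has_rot_WRPS:
  assumes f: "f \<in> rules n" and "has_rot (slope_index T S) n f"
  shows "WRPS n f T S \<noteq> {}"
proof -
  obtain \<tau> h c where *: "(\<tau>, h) \<in> slope_index T S" "c \<in> arr \<tau> {..<n}" "rot_attr n f \<tau> h c"
    using assms(2) unfolding has_rot_def by blast
  then obtain \<sigma> where \<sigma>: "\<tau> \<in> T" "h < \<tau>" "\<sigma> \<in> S" "slope_period \<tau> h \<sigma>" by (auto simp: slope_index_def)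
  have \<tau>: "\<tau> > 0" using \<sigma>(2) by simp
  let ?C = "wrap \<tau> c"
  have less: "?C i < n" for i using wrap_in[OF *(2) \<tau>] by auto
  define \<xi> where "\<xi> = (\<lambda>x. ?C (int h * x))"
  have rec: "f (?C i, ?C (i + int h)) = ?C (i + 1 + int h)" for i
    using *(3) by (simp add: rot_attr_def attracts_def)
  have run: "run f \<xi> t x = ?C (int t + int h * x)" for t x
  proof (induction t arbitrary: x)
    case 0
    then show ?case by (simp add: \<xi>_def)
  next
    case (Suc t)
    have "int t + int h * x = int t + int h * (x - 1) + int h"
      "int (Suc t) + int h * x = int t + int h * (x - 1) + 1 + int h"
      by (simp_all add: algebra_simps)
    then show ?case using rec[of "int t + int h * (x - 1)"] by (simp only: run_Suc Suc)
  qed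
  have conf: "\<xi> \<in> configs n" using less by (simp add: configs_def \<xi>_def)
  have sp: "spatial_period \<xi> \<sigma>"
    using \<sigma>(4) unfolding slope_period_iff[OF *(2) \<tau>] \<xi>_def .
  have run_\<tau>: "run f \<xi> \<tau> = \<xi>"
  proof
    fix x
    have "run f \<xi> \<tau> x = ?C (int h * x + int \<tau>)" using run[of \<tau> x] by (simp only: add.commute)
    also have "\<dots> = ?C (int h * x)" by (rule periodicD[OF periodic_wrap])
    finally show "run f \<xi> \<tau> x = \<xi> x" by (simp only: \<xi>_def)
  qed
  have tp: "temporal_period f \<xi> \<tau>"
    unfolding temporal_period_def
  proof (intro conjI allI impI notI \<tau> run_\<tau>)
    fix t assume t: "0 < t \<and> t < \<tau>" "run f \<xi> t = \<xi>"
    have "?C (int t) = run f \<xi> t 0" using run[of t 0] by simp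
    also have "\<dots> = ?C 0" unfolding t(2) by (simp add: \<xi>_def)
    finally have "?C (int t) = ?C 0" .
    then have "int t mod int \<tau> = 0 mod int \<tau>" unfolding wrap_inj[OF *(2) \<tau>] .
    then show False using t(1) by simp
  qed
  have diag: "diag f \<xi> \<tau> x t = ?C (t + int h * x)" for x t
  proof -
    have "diag f \<xi> \<tau> x t = ?C (t mod int \<tau> + int h * x)"
      unfolding diag_def run using \<tau> by simp
    then show ?thesis by (simp add: wrap_def mod_simps)
  qed
  have "attracts n f (diag f \<xi> \<tau> y) (diag f \<xi> \<tau> (y + 1))" for y
  proof -
    have "attracts n f (\<lambda>i. ?C (i + int h * y)) (\<lambda>i. (\<lambda>i. ?C (i + int h)) (i + int h * y))"
      using *(3) less \<tau> periodic_wrap periodic_shift[OF periodic_wrap]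
      unfolding rot_attr_def by (intro attracts_shift[OF _ f]) auto
    moreover have "(\<lambda>i. ?C (i + int h * y)) = diag f \<xi> \<tau> y"
      by (simp add: diag fun_eq_iff)
    moreover have "(\<lambda>i. (\<lambda>i. ?C (i + int h)) (i + int h * y)) = diag f \<xi> \<tau> (y + 1)"
      by (simp add: diag fun_eq_iff algebra_simps)
    ultimately show ?thesis by simp
  qed
  then have "weakly_robust n f \<xi>"
    using sp attracts_weakly_robust[OF f conf run_\<tau> \<tau>, of \<sigma>] by (auto simp: spatial_period_def)
  moreover have "is_PS n f \<tau> \<sigma> \<xi>" using conf sp tp by (simp add: is_PS_def)
  ultimately have "shift_class f \<xi> \<in> WRPS n f T S"
    using \<sigma> unfolding WRPS_def by blast
  then show ?thesis by blast
qed

definition good_tile :: "nat \<Rightarrow> nat \<Rightarrow> nat \<Rightarrow> (int \<times> int \<Rightarrow> nat) set" where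
  "good_tile n \<tau> \<sigma> = {v \<in> cells \<tau> \<sigma> \<rightarrow>\<^sub>E {..<n}. \<tau> > 0 \<and> \<sigma> > 0 \<and> primitive \<tau> (tile \<tau> \<sigma> v 0) \<and>
      spatial_period (\<lambda>x. tile \<tau> \<sigma> v x 0) \<sigma>}"

lemma finite_good_tile: "finite (good_tile n \<tau> \<sigma>)"
  unfolding good_tile_def cells_def
  by (rule finite_subset[OF Collect_subset]) (auto intro: finite_PiE)

text \<open>The weights of all tiles have a sum bounded independently of \<open>n\<close>, so the
  common factor from \<open>pr_attr_tile\<close>, which is o(1/n), survives the summation.\<close>

lemma sum_pr_attr_tile:
  assumes "\<tau> \<in> T" "\<sigma> \<in> S" "\<epsilon> > 0"
  shows "\<forall>\<^sub>F n in sequentially.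
    (\<Sum>v\<in>good_tile n \<tau> \<sigma>. pr n (\<lambda>f. attr_tile n f \<tau> \<sigma> v \<and> \<not> has_rot (slope_index T S) n f)) \<le> \<epsilon> / real n"
proof (cases "\<tau> > 0 \<and> \<sigma> > 0")
  case False
  then have "good_tile n \<tau> \<sigma> = {}" for n by (auto simp: good_tile_def)
  then show ?thesis using assms(3) by simp
next
  case True
  define W where "W = weight_bound (card (cells \<tau> \<sigma>))"
  have W0: "W \<ge> 0" by (simp add: W_def weight_bound_def)
  define \<epsilon>' where "\<epsilon>' = \<epsilon> / (2 * (W + 1))"
  have \<epsilon>': "\<epsilon>' > 0" "W * \<epsilon>' \<le> \<epsilon> / 2"
    using W0 assms(3) by (auto simp: \<epsilon>'_def field_simps)
  have fin: "finite (cells \<tau> \<sigma>)" by (simp add: cells_def)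
  have "\<forall>\<^sub>F n in sequentially. \<forall>c V. (\<forall>i. c i < n) \<and> periodic (int \<tau>) c \<and> primitive \<tau> c
      \<and> V \<subseteq> {..<n} \<and> card V \<le> card (cells \<tau> \<sigma>) \<longrightarrow> pr n (\<lambda>f. no_fresh n f c \<tau> V) \<le> \<epsilon>'"
    using True \<epsilon>'(1) by (intro pr_no_fresh) auto
  moreover have "\<forall>\<^sub>F n in sequentially. W * (real \<tau>)\<^sup>2 / real n < \<epsilon> / 2"
    using lim_const_over_n[of "W * (real \<tau>)\<^sup>2"] assms(3) by (intro order_tendstoD) auto
  ultimately show ?thesis using eventually_gt_at_top[of 0]
  proof eventually_elim
    case (elim n)
    define err where "err = \<epsilon>' / real n + (real \<tau>)\<^sup>2 / (real n)\<^sup>2"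
    have err0: "err \<ge> 0" using \<epsilon>'(1) by (simp add: err_def)
    have "(\<Sum>v\<in>good_tile n \<tau> \<sigma>. pr n (\<lambda>f. attr_tile n f \<tau> \<sigma> v \<and> \<not> has_rot (slope_index T S) n f))
      \<le> (\<Sum>v\<in>good_tile n \<tau> \<sigma>. (1 / real n) ^ card (v ` cells \<tau> \<sigma>) * err)"
    proof (rule sum_mono)
      fix v assume "v \<in> good_tile n \<tau> \<sigma>"
      then have v: "v \<in> cells \<tau> \<sigma> \<rightarrow>\<^sub>E {..<n}" "primitive \<tau> (tile \<tau> \<sigma> v 0)" "spatial_period (\<lambda>x. tile \<tau> \<sigma> v x 0) \<sigma>"
        by (auto simp: good_tile_def)
      have "\<forall>i. tile \<tau> \<sigma> v 0 i < n" using tile_in(2)[OF v(1)] True by auto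
      moreover have "v ` cells \<tau> \<sigma> \<subseteq> {..<n}" using v(1) by (auto simp: PiE_iff)
      moreover have "card (v ` cells \<tau> \<sigma>) \<le> card (cells \<tau> \<sigma>)" using fin by (rule card_image_le)
      ultimately have "pr n (\<lambda>f. no_fresh n f (tile \<tau> \<sigma> v 0) \<tau> (v ` cells \<tau> \<sigma>)) \<le> \<epsilon>'"
        using elim(1) v(2) tile_periodic by blast
      then show "pr n (\<lambda>f. attr_tile n f \<tau> \<sigma> v \<and> \<not> has_rot (slope_index T S) n f)
          \<le> (1 / real n) ^ card (v ` cells \<tau> \<sigma>) * err"
        unfolding err_def using v True \<epsilon>'(1) assms(1,2)
        by (intro pr_attr_tile) (auto simp: slope_index_def)
    qed
    also have "\<dots> = (\<Sum>v\<in>good_tile n \<tau> \<sigma>. (1 / real n) ^ card (v ` cells \<tau> \<sigma>)) * err"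
      by (simp add: sum_distrib_right)
    also have "\<dots> \<le> W * err"
    proof (rule mult_right_mono[OF _ err0])
      show "(\<Sum>v\<in>good_tile n \<tau> \<sigma>. (1 / real n) ^ card (v ` cells \<tau> \<sigma>)) \<le> W"
        unfolding W_def using elim(3) fin
        by (intro sum_weight_le[where \<phi> = "\<lambda>v. v"]) (auto simp: good_tile_def)
    qed
    also have "W * err = W * \<epsilon>' / real n + (W * (real \<tau>)\<^sup>2 / real n) / real n"
      by (simp add: err_def distrib_left power2_eq_square)
    also have "\<dots> \<le> (\<epsilon> / 2) / real n + (\<epsilon> / 2) / real n"
      using elim \<epsilon>'(2) by (intro add_mono divide_right_mono) auto
    also have "\<dots> = \<epsilon> / real n" by (simp add: field_simps)
    finally show ?case .
  qed
qed

text \<open>A union bound over tiles. Shifts of one solution are counted several times, which is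
  harmless for an upper bound.\<close>

lemma pr_WRPS_le:
  assumes "finite (T \<times> S)"
  shows "pr n (\<lambda>f. WRPS n f T S \<noteq> {}) \<le> pr n (has_rot (slope_index T S) n)
    + (\<Sum>(\<tau>, \<sigma>)\<in>T \<times> S. \<Sum>v\<in>good_tile n \<tau> \<sigma>.
        pr n (\<lambda>f. attr_tile n f \<tau> \<sigma> v \<and> \<not> has_rot (slope_index T S) n f))"
proof -
  let ?B = "\<lambda>f \<tau> \<sigma> v. attr_tile n f \<tau> \<sigma> v \<and> \<not> has_rot (slope_index T S) n f"
  have "pr n (\<lambda>f. WRPS n f T S \<noteq> {}) \<le> avg n (\<lambda>f. of_bool (has_rot (slope_index T S) n f)
    + (\<Sum>a\<in>T \<times> S. \<Sum>v\<in>good_tile n (fst a) (snd a). of_bool (?B f (fst a) (snd a) v)))"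
  proof (rule avg_mono)
    fix f assume f: "f \<in> rules n"
    have nonneg: "0 \<le> (\<Sum>a\<in>T \<times> S. \<Sum>v\<in>good_tile n (fst a) (snd a). of_bool (?B f (fst a) (snd a) v) :: real)"
      by (intro sum_nonneg) auto
    show "of_bool (WRPS n f T S \<noteq> {}) \<le> of_bool (has_rot (slope_index T S) n f)
      + (\<Sum>a\<in>T \<times> S. \<Sum>v\<in>good_tile n (fst a) (snd a). of_bool (?B f (fst a) (snd a) v) :: real)"
    proof (cases "WRPS n f T S \<noteq> {} \<and> \<not> has_rot (slope_index T S) n f")
      case False
      then show ?thesis using nonneg by auto
    next
      case True
      then obtain \<xi> \<tau> \<sigma> where *: "(\<tau>, \<sigma>) \<in> T \<times> S" "is_PS n f \<tau> \<sigma> \<xi>" "weakly_robust n f \<xi>"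
        unfolding WRPS_def by blast
      obtain v where v: "v \<in> good_tile n \<tau> \<sigma>" "attr_tile n f \<tau> \<sigma> v"
      proof (rule WRPS_tile[OF f *(2,3)])
        fix v assume "v \<in> cells \<tau> \<sigma> \<rightarrow>\<^sub>E {..<n}" "\<tau> > 0" "\<sigma> > 0" "attr_tile n f \<tau> \<sigma> v"
          "primitive \<tau> (tile \<tau> \<sigma> v 0)" "spatial_period (\<lambda>x. tile \<tau> \<sigma> v x 0) \<sigma>"
        then show thesis by (intro that[of v]) (simp_all add: good_tile_def)
      qed
      have "(1 :: real) \<le> (\<Sum>v\<in>good_tile n \<tau> \<sigma>. of_bool (?B f \<tau> \<sigma> v))"
        using member_le_sum[OF v(1), of "\<lambda>v. of_bool (?B f \<tau> \<sigma> v) :: real"] v(2) True finite_good_tile by auto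
      also have "\<dots> \<le> (\<Sum>a\<in>T \<times> S. \<Sum>v\<in>good_tile n (fst a) (snd a). of_bool (?B f (fst a) (snd a) v))"
        using member_le_sum[OF *(1), of "\<lambda>a. \<Sum>v\<in>good_tile n (fst a) (snd a). of_bool (?B f (fst a) (snd a) v) :: real"]
          assms by (simp add: sum_nonneg)
      moreover have "of_bool (WRPS n f T S \<noteq> {}) = (1 :: real)"
          "of_bool (has_rot (slope_index T S) n f) = (0 :: real)" using True by simp_all
      ultimately show ?thesis by linarith
    qed
  qed
  also have "\<dots> = pr n (has_rot (slope_index T S) n)
    + (\<Sum>a\<in>T \<times> S. \<Sum>v\<in>good_tile n (fst a) (snd a). pr n (\<lambda>f. ?B f (fst a) (snd a) v))"
    by (simp only: avg_add avg_sum)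
  finally show ?thesis by (simp only: case_prod_unfold)
qed

theorem theorem1p1:
  fixes T S :: "nat set"
  assumes "T \<subseteq> {1..}" and "S \<subseteq> {1..}"
    and "finite (T \<times> S)"
    and "\<exists>(\<tau>, \<sigma>) \<in> T \<times> S. \<sigma> dvd \<tau>"
  shows "\<exists>c::real.
    (\<lambda>n. measure_pmf.prob (random_rule n) {f. WRPS n f T S \<noteq> {}} - c / real n)
      \<in> o[sequentially](\<lambda>n. 1 / real n)"
proof -
  let ?K = "slope_index T S"
  define P where "P = (\<lambda>n. pr n (\<lambda>f. WRPS n f T S \<noteq> {}))"
  define bad where "bad = (\<lambda>n. \<Sum>(\<tau>, \<sigma>)\<in>T \<times> S. \<Sum>v\<in>good_tile n \<tau> \<sigma>.
        pr n (\<lambda>f. attr_tile n f \<tau> \<sigma> v \<and> \<not> has_rot ?K n f))"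
  have "S \<noteq> {}" using assms(4) by auto
  then have "finite T" using assms(3) by (auto simp: finite_cartesian_product_iff)
  then have lim: "(\<lambda>n. real n * pr n (has_rot ?K n)) \<longlonglongrightarrow> real (card ?K)"
    by (intro pr_has_rot_lim rot_index_slope)
  have bad0: "0 \<le> bad n" for n unfolding bad_def by (intro sum_nonneg) (auto intro: sum_nonneg)
  have "(\<lambda>n. real n * bad n) \<longlonglongrightarrow> 0"
  proof (rule LIMSEQ_I)
    fix \<epsilon> :: real assume \<epsilon>: "\<epsilon> > 0"
    \<comment> \<open>The added 1 makes \<open>D\<close> positive and the final estimate
      \<open>(D - 1) * (\<epsilon> / D) < \<epsilon>\<close> strict.\<close>
    define D where "D = real (card (T \<times> S)) + 1"
    have D: "D > 0" by (simp add: D_def)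
    have "\<forall>\<^sub>F n in sequentially. \<forall>a\<in>T \<times> S. (\<Sum>v\<in>good_tile n (fst a) (snd a).
        pr n (\<lambda>f. attr_tile n f (fst a) (snd a) v \<and> \<not> has_rot ?K n f)) \<le> (\<epsilon> / D) / real n"
      using assms(3) \<epsilon> D by (intro eventually_ball_finite ballI sum_pr_attr_tile) auto
    then have "\<forall>\<^sub>F n in sequentially. norm (real n * bad n - 0) < \<epsilon>"
      using eventually_gt_at_top[of 0]
    proof eventually_elim
      case (elim n)
      have "bad n \<le> (\<Sum>a\<in>T \<times> S. (\<epsilon> / D) / real n)"
        unfolding bad_def case_prod_unfold using elim(1) by (intro sum_mono) blast
      also have "\<dots> = (D - 1) * ((\<epsilon> / D) / real n)" by (simp add: D_def)
      finally have "real n * bad n \<le> real n * ((D - 1) * ((\<epsilon> / D) / real n))"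
        by (intro mult_left_mono) auto
      also have "\<dots> = (D - 1) * (\<epsilon> / D)" using elim(2) by simp
      also have "\<dots> < \<epsilon>" using \<epsilon> D by (simp add: field_simps)
      finally show ?case using bad0[of n] by simp
    qed
    then show "\<exists>no. \<forall>n\<ge>no. norm (real n * bad n - 0) < \<epsilon>" by (simp add: eventually_sequentially)
  qed
  from tendsto_add[OF lim this]
  have lim': "(\<lambda>n. real n * pr n (has_rot ?K n) + real n * bad n) \<longlonglongrightarrow> real (card ?K)" by simp
  have "(\<lambda>n. real n * P n) \<longlonglongrightarrow> real (card ?K)"
  proof (rule tendsto_sandwich[OF _ _ lim lim'])
    have "pr n (has_rot ?K n) \<le> P n" for n
      unfolding P_def using has_rot_WRPS by (intro pr_mono) blast
    then show "\<forall>\<^sub>F n in sequentially. real n * pr n (has_rot ?K n) \<le> real n * P n"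
      by (intro always_eventually allI mult_left_mono) auto
    have "P n \<le> pr n (has_rot ?K n) + bad n" for n
      unfolding P_def bad_def by (rule pr_WRPS_le[OF assms(3)])
    then show "\<forall>\<^sub>F n in sequentially. real n * P n \<le> real n * pr n (has_rot ?K n) + real n * bad n"
      unfolding distrib_left[symmetric] by (intro always_eventually allI mult_left_mono) auto
  qed
  then have "(\<lambda>n. real n * P n - real (card ?K)) \<longlonglongrightarrow> 0"
    using tendsto_diff[OF _ tendsto_const, of _ "real (card ?K)" _ "real (card ?K)"] by fastforce
  moreover have "\<forall>\<^sub>F n in sequentially. (P n - real (card ?K) / real n) / (1 / real n) = real n * P n - real (card ?K)"
    using eventually_gt_at_top[of 0] by eventually_elim (simp add: field_simps)
  ultimately have "(\<lambda>n. (P n - real (card ?K) / real n) / (1 / real n)) \<longlonglongrightarrow> 0"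
    by (simp add: tendsto_cong)
  then have "(\<lambda>n. P n - real (card ?K) / real n) \<in> o[sequentially](\<lambda>n. 1 / real n)"
    by (rule smalloI_tendsto) (use eventually_gt_at_top[of 0] in eventually_elim, simp)
  then show ?thesis unfolding prob_random_rule P_def by blast
qed

end
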